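(* Let $k, \ell$ be integers such that $2 \le \ell < k$ and let $r \ge 2$ be an integer. Then there exist constants $c, C > 0$ such that, for $p = p(n)$, $$\lim_{n\to\infty}\Pr\big[\text{every colouring of the edges of } G^{(\ell)}(n,p) \text{ with } r \text{ colours contains a monochromatic copy of } K_k^{(\ell)}\big] = \begin{cases} 1, & \text{if } p \ge C n^{-1/m_\ell(K_k^{(\ell)})},\\ 0, & \text{if } p \le c n^{-1/m_\ell(K_k^{(\ell)})}.\end{cases}$$
   Context: An $\ell$-graph is an $\ell$-uniform hypergraph $(V,E)$ with $E \subseteq \binom{V}{\ell}$; $v(\cdot)$ and $e(\cdot)$ denote numbers of vertices and edges. $K_k^{(\ell)}$ is the complete $\ell$-graph on $k$ vertices. $G^{(\ell)}(n,p)$ is the binomial random $\ell$-graph on $n$ vertices: each $\ell$-subset of the vertex set is an edge independently with probability $p$. A copy of $F$ in $G$ is a subgraph of $G$ isomorphic to $F$; it is monochromatic if all its edges have the same colour. For an $\ell$-graph $G$ on at least $\ell+1$ vertices, $d_\ell(G) := (e(G)-1)/(v(G)-\ell)$ and $m_\ell(G) := \max\{d_\ell(J) : J \subseteq G,\ v(J) \ge \ell+1\}$. *)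

theory Defs
  imports "HOL-Probability.Probability" "HOL-Library.Ramsey"
begin

record 'a hypergraph =
  verts :: "'a set"
  edges :: "'a set set"

definition uniform_hypergraph :: "nat \<Rightarrow> 'a hypergraph \<Rightarrow> bool" where
  "uniform_hypergraph l G \<longleftrightarrow> finite (verts G) \<and> edges G \<subseteq> nsets (verts G) l"

definition subgraph :: "nat \<Rightarrow> 'a hypergraph \<Rightarrow> 'a hypergraph \<Rightarrow> bool" where
  "subgraph l H G \<longleftrightarrow> uniform_hypergraph l H \<and> verts H \<subseteq> verts G \<and> edges H \<subseteq> edges G"

definition isomorphic :: "'a hypergraph \<Rightarrow> 'b hypergraph \<Rightarrow> bool" where
  "isomorphic F H \<longleftrightarrow>
     (\<exists>f. bij_betw f (verts F) (verts H) \<and> edges H = (\<lambda>e. f ` e) ` edges F)"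

definition is_copy :: "nat \<Rightarrow> 'b hypergraph \<Rightarrow> 'a hypergraph \<Rightarrow> 'a hypergraph \<Rightarrow> bool" where
  "is_copy l F G H \<longleftrightarrow> subgraph l H G \<and> isomorphic F H"

definition complete_hypergraph :: "nat \<Rightarrow> nat \<Rightarrow> nat hypergraph" where
  "complete_hypergraph l k = \<lparr>verts = {..<k}, edges = nsets {..<k} l\<rparr>"

definition l_density :: "nat \<Rightarrow> 'a hypergraph \<Rightarrow> real" where
  "l_density l G = (real (card (edges G)) - 1) / (real (card (verts G)) - real l)"

text \<open>Only meaningful for finite \<open>G\<close> with at least \<open>l + 1\<close> vertices, so that the maximum
  is taken over a finite nonempty set.\<close>
definition max_l_density :: "nat \<Rightarrow> 'a hypergraph \<Rightarrow> real" where
  "max_l_density l G = Max {l_density l J |J. subgraph l J G \<and> card (verts J) \<ge> l + 1}"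

lemma finite_l_densities:
  assumes "uniform_hypergraph l G"
  shows "finite {l_density l J |J. subgraph l J G \<and> card (verts J) \<ge> l + 1}"
proof -
  have fin: "finite (verts G)" "finite (edges G)"
    using assms finite_imp_finite_nsets finite_subset
    by (auto simp: uniform_hypergraph_def)
  have "{l_density l J |J. subgraph l J G \<and> card (verts J) \<ge> l + 1}
      \<subseteq> (\<lambda>(V, E). l_density l \<lparr>verts = V, edges = E\<rparr>) ` (Pow (verts G) \<times> Pow (edges G))"
    by (force simp: subgraph_def l_density_def)
  then show ?thesis
    by (rule finite_subset) (use fin in simp)
qed

lemma l_densities_nonempty:
  assumes "uniform_hypergraph l G" and "card (verts G) \<ge> l + 1"
  shows "{l_density l J |J. subgraph l J G \<and> card (verts J) \<ge> l + 1} \<noteq> {}"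
  using assms by (auto simp: subgraph_def)

lemma uniform_complete_hypergraph: "uniform_hypergraph l (complete_hypergraph l k)"
  by (simp add: uniform_hypergraph_def complete_hypergraph_def)

definition random_hypergraph :: "nat \<Rightarrow> nat \<Rightarrow> real \<Rightarrow> nat hypergraph pmf" where
  "random_hypergraph l n p =
     map_pmf (\<lambda>X. \<lparr>verts = {..<n}, edges = {e \<in> nsets {..<n} l. X e}\<rparr>)
       (Pi_pmf (nsets {..<n} l) False (\<lambda>_. bernoulli_pmf p))"

definition monochromatic :: "('a set \<Rightarrow> nat) \<Rightarrow> 'a hypergraph \<Rightarrow> bool" where
  "monochromatic col H \<longleftrightarrow> (\<exists>i. \<forall>e \<in> edges H. col e = i)"

definition ramsey_for :: "nat \<Rightarrow> nat \<Rightarrow> 'b hypergraph \<Rightarrow> 'a hypergraph \<Rightarrow> bool" where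
  "ramsey_for l r F G \<longleftrightarrow>
     (\<forall>col \<in> edges G \<rightarrow> {..<r}. \<exists>H. is_copy l F G H \<and> monochromatic col H)"

end

theory Submission
  imports Defs "HOL-Real_Asymp.Real_Asymp"
begin

text \<open>
  Write \<open>s = k choose l\<close> and \<open>m = (s - 1) / (k - l)\<close>, the \<open>l\<close>-density of the complete \<open>l\<close>-graph on
  \<open>k\<close> vertices.

  For the 1-statement (after Nenadov and Steger), consider the \<open>s\<close>-uniform hypergraph whose vertices
  are the \<open>l\<close>-subsets of \<open>{..<n}\<close> and whose edges are the copies of the clique. By a container theorem,
  every clique-free \<open>l\<close>-graph lies in a container with few cliques that is determined by a fingerprint
  of \<open>O(n powr (l - 1 / m))\<close> edges. If the random \<open>l\<close>-graph is not Ramsey, each colour class has a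
  container; by Ramsey's theorem and averaging, \<open>r\<close> containers miss a positive fraction of all
  \<open>l\<close>-sets, and the random \<open>l\<close>-graph has to avoid all of these. The union bound over the fingerprints
  is affordable when \<open>C\<close> is large.

  For the 0-statement, an \<open>l\<close>-graph that is edge-minimal without a good 2-colouring is connected
  through cliques, has every edge in two cliques, and has more than \<open>m\<close> times as many edges as
  vertices. Exploring it clique by clique, the expected number of explorations is geometrically
  small in the number of regular steps (the new clique meets the old ones in one edge), while every
  degenerate step gains a power of \<open>n\<close>. Hence a first moment computation rules out explorations
  of logarithmic length, those with many degenerate steps, and those that exhaust a minimal
  \<open>l\<close>-graph.
\<close>

section \<open>Cliques and random hypergraphs\<close>

text \<open>Both halves rest on one fact: \<open>clique_ratio l u\<close> increases strictly in u,
  so the clique is denser than its smaller subcliques. This gives the degree condition of the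
  container theorem with Q = n powr (1 / m), the reciprocal of the threshold, and it gives the gain
  of degenerate steps. For p = C / Q the random graph has about C N / Q edges, N = n choose l, while
  fingerprints have O(N / Q) elements; hence a constant C outweighs the entropy of the union bound.
  The 0-statement meets two obstacles. A minimal hypergraph without a good 2-colouring may exceed
  density m only slightly, which gains a small power of n; explorations are cut at logarithmic
  length so that the other losses stay polylogarithmic. And a free choice of the edge of attachment
  costs a factor that grows with the length, so only boundedly many steps may have it. That the
  density exceeds m comes from the degree bound ((k - 1) choose (l - 1))^2. For k = l + 1 this bound
  gives only a weak inequality, and the case of equality has to be excluded, for triangles by a
  separate argument.\<close>

lemma card_nsets: "finite A \<Longrightarrow> card (nsets A l) = card A choose l"
proof -
  assume A: "finite A"
  then have "nsets A l = {B. B \<subseteq> A \<and> card B = l}" by (auto simp: nsets_def intro: finite_subset)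
  then show ?thesis using n_subsets[OF A] by simp
qed

lemma choose_le_power: "n choose j \<le> n ^ j"
proof -
  have "(n choose j) * 1 \<le> (n choose j) * fact j" by (intro mult_left_mono) simp_all
  also have "\<dots> \<le> n ^ j" by (rule binomial_fact_pow)
  finally show ?thesis by simp
qed

lemma finite_subset_nsets: "G \<subseteq> nsets A j \<Longrightarrow> finite A \<Longrightarrow> finite G"
  using finite_imp_finite_nsets finite_subset by blast

lemma isomorphic_complete_iff:
  fixes H :: "'a hypergraph"
  assumes "finite (verts H)"
  shows "isomorphic (complete_hypergraph l k) H \<longleftrightarrow> card (verts H) = k \<and> edges H = nsets (verts H) l"
proof
  assume "isomorphic (complete_hypergraph l k) H"
  then obtain f where f: "bij_betw f {..<k} (verts H)" "edges H = (\<lambda>e. f ` e) ` nsets {..<k} l"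
    by (auto simp: isomorphic_def complete_hypergraph_def)
  have "card (verts H) = k" using bij_betw_same_card[OF f(1)] by simp
  moreover have "edges H = nsets (verts H) l"
    using bij_betw_nsets[OF f(1), of l] f(2) by (simp add: bij_betw_def)
  ultimately show "card (verts H) = k \<and> edges H = nsets (verts H) l" by simp
next
  assume H: "card (verts H) = k \<and> edges H = nsets (verts H) l"
  then obtain f where f: "bij_betw f {..<k} (verts H)"
    using assms ex_bij_betw_nat_finite[of "verts H"] by (auto simp: atLeast0LessThan)
  then have "edges H = (\<lambda>e. f ` e) ` nsets {..<k} l"
    using bij_betw_nsets[OF f, of l] H by (simp add: bij_betw_def)
  with f show "isomorphic (complete_hypergraph l k) H"
    by (auto simp: isomorphic_def complete_hypergraph_def)
qed

abbreviation arrows :: "nat \<Rightarrow> nat \<Rightarrow> nat \<Rightarrow> 'a set \<Rightarrow> 'a set set \<Rightarrow> bool" where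
  "arrows l r k V E \<equiv> ramsey_for l r (complete_hypergraph l k) \<lparr>verts = V, edges = E\<rparr>"

abbreviation ramsey_prob :: "nat \<Rightarrow> nat \<Rightarrow> nat \<Rightarrow> nat \<Rightarrow> real \<Rightarrow> real" where
  "ramsey_prob l r k n p \<equiv>
    measure_pmf.prob (random_hypergraph l n p) {G. ramsey_for l r (complete_hypergraph l k) G}"

lemma ramsey_for_complete_iff:
  fixes V :: "'a set"
  assumes "finite V"
  shows "arrows l r k V E \<longleftrightarrow>
    (\<forall>col\<in>E \<rightarrow> {..<r}. \<exists>K\<in>nsets V k. nsets K l \<subseteq> E \<and> (\<exists>i. \<forall>e\<in>nsets K l. col e = i))"
proof -
  have "(\<exists>H. is_copy l (complete_hypergraph l k) \<lparr>verts = V, edges = E\<rparr> H \<and> monochromatic col H) \<longleftrightarrow>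
    (\<exists>K\<in>nsets V k. nsets K l \<subseteq> E \<and> (\<exists>i. \<forall>e\<in>nsets K l. col e = i))" for col
  proof
    assume "\<exists>H. is_copy l (complete_hypergraph l k) \<lparr>verts = V, edges = E\<rparr> H \<and> monochromatic col H"
    then obtain H where H: "subgraph l H \<lparr>verts = V, edges = E\<rparr>" "isomorphic (complete_hypergraph l k) H"
      "monochromatic col H" by (auto simp: is_copy_def)
    from H(1) have "finite (verts H)" by (simp add: subgraph_def uniform_hypergraph_def)
    with H show "\<exists>K\<in>nsets V k. nsets K l \<subseteq> E \<and> (\<exists>i. \<forall>e\<in>nsets K l. col e = i)"
      by (intro bexI[of _ "verts H"])
        (auto simp: isomorphic_complete_iff subgraph_def monochromatic_def nsets_def)
  next
    assume "\<exists>K\<in>nsets V k. nsets K l \<subseteq> E \<and> (\<exists>i. \<forall>e\<in>nsets K l. col e = i)"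
    then obtain K where K: "K \<in> nsets V k" "nsets K l \<subseteq> E" "\<exists>i. \<forall>e\<in>nsets K l. col e = i" by blast
    then have "finite K" "card K = k" "K \<subseteq> V" by (auto simp: nsets_def)
    then have "is_copy l (complete_hypergraph l k) \<lparr>verts = V, edges = E\<rparr> \<lparr>verts = K, edges = nsets K l\<rparr>"
      using K(2) by (simp add: is_copy_def subgraph_def uniform_hypergraph_def isomorphic_complete_iff)
    moreover have "monochromatic col \<lparr>verts = K, edges = nsets K l\<rparr>"
      using K(3) by (simp add: monochromatic_def)
    ultimately show "\<exists>H. is_copy l (complete_hypergraph l k) \<lparr>verts = V, edges = E\<rparr> H \<and> monochromatic col H"
      by blast
  qed
  then show ?thesis by (simp add: ramsey_for_def)
qed

lemma prob_bernoulli_cylinder: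
  assumes fin: "finite V" and sub: "A \<subseteq> V" "B \<subseteq> V" and disj: "A \<inter> B = {}"
    and p: "0 \<le> p" "p \<le> 1"
  shows "measure_pmf.prob (Pi_pmf V False (\<lambda>_. bernoulli_pmf p))
    {X. (\<forall>e\<in>A. X e) \<and> (\<forall>e\<in>B. \<not> X e)} = p ^ card A * (1 - p) ^ card B"
proof -
  define P where "P = (\<lambda>e. if e \<in> A then {True} else if e \<in> B then {False} else UNIV)"
  have eq: "{X. (\<forall>e\<in>A. X e) \<and> (\<forall>e\<in>B. \<not> X e)} = Pi V P"
    using sub disj by (fastforce simp: P_def Pi_def split: if_splits)
  have "measure_pmf.prob (Pi_pmf V False (\<lambda>_. bernoulli_pmf p)) (Pi V P)
      = (\<Prod>e\<in>V. measure_pmf.prob (bernoulli_pmf p) (P e))"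
    by (rule measure_Pi_pmf_Pi[OF fin])
  also have "\<dots> = (\<Prod>e\<in>V. (if e \<in> A then p else 1) * (if e \<in> B then 1 - p else 1))"
    using disj p by (intro prod.cong) (auto simp: P_def measure_pmf_single)
  also have "\<dots> = p ^ card A * (1 - p) ^ card B"
    using fin sub by (simp add: prod.distrib prod.If_cases Int_absorb1)
  finally show ?thesis using eq by simp
qed

lemma prob_random_hypergraph:
  "measure_pmf.prob (random_hypergraph l n p) {G. P G} =
   measure_pmf.prob (Pi_pmf (nsets {..<n} l) False (\<lambda>_. bernoulli_pmf p))
     {X. P \<lparr>verts = {..<n}, edges = {e \<in> nsets {..<n} l. X e}\<rparr>}"
  by (simp add: random_hypergraph_def vimage_def)

section \<open>Strict balancedness of the complete hypergraph\<close>

definition clique_ratio :: "nat \<Rightarrow> nat \<Rightarrow> real" where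
  "clique_ratio l u = (real (u choose l) - 1) / (real u - real l)"

text \<open>Write d = u - l, b = u choose l and a = u choose (l - 1). By Pascal's rule,
  cross-multiplication leaves b - 1 < a d. The absorption identity b l = a (d + 1) and d + 1 \<le> l
  d, which holds for l \<ge> 2 and d \<ge> 1, give even b \<le> a d.\<close>

lemma clique_ratio_Suc:
  assumes l: "2 \<le> l" and u: "l < u"
  shows "clique_ratio l u < clique_ratio l (Suc u)"
proof -
  obtain l' where l': "l = Suc l'" using l by (cases l) auto
  define a where "a = real (u choose l')"
  define b where "b = real (u choose l)"
  have ab: "b * real l = a * (real u - real l + 1)"
  proof -
    have "(u choose Suc l') * Suc l' = (u choose l') * (u - l')"
      using binomial_absorption[of l' u] binomial_absorb_comp[of u l'] by (simp add: mult.commute)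
    then have "b * real l = a * real (u - l')"
      unfolding a_def b_def l' by (metis of_nat_mult)
    moreover have "real (u - l') = real u - real l + 1" using u l' by (simp add: of_nat_diff)
    ultimately show ?thesis by simp
  qed
  have a: "a \<ge> 0" by (simp add: a_def)
  have "b * real l \<le> a * (real u - real l) * real l"
  proof -
    have "real l * (real u - real l) \<ge> real u - real l + 1"
    proof -
      have "2 * (real u - real l) \<le> real l * (real u - real l)" using l u by (intro mult_right_mono) auto
      moreover have "real u - real l + 1 \<le> 2 * (real u - real l)" using u by simp
      ultimately show ?thesis by (rule order.trans[rotated])
    qed
    then have "a * (real u - real l + 1) \<le> a * (real l * (real u - real l))"
      using a by (intro mult_left_mono)
    then show ?thesis using ab by (simp add: mult_ac)
  qed
  then have "b \<le> a * (real u - real l)" using l by simp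
  then have "(b - 1) * (real u - real l + 1) < (a + b - 1) * (real u - real l)"
    by (simp add: algebra_simps)
  moreover have "real (Suc u choose l) = a + b" by (simp add: a_def b_def l')
  ultimately show ?thesis using u
    by (simp add: clique_ratio_def b_def[symmetric] field_simps)
qed

lemma clique_ratio_less:
  assumes l: "2 \<le> l" and u: "l < u" and k: "u < k"
  shows "clique_ratio l u < clique_ratio l k"
proof -
  have "clique_ratio l (Suc u + i) > clique_ratio l u" for i
  proof (induction i)
    case 0
    then show ?case using clique_ratio_Suc[OF l u] by simp
  next
    case (Suc i)
    have "clique_ratio l (Suc u + i) < clique_ratio l (Suc (Suc u + i))"
      by (rule clique_ratio_Suc[OF l]) (use u in simp)
    with Suc show ?case by simp
  qed
  from this[of "k - Suc u"] k show ?thesis by simp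
qed

text \<open>Explorations need strict balancedness over the naturals, where a strict inequality is a
  surplus of at least one; this surplus is the gain of a degenerate step.\<close>

lemma clique_edges_less:
  assumes l: "2 \<le> l" and u: "l < u" and k: "u < k"
  shows "((u choose l) - 1) * (k - l) < ((k choose l) - 1) * (u - l)"
proof -
  have "1 \<le> u choose l" "1 \<le> k choose l" using u k by (simp_all add: Suc_le_eq)
  then have "real (((u choose l) - 1) * (k - l)) = (real (u choose l) - 1) * (real k - real l)"
    "real (((k choose l) - 1) * (u - l)) = (real (k choose l) - 1) * (real u - real l)"
    using u k by (simp_all add: of_nat_diff)
  moreover have "(real (u choose l) - 1) * (real k - real l) < (real (k choose l) - 1) * (real u - real l)"
    using clique_ratio_less[OF assms] u k by (simp add: clique_ratio_def field_simps)
  ultimately show ?thesis using of_nat_less_iff by metis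
qed

text \<open>Among subgraphs on u vertices the complete one is densest, and monotonicity of
  \<open>clique_ratio\<close> then puts the maximum at u = k.\<close>

lemma max_l_density_complete:
  assumes l: "2 \<le> l" and k: "l < k"
  shows "max_l_density l (complete_hypergraph l k) = clique_ratio l k"
  unfolding max_l_density_def
proof (rule Max_eqI)
  show "finite {l_density l J |J. subgraph l J (complete_hypergraph l k) \<and> card (verts J) \<ge> l + 1}"
    by (rule finite_l_densities[OF uniform_complete_hypergraph])
  show "clique_ratio l k \<in> {l_density l J |J. subgraph l J (complete_hypergraph l k) \<and> card (verts J) \<ge> l + 1}"
    using k uniform_complete_hypergraph[of l k]
    by (auto simp: subgraph_def clique_ratio_def l_density_def
      complete_hypergraph_def card_nsets intro!: exI[of _ "complete_hypergraph l k"])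
  fix d assume "d \<in> {l_density l J |J. subgraph l J (complete_hypergraph l k) \<and> card (verts J) \<ge> l + 1}"
  then obtain J where J: "d = l_density l J" "subgraph l J (complete_hypergraph l k)" "card (verts J) \<ge> l + 1"
    by blast
  then have fin: "finite (verts J)" and "edges J \<subseteq> nsets (verts J) l" and "verts J \<subseteq> {..<k}"
    by (auto simp: subgraph_def uniform_hypergraph_def complete_hypergraph_def)
  then have "card (edges J) \<le> card (verts J) choose l" and vk: "card (verts J) \<le> k"
    using card_mono[OF finite_imp_finite_nsets] card_nsets card_mono[of "{..<k}"]
    by (metis, fastforce)
  then have "d \<le> clique_ratio l (card (verts J))"
    unfolding J l_density_def clique_ratio_def using J(3) by (intro divide_right_mono) auto
  also have "\<dots> \<le> clique_ratio l k"
    using clique_ratio_less[OF l, of "card (verts J)" k] vk J(3) by (cases "card (verts J) = k") auto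
  finally show "d \<le> clique_ratio l k" .
qed

lemma choose_ge_self:
  assumes "1 \<le> l" "l < k"
  shows "k \<le> k choose l"
  using assms
proof (induction k arbitrary: l)
  case (Suc k)
  obtain l' where l': "l = Suc l'" using Suc.prems by (cases l) auto
  show ?case
  proof (cases "k = l")
    case False
    then have "k \<le> k choose l" using Suc by simp
    moreover have "1 \<le> k choose l'" using Suc.prems l' by (simp add: Suc_le_eq)
    ultimately show ?thesis by (simp add: l')
  qed simp
qed simp

lemma Union_nsets:
  assumes "finite K" "1 \<le> l" "l \<le> card K"
  shows "\<Union>(nsets K l) = K"
proof
  show "K \<subseteq> \<Union>(nsets K l)"
  proof
    fix x assume x: "x \<in> K"
    have "l - 1 \<le> card (K - {x})" using x assms by simp
    then obtain e where e: "e \<subseteq> K - {x}" "card e = l - 1" "finite e"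
      using obtain_subset_with_card_n by metis
    then have "insert x e \<in> nsets K l" using x assms by (auto simp: nsets_def card_insert_if)
    then show "x \<in> \<Union>(nsets K l)" by blast
  qed
qed (auto simp: nsets_def)

text \<open>A clique is recovered as the union of its edges. Cliques may therefore be counted as
  k-sets of vertices or as sets of edges.\<close>

lemma inj_on_nsets_right:
  assumes "1 \<le> l" "l \<le> k"
  shows "inj_on (\<lambda>K. nsets K l) (nsets V k)"
proof (rule inj_on_inverseI[where g = Union])
  fix K assume "K \<in> nsets V k"
  then have "finite K" "card K = k" by (auto simp: nsets_def)
  then show "\<Union>(nsets K l) = K" using Union_nsets[of K l] assms by simp
qed

section \<open>Hypergraph containers\<close>

definition hdeg :: "'a set set \<Rightarrow> 'a set \<Rightarrow> nat" where
  "hdeg G T = card {E \<in> G. T \<subseteq> E}"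

text \<open>\<open>S\<close> is a fingerprint of \<open>I\<close> and \<open>f S\<close> its container. Everything is relative to \<open>A\<close>, so that
  containers can be built by a decision tree that queries the vertices one by one and spends one
  unit of the budget \<open>b\<close> whenever the queried vertex belongs to \<open>I\<close>.\<close>

definition fingerprint :: "('a set \<Rightarrow> bool) \<Rightarrow> 'a set \<Rightarrow> real \<Rightarrow> ('a set \<Rightarrow> 'a set) \<Rightarrow> 'a set \<Rightarrow> 'a set \<Rightarrow> bool" where
  "fingerprint good A b f I S \<longleftrightarrow>
     S \<subseteq> I \<inter> A \<and> real (card S) \<le> b \<and> f S \<subseteq> A \<and> I \<inter> A \<subseteq> S \<union> f S \<and> good (f S)"

text \<open>The order of the quantifiers carries the content: \<open>f\<close> is fixed before
  \<open>I\<close>, so there are at most as many containers as fingerprints. The family is a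
  parameter because a query splits it into the sets with and those without the queried
  vertex.\<close>

definition containable :: "('a set \<Rightarrow> bool) \<Rightarrow> 'a set \<Rightarrow> real \<Rightarrow> 'a set set \<Rightarrow> bool" where
  "containable good A b \<I> \<longleftrightarrow> (\<exists>f. \<forall>I\<in>\<I>. \<exists>S. fingerprint good A b f I S)"

lemma containable_mono:
  assumes "containable good A b \<I>" "b \<le> b'" "\<I>' \<subseteq> \<I>"
  shows "containable good A b' \<I>'"
proof -
  from assms(1) obtain f where f: "\<forall>I\<in>\<I>. \<exists>S. fingerprint good A b f I S"
    unfolding containable_def ..
  have "fingerprint good A b' f I S" if "fingerprint good A b f I S" for I S
    using that assms(2) by (simp add: fingerprint_def)
  with f assms(3) show ?thesis unfolding containable_def by blast
qed

lemma containable_good_mono: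
  assumes "containable good A b \<I>" "\<And>C. good C \<Longrightarrow> good' C"
  shows "containable good' A b \<I>"
proof -
  from assms(1) obtain f where f: "\<forall>I\<in>\<I>. \<exists>S. fingerprint good A b f I S"
    unfolding containable_def ..
  have "fingerprint good' A b f I S" if "fingerprint good A b f I S" for I S
    using that assms(2) by (simp add: fingerprint_def)
  with f show ?thesis unfolding containable_def by blast
qed

lemma containable_stop:
  assumes "good A" "0 \<le> b"
  shows "containable good A b \<I>"
proof -
  have "fingerprint good A b (\<lambda>_. A) I {}" for I
    using assms by (simp add: fingerprint_def)
  then show ?thesis unfolding containable_def by blast
qed

text \<open>Vertices of \<open>A\<close> outside every member of the family can leave
  \<open>A\<close> without being queried, hence without cost. Forbidden singletons are exploited in
  this way.\<close>

lemma containable_drop: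
  assumes "containable good A' b \<I>" "A' \<subseteq> A" "\<And>I. I \<in> \<I> \<Longrightarrow> I \<inter> A \<subseteq> A'"
  shows "containable good A b \<I>"
proof -
  from assms(1) obtain f where f: "\<forall>I\<in>\<I>. \<exists>S. fingerprint good A' b f I S"
    unfolding containable_def ..
  have "fingerprint good A b f I S" if "I \<in> \<I>" "fingerprint good A' b f I S" for I S
  proof -
    have "I \<inter> A = I \<inter> A'" using assms(2,3) that(1) by blast
    then show ?thesis using that(2) assms(2) by (auto simp: fingerprint_def)
  qed
  with f show ?thesis unfolding containable_def by blast
qed

text \<open>One node of the decision tree. The fingerprint contains \<open>v\<close> exactly if
  \<open>I\<close> does, so \<open>f\<close> can read the branch off \<open>S\<close> and call the
  function of that branch.\<close>

lemma containable_query: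
  assumes fin: "finite A" and v: "v \<in> A"
    and no: "containable good (A - {v}) b {I \<in> \<I>. v \<notin> I}"
    and yes: "containable good (A - {v}) (b - 1) {I \<in> \<I>. v \<in> I}"
  shows "containable good A b \<I>"
proof -
  from no obtain f0 where f0: "\<forall>I\<in>{I \<in> \<I>. v \<notin> I}. \<exists>S. fingerprint good (A - {v}) b f0 I S"
    unfolding containable_def ..
  from yes obtain f1 where f1: "\<forall>I\<in>{I \<in> \<I>. v \<in> I}. \<exists>S. fingerprint good (A - {v}) (b - 1) f1 I S"
    unfolding containable_def ..
  define f where "f = (\<lambda>S. if v \<in> S then f1 (S - {v}) else f0 S)"
  have "\<exists>S. fingerprint good A b f I S" if I: "I \<in> \<I>" for I
  proof (cases "v \<in> I")
    case True
    then obtain S where S: "fingerprint good (A - {v}) (b - 1) f1 I S" using f1 I by blast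
    then have sub: "S \<subseteq> I \<inter> (A - {v})" by (simp add: fingerprint_def)
    then have "v \<notin> S" "finite S" using fin by (auto intro: finite_subset)
    then have "f (insert v S) = f1 S" "card (insert v S) = Suc (card S)"
      by (simp_all add: f_def)
    then have "fingerprint good A b f I (insert v S)"
      using S True v by (auto simp: fingerprint_def)
    then show ?thesis ..
  next
    case False
    then obtain S where S: "fingerprint good (A - {v}) b f0 I S" using f0 I by blast
    then have "v \<notin> S" by (auto simp: fingerprint_def)
    then have "f S = f0 S" by (auto simp: f_def)
    then have "fingerprint good A b f I S"
      using S False by (auto simp: fingerprint_def)
    then show ?thesis ..
  qed
  then show ?thesis unfolding containable_def by blast
qed

text \<open>A set \<open>T\<close> is saturated when its degree in the \<open>j\<close>-uniform \<open>G'\<close> is at least \<open>Q powr (j - card T)\<close>.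
  Edges that contain a saturated set are ignored, which keeps the degrees of \<open>G'\<close> under control.\<close>

definition alive :: "real \<Rightarrow> nat \<Rightarrow> 'a set \<Rightarrow> 'a set set \<Rightarrow> 'a set \<Rightarrow> bool" where
  "alive Q j A G' E \<longleftrightarrow> E \<subseteq> A \<and> (\<forall>T\<subseteq>E. T \<noteq> {} \<longrightarrow> real (hdeg G' T) * Q ^ card T < Q ^ j)"

abbreviation alive_at :: "real \<Rightarrow> nat \<Rightarrow> 'a set \<Rightarrow> 'a set set \<Rightarrow> 'a set set \<Rightarrow> 'a \<Rightarrow> 'a set set" where
  "alive_at Q j A G G' v \<equiv> {E \<in> G. v \<in> E \<and> alive Q j A G' E}"

section \<open>Selecting a vertex and adding its link\<close>

lemma sum_hdeg_le:
  assumes "finite \<T>" "G \<subseteq> nsets A j" "finite A"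
  shows "(\<Sum>T\<in>\<T>. hdeg G T) \<le> 2 ^ j * card G"
proof -
  have finG: "finite G" using assms finite_subset_nsets by blast
  have "(\<Sum>T\<in>\<T>. hdeg G T) = (\<Sum>T\<in>\<T>. \<Sum>E\<in>G. if T \<subseteq> E then 1 else 0)"
    using finG by (simp add: hdeg_def sum.If_cases Int_def)
  also have "\<dots> = (\<Sum>E\<in>G. \<Sum>T\<in>\<T>. if T \<subseteq> E then 1 else 0)"
    by (rule sum.swap)
  also have "\<dots> = (\<Sum>E\<in>G. card {T\<in>\<T>. T \<subseteq> E})"
    using assms(1) by (simp add: sum.If_cases Int_def)
  also have "\<dots> \<le> (\<Sum>E\<in>G. 2 ^ j)"
  proof (rule sum_mono)
    fix E assume "E \<in> G"
    then have E: "finite E" "card E = j" using assms(2) by (auto simp: nsets_def)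
    have "card {T\<in>\<T>. T \<subseteq> E} \<le> card (Pow E)"
      by (rule card_mono) (use E in auto)
    then show "card {T\<in>\<T>. T \<subseteq> E} \<le> 2 ^ j" using E by (simp add: card_Pow)
  qed
  finally show ?thesis by (simp add: mult.commute)
qed

text \<open>Averaging: measured against the bound \<alpha> N Q^j, at most a quarter of the edges of
  \<open>G\<close> meets \<open>A0 - A\<close> and at most a quarter contains a saturated set. If
  every vertex of \<open>A\<close> had fewer than \<alpha> / 4 * Q^j alive edges, the alive ones
  would make up at most another quarter, which is too few in total.\<close>

lemma alive_vertex:
  fixes Q N M \<alpha> \<gamma> \<eta> :: real
  assumes fin: "finite A0" and G: "G \<subseteq> nsets A0 (Suc j)" and G': "G' \<subseteq> nsets A0 j"
    and Q: "Q \<ge> 1" and N: "N > 0" and \<alpha>: "\<alpha> > 0" and M: "M \<ge> 0"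
    and A: "A \<subseteq> A0" and cA: "real (card A0) \<le> N"
    and lost: "real (card (A0 - A)) \<le> \<eta> * N"
    and deg: "\<And>T. T \<noteq> {} \<Longrightarrow> real (hdeg G T) * Q ^ card T \<le> M * Q ^ Suc j"
    and big: "\<alpha> * N * Q ^ j \<le> real (card G)"
    and small: "real (card G') * Q \<le> \<gamma> * N * Q ^ j"
    and \<eta>: "\<eta> * M \<le> \<alpha> / 4" and \<gamma>: "\<gamma> * M * 2 ^ j \<le> \<alpha> / 4"
  shows "\<exists>v\<in>A. \<alpha> / 4 * Q ^ j \<le> real (card (alive_at Q j A G G' v))"
proof (rule ccontr)
  assume neg: "\<not> ?thesis"
  define Al where "Al = {E \<in> G. alive Q j A G' E}"
  define Sat where "Sat = {T. T \<noteq> {} \<and> T \<subseteq> A0 \<and> Q ^ j \<le> real (hdeg G' T) * Q ^ card T}"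
  have finG: "finite G" using finite_subset_nsets[OF G fin] .
  have finS: "finite Sat" unfolding Sat_def
    by (rule finite_subset[of _ "Pow A0"]) (use fin in auto)
  have Qpos: "Q > 0" using Q by simp
  have sub: "G \<subseteq> Al \<union> (\<Union>u\<in>A0 - A. {E \<in> G. {u} \<subseteq> E}) \<union> (\<Union>T\<in>Sat. {E \<in> G. T \<subseteq> E})"
  proof
    fix E assume E: "E \<in> G"
    then have "E \<subseteq> A0" using G by (auto simp: nsets_def)
    then show "E \<in> Al \<union> (\<Union>u\<in>A0 - A. {E \<in> G. {u} \<subseteq> E}) \<union> (\<Union>T\<in>Sat. {E \<in> G. T \<subseteq> E})"
    proof (cases "\<exists>T\<subseteq>E. T \<noteq> {} \<and> Q ^ j \<le> real (hdeg G' T) * Q ^ card T")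
      case True
      then obtain T where "T \<subseteq> E" "T \<noteq> {}" "Q ^ j \<le> real (hdeg G' T) * Q ^ card T" by blast
      then have "T \<in> Sat" "T \<subseteq> E" using \<open>E \<subseteq> A0\<close> by (auto simp: Sat_def)
      then show ?thesis using E by blast
    next
      case False
      then have "\<forall>T\<subseteq>E. T \<noteq> {} \<longrightarrow> real (hdeg G' T) * Q ^ card T < Q ^ j" by (meson not_le)
      then show ?thesis using E \<open>E \<subseteq> A0\<close> unfolding Al_def alive_def by blast
    qed
  qed
  have "card G \<le> card (Al \<union> (\<Union>u\<in>A0 - A. {E \<in> G. {u} \<subseteq> E}) \<union> (\<Union>T\<in>Sat. {E \<in> G. T \<subseteq> E}))"
    by (rule card_mono[OF _ sub]) (use finG fin finS in \<open>auto simp: Al_def\<close>)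
  also have "\<dots> \<le> card (Al \<union> (\<Union>u\<in>A0 - A. {E \<in> G. {u} \<subseteq> E})) + card (\<Union>T\<in>Sat. {E \<in> G. T \<subseteq> E})"
    by (rule card_Un_le)
  also have "\<dots> \<le> card Al + card (\<Union>u\<in>A0 - A. {E \<in> G. {u} \<subseteq> E}) + card (\<Union>T\<in>Sat. {E \<in> G. T \<subseteq> E})"
    using card_Un_le by (simp add: add_mono)
  also have "\<dots> \<le> card Al + (\<Sum>u\<in>A0 - A. hdeg G {u}) + (\<Sum>T\<in>Sat. hdeg G T)"
    unfolding hdeg_def using fin finS by (intro add_mono card_UN_le order_refl) auto
  finally have "real (card G) \<le> real (card Al + (\<Sum>u\<in>A0 - A. hdeg G {u}) + (\<Sum>T\<in>Sat. hdeg G T))"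
    by (rule of_nat_mono)
  then have c1: "real (card G) \<le> real (card Al) + (\<Sum>u\<in>A0 - A. real (hdeg G {u})) + (\<Sum>T\<in>Sat. real (hdeg G T))"
    by simp
  have c2: "(\<Sum>u\<in>A0 - A. real (hdeg G {u})) \<le> \<alpha> / 4 * N * Q ^ j"
  proof -
    have "real (hdeg G {u}) \<le> M * Q ^ j" for u
      using deg[of "{u}"] Qpos by (simp add: mult.assoc[symmetric] mult.commute[of Q])
    then have "(\<Sum>u\<in>A0 - A. real (hdeg G {u})) \<le> real (card (A0 - A)) * (M * Q ^ j)"
      by (intro sum_bounded_above)
    also have "\<dots> \<le> (\<eta> * N) * (M * Q ^ j)"
      using lost M Qpos by (intro mult_right_mono) auto
    also have "\<dots> = (\<eta> * M) * (N * Q ^ j)" by simp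
    also have "\<dots> \<le> (\<alpha> / 4) * (N * Q ^ j)"
      using \<eta> N Qpos by (intro mult_right_mono) auto
    finally show ?thesis by (simp add: mult.assoc)
  qed
  have c3: "(\<Sum>T\<in>Sat. real (hdeg G T)) \<le> \<alpha> / 4 * N * Q ^ j"
  proof -
    \<comment> \<open>Saturation turns the degree bound on \<open>G\<close> into a comparison with
      \<open>G'\<close>. The sum over the saturated sets can then be charged to
      \<open>card G'\<close>, as a j-set has only 2^j subsets.\<close>
    have "real (hdeg G T) \<le> M * Q * real (hdeg G' T)" if T: "T \<in> Sat" for T
    proof -
      have "real (hdeg G T) * Q ^ card T \<le> M * Q ^ Suc j" using deg T by (auto simp: Sat_def)
      also have "\<dots> = M * Q * Q ^ j" by simp
      also have "\<dots> \<le> M * Q * (real (hdeg G' T) * Q ^ card T)"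
        using T M Qpos by (intro mult_left_mono) (auto simp: Sat_def)
      finally show ?thesis using Qpos by (simp add: mult.assoc[symmetric])
    qed
    then have "(\<Sum>T\<in>Sat. real (hdeg G T)) \<le> (\<Sum>T\<in>Sat. M * Q * real (hdeg G' T))"
      by (rule sum_mono)
    also have "\<dots> = M * Q * real (\<Sum>T\<in>Sat. hdeg G' T)"
      by (simp add: sum_distrib_left)
    also have "\<dots> \<le> M * Q * (2 ^ j * real (card G'))"
      using sum_hdeg_le[OF finS G' fin] M Qpos
      by (intro mult_left_mono) (simp_all flip: of_nat_le_iff[where 'a=real])
    also have "\<dots> = M * 2 ^ j * (real (card G') * Q)" by simp
    also have "\<dots> \<le> M * 2 ^ j * (\<gamma> * N * Q ^ j)"
      using small M by (intro mult_left_mono) auto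
    also have "\<dots> = (\<gamma> * M * 2 ^ j) * (N * Q ^ j)" by simp
    also have "\<dots> \<le> (\<alpha> / 4) * (N * Q ^ j)"
      using \<gamma> N Qpos by (intro mult_right_mono) auto
    finally show ?thesis by (simp add: mult.assoc)
  qed
  have c4: "real (card Al) \<le> \<alpha> / 4 * N * Q ^ j"
  proof -
    have "Al \<subseteq> (\<Union>v\<in>A. alive_at Q j A G G' v)"
    proof
      fix E assume E: "E \<in> Al"
      then have al: "E \<in> G" "alive Q j A G' E" by (simp_all add: Al_def)
      from al(1) G have "card E = Suc j" by (auto simp: nsets_def)
      then have "E \<noteq> {}" by auto
      moreover have "E \<subseteq> A" using al(2) by (simp add: alive_def)
      ultimately obtain v where "v \<in> E" "v \<in> A" by blast
      with al show "E \<in> (\<Union>v\<in>A. alive_at Q j A G G' v)"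
        by (intro UN_I[of v]) simp_all
    qed
    moreover have finA: "finite A" using A fin finite_subset by blast
    ultimately have "card Al \<le> card (\<Union>v\<in>A. alive_at Q j A G G' v)"
      using finG by (intro card_mono) auto
    also have "\<dots> \<le> (\<Sum>v\<in>A. card (alive_at Q j A G G' v))"
      using finA by (rule card_UN_le)
    finally have "real (card Al) \<le> real (\<Sum>v\<in>A. card (alive_at Q j A G G' v))"
      by (rule of_nat_mono)
    also have "\<dots> = (\<Sum>v\<in>A. real (card (alive_at Q j A G G' v)))"
      by (rule of_nat_sum)
    also have "\<dots> \<le> real (card A) * (\<alpha> / 4 * Q ^ j)"
      using neg by (intro sum_bounded_above) (auto simp: not_le intro: less_imp_le)
    also have "\<dots> \<le> N * (\<alpha> / 4 * Q ^ j)"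
      using card_mono[OF fin A] cA \<alpha> Qpos by (intro mult_right_mono) auto
    finally show ?thesis by (simp add: mult_ac)
  qed
  have "\<alpha> * N * Q ^ j \<le> 3 * (\<alpha> / 4 * N * Q ^ j)"
    using c1 c2 c3 c4 big by linarith
  moreover have "\<alpha> * N * Q ^ j > 0" using \<alpha> N Qpos by simp
  moreover have "\<alpha> / 4 * N * Q ^ j = (\<alpha> * N * Q ^ j) / 4" by simp
  ultimately show False by linarith
qed

text \<open>A set \<open>T\<close> that gains an edge lies in an alive edge and so was unsaturated:
  its degree was below Q^(j - card T), and it grows by at most the degree of
  \<open>insert v T\<close> in \<open>G\<close>. Hence the constant M + 1 survives any number of
  steps.\<close>

lemma link_step:
  fixes Q M :: real and v :: 'a and A A0 :: "'a set"
  assumes fin: "finite A0" and G: "G \<subseteq> nsets A0 (Suc j)" and G': "G' \<subseteq> nsets A0 j"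
    and Q: "Q \<ge> 1" and j: "j \<ge> 1"
    and deg: "\<And>T. T \<noteq> {} \<Longrightarrow> real (hdeg G T) * Q ^ card T \<le> M * Q ^ Suc j"
    and deg': "\<And>T. T \<noteq> {} \<Longrightarrow> real (hdeg G' T) * Q ^ card T \<le> (M + 1) * Q ^ j"
  defines "L \<equiv> (\<lambda>E. E - {v}) ` (alive_at Q j A G G' v)"
  shows "G' \<union> L \<subseteq> nsets A0 j"
    and "card (G' \<union> L) = card G' + card (alive_at Q j A G G' v)"
    and "\<And>T. T \<noteq> {} \<Longrightarrow> real (hdeg (G' \<union> L) T) * Q ^ card T \<le> (M + 1) * Q ^ j"
proof -
  define B where "B = alive_at Q j A G G' v"
  have L: "L = (\<lambda>E. E - {v}) ` B" by (simp add: L_def B_def)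
  have finG: "finite G" "finite G'" using finite_subset_nsets[OF G fin] finite_subset_nsets[OF G' fin] .
  have finB: "finite B" using finG by (simp add: B_def)
  have Qpos: "Q > 0" using Q by simp
  show sub: "G' \<union> L \<subseteq> nsets A0 j"
    using G G' by (auto simp: L_def nsets_def)
  have inj: "inj_on (\<lambda>E. E - {v}) B"
  proof (rule inj_onI)
    fix E F assume "E \<in> B" "F \<in> B" "E - {v} = F - {v}"
    then show "E = F" unfolding B_def by (metis (no_types, lifting) insert_Diff mem_Collect_eq)
  qed
  \<comment> \<open>A link edge already in \<open>G'\<close> would be a saturated subset of an alive
    edge, since it has j elements and degree at least one.\<close>
  have disj: "G' \<inter> L = {}"
  proof (rule ccontr)
    assume "G' \<inter> L \<noteq> {}"
    then obtain E where E: "E \<in> B" "E - {v} \<in> G'" by (auto simp: L)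
    have c: "card (E - {v}) = j" using E(2) G' by (auto simp: nsets_def)
    then have ne: "E - {v} \<noteq> {}" using j by (metis card.empty not_one_le_zero)
    have "hdeg G' (E - {v}) \<ge> 1"
    proof -
      have "card {E - {v}} \<le> hdeg G' (E - {v})" unfolding hdeg_def
        by (rule card_mono) (use E finG in auto)
      then show ?thesis by simp
    qed
    then have "Q ^ j \<le> real (hdeg G' (E - {v})) * Q ^ card (E - {v})"
      using c Qpos by simp
    moreover have "alive Q j A G' E" using E by (auto simp: B_def)
    ultimately show False using ne unfolding alive_def by (meson Diff_subset not_le)
  qed
  show "card (G' \<union> L) = card G' + card (alive_at Q j A G G' v)"
    using card_Un_disjoint[OF finG(2) _ disj] finB card_image[OF inj] by (simp add: L B_def)
  fix T :: "'a set" assume T: "T \<noteq> {}"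
  have hU: "hdeg (G' \<union> L) T \<le> hdeg G' T + card {E \<in> L. T \<subseteq> E}"
  proof -
    have "{E \<in> G' \<union> L. T \<subseteq> E} = {E \<in> G'. T \<subseteq> E} \<union> {E \<in> L. T \<subseteq> E}" by blast
    then show ?thesis by (simp add: hdeg_def card_Un_le)
  qed
  show "real (hdeg (G' \<union> L) T) * Q ^ card T \<le> (M + 1) * Q ^ j"
  proof (cases "{E \<in> L. T \<subseteq> E} = {}")
    case True
    then have "hdeg (G' \<union> L) T \<le> hdeg G' T" using hU unfolding True by simp
    then have "real (hdeg (G' \<union> L) T) * Q ^ card T \<le> real (hdeg G' T) * Q ^ card T"
      using Qpos by (intro mult_right_mono) auto
    then show ?thesis using deg'[OF T] by linarith
  next
    case False
    then obtain E where E: "E \<in> B" "T \<subseteq> E - {v}" by (auto simp: L)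
    then have vT: "v \<notin> T" and "T \<subseteq> E" by auto
    then have s: "real (hdeg G' T) * Q ^ card T < Q ^ j"
      using E T by (auto simp: B_def alive_def)
    have finT: "finite T" using E G by (auto simp: B_def nsets_def intro: finite_subset)
    have "card {E \<in> L. T \<subseteq> E} \<le> hdeg G (insert v T)"
    proof -
      have "{E \<in> L. T \<subseteq> E} \<subseteq> (\<lambda>E. E - {v}) ` {E \<in> G. insert v T \<subseteq> E}"
        by (auto simp: L B_def)
      then have "card {E \<in> L. T \<subseteq> E} \<le> card ((\<lambda>E. E - {v}) ` {E \<in> G. insert v T \<subseteq> E})"
        using finG by (intro card_mono) auto
      also have "\<dots> \<le> hdeg G (insert v T)" unfolding hdeg_def
        using finG by (intro card_image_le) auto
      finally show ?thesis .
    qed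
    then have "real (card {E \<in> L. T \<subseteq> E}) * Q ^ card T \<le> real (hdeg G (insert v T)) * Q ^ card T"
      using Qpos by (intro mult_right_mono) auto
    also have "\<dots> \<le> M * Q ^ j"
      using deg[of "insert v T"] finT vT Qpos by (simp add: mult.left_commute)
    finally have "(real (hdeg G' T) + real (card {E \<in> L. T \<subseteq> E})) * Q ^ card T \<le> (M + 1) * Q ^ j"
      using s by (simp add: algebra_simps)
    moreover have "real (hdeg (G' \<union> L) T) * Q ^ card T \<le> (real (hdeg G' T) + real (card {E \<in> L. T \<subseteq> E})) * Q ^ card T"
      using hU Qpos by (intro mult_right_mono) (simp_all flip: of_nat_add)
    ultimately show ?thesis by linarith
  qed
qed


text \<open>One level of the container algorithm: \<open>G\<close> is a family of forbidden \<open>(j+1)\<close>-sets, and the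
  links of the selected vertices are collected in a family \<open>G'\<close> of forbidden \<open>j\<close>-sets until \<open>G'\<close>
  is large enough for the next level or \<open>A\<close> has lost many vertices.\<close>

lemma containable_level_step:
  fixes Q N M \<alpha> \<gamma> \<eta> b :: real and A0 :: "'a set"
  assumes fin: "finite A0" and G: "G \<subseteq> nsets A0 (Suc j)" and j: "j \<ge> 1"
    and Q: "Q \<ge> 1" and N: "N > 0" and \<alpha>: "\<alpha> > 0" and M: "M \<ge> 0" and \<gamma>0: "\<gamma> \<ge> 0"
    and cA: "real (card A0) \<le> N"
    and deg: "\<And>T. T \<noteq> {} \<Longrightarrow> real (hdeg G T) * Q ^ card T \<le> M * Q ^ Suc j"
    and big: "\<alpha> * N * Q ^ j \<le> real (card G)"
    and \<eta>: "\<eta> * M \<le> \<alpha> / 4" and \<gamma>: "\<gamma> * M * 2 ^ j \<le> \<alpha> / 4" and \<gamma>\<alpha>: "\<gamma> \<le> \<alpha> / 4"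
    and forb: "\<And>I E. I \<in> \<I> \<Longrightarrow> E \<in> G \<Longrightarrow> \<not> E \<subseteq> I"
    and shrunk: "\<And>A \<I>'. A \<subseteq> A0 \<Longrightarrow> \<I>' \<subseteq> \<I> \<Longrightarrow> \<eta> * N \<le> real (card (A0 - A)) \<Longrightarrow> containable good A b \<I>'"
    and lower: "\<And>A \<I>' G'. A \<subseteq> A0 \<Longrightarrow> \<I>' \<subseteq> \<I> \<Longrightarrow> G' \<subseteq> nsets A0 j \<Longrightarrow>
      (\<And>T. T \<noteq> {} \<Longrightarrow> real (hdeg G' T) * Q ^ card T \<le> (M + 1) * Q ^ j) \<Longrightarrow>
      \<gamma> * N * Q ^ j \<le> real (card G') * Q \<Longrightarrow>
      (\<And>I E. I \<in> \<I>' \<Longrightarrow> E \<in> G' \<Longrightarrow> \<not> E \<subseteq> I) \<Longrightarrow> containable good A b \<I>'"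
  assumes A: "A \<subseteq> A0"
  shows "containable good A (b + (N / Q + 1)) \<I>"
proof -
  \<comment> \<open>The least growth of \<open>card G' * Q\<close> when a selected vertex belongs to
    \<open>I\<close>. The amount that is still missing, divided by \<beta>, governs how many more
    queries can be answered with yes; the additional 1 in the budget pays for the query that passes
    the threshold.\<close>
  define \<beta> where "\<beta> = \<alpha> / 4 * Q ^ Suc j"
  have Qpos: "Q > 0" using Q by simp
  have \<beta>: "\<beta> > 0" unfolding \<beta>_def using \<alpha> Qpos by simp
  have main: "containable good A (b + ((\<gamma> * N * Q ^ j - real (card G') * Q) / \<beta> + 1)) \<I>'"
    if "A \<subseteq> A0" "\<I>' \<subseteq> \<I>" "G' \<subseteq> nsets A0 j"
      "\<And>T. T \<noteq> {} \<Longrightarrow> real (hdeg G' T) * Q ^ card T \<le> (M + 1) * Q ^ j"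
      "real (card G') * Q \<le> \<gamma> * N * Q ^ j"
      "\<And>I E. I \<in> \<I>' \<Longrightarrow> E \<in> G' \<Longrightarrow> \<not> E \<subseteq> I" for A \<I>' G'
    using that
  proof (induction "card A" arbitrary: A \<I>' G' rule: less_induct)
    case (less A \<I>' G')
    note A = less.prems(1) and I = less.prems(2) and G' = less.prems(3) and deg' = less.prems(4)
      and small = less.prems(5) and forb' = less.prems(6)
    define d where "d = (\<gamma> * N * Q ^ j - real (card G') * Q) / \<beta>"
    have d: "d \<ge> 0" using small \<beta> by (simp add: d_def)
    have finA: "finite A" using A fin finite_subset by blast
    show ?case
    proof (cases "\<eta> * N \<le> real (card (A0 - A))")
      case True
      show ?thesis
        by (rule containable_mono[OF shrunk[OF A I True]]) (use d in \<open>auto simp: d_def\<close>)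
    next
      case False
      then obtain v where v: "v \<in> A"
        and dv: "\<alpha> / 4 * Q ^ j \<le> real (card (alive_at Q j A G G' v))"
        using alive_vertex[OF fin G G' Q N \<alpha> M A cA _ deg big small \<eta> \<gamma>] by force
      have lt: "card (A - {v}) < card A" by (rule card_Diff1_less[OF finA v])
      have A': "A - {v} \<subseteq> A0" using A by blast
      define L where "L = (\<lambda>E. E - {v}) ` (alive_at Q j A G G' v)"
      note link = link_step[OF fin G G' Q j deg deg', where v = v and A = A, folded L_def]
      have forbL: "\<not> E \<subseteq> I" if "I \<in> {I \<in> \<I>'. v \<in> I}" "E \<in> G' \<union> L" for I E
      proof
        assume EI: "E \<subseteq> I"
        from that(2) show False
        proof
          assume "E \<in> G'" then show False using forb' that(1) EI by blast
        next
          assume "E \<in> L"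
          then obtain E' where "E' \<in> G" "E = E' - {v}" by (auto simp: L_def)
          then have "E' \<in> G" "E' \<subseteq> I" using EI that(1) by auto
          then show False using forb that(1) I by blast
        qed
      qed
      have gain: "real (card G') * Q + \<beta> \<le> real (card (G' \<union> L)) * Q"
      proof -
        have "\<beta> = (\<alpha> / 4 * Q ^ j) * Q" by (simp add: \<beta>_def)
        also have "\<dots> \<le> real (card (alive_at Q j A G G' v)) * Q"
          using dv Qpos by (intro mult_right_mono) auto
        finally show ?thesis using link(2) by (simp add: algebra_simps)
      qed
      have no: "containable good (A - {v}) (b + (d + 1)) {I \<in> \<I>'. v \<notin> I}"
        unfolding d_def
        by (rule less.hyps[OF lt A' _ G' deg' small]) (use I forb' in auto)
      have yes: "containable good (A - {v}) (b + (d + 1) - 1) {I \<in> \<I>'. v \<in> I}"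
      proof (cases "\<gamma> * N * Q ^ j \<le> real (card (G' \<union> L)) * Q")
        case True
        have "containable good (A - {v}) b {I \<in> \<I>'. v \<in> I}"
          by (rule lower[OF A' _ link(1) link(3) True]) (use I forbL in auto)
        then show ?thesis by (rule containable_mono) (use d in auto)
      next
        case False
        have "containable good (A - {v}) (b + ((\<gamma> * N * Q ^ j - real (card (G' \<union> L)) * Q) / \<beta> + 1)) {I \<in> \<I>'. v \<in> I}"
          by (rule less.hyps[OF lt A' _ link(1) link(3)]) (use False I forbL in auto)
        moreover have "(\<gamma> * N * Q ^ j - real (card (G' \<union> L)) * Q) / \<beta> + 1 \<le> d"
        proof -
          have "(\<gamma> * N * Q ^ j - real (card (G' \<union> L)) * Q) / \<beta> \<le> (\<gamma> * N * Q ^ j - real (card G') * Q - \<beta>) / \<beta>"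
            using gain \<beta> by (intro divide_right_mono) auto
          also have "\<dots> = d - 1" using \<beta> by (simp add: d_def diff_divide_distrib)
          finally show ?thesis by simp
        qed
        ultimately show ?thesis by (elim containable_mono) auto
      qed
      show ?thesis using containable_query[OF finA v no yes] by (simp add: d_def)
    qed
  qed
  have "containable good A (b + ((\<gamma> * N * Q ^ j - real (card ({} :: 'a set set)) * Q) / \<beta> + 1)) \<I>"
  proof (rule main[OF A order_refl])
    show "real (card ({} :: 'a set set)) * Q \<le> \<gamma> * N * Q ^ j" using \<gamma>0 N Qpos by simp
    show "real (hdeg {} T) * Q ^ card T \<le> (M + 1) * Q ^ j" for T :: "'a set"
      using M Qpos by (simp add: hdeg_def)
  qed auto
  \<comment> \<open>With \<open>G'\<close> empty the whole amount is missing, and the quotient is (4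
    \<gamma> / \<alpha>) (N / Q); here \<gamma> \<le> \<alpha> / 4 enters.\<close>
  moreover have "(\<gamma> * N * Q ^ j - real (card ({} :: 'a set set)) * Q) / \<beta> \<le> N / Q"
  proof -
    have "(\<gamma> * N * Q ^ j) / \<beta> = (4 * \<gamma> / \<alpha>) * (N / Q)"
      using Qpos \<alpha> by (simp add: \<beta>_def field_simps)
    also have "\<dots> \<le> 1 * (N / Q)"
      using \<gamma>\<alpha> \<alpha> N Qpos by (intro mult_right_mono) (auto simp: field_simps)
    finally show ?thesis by simp
  qed
  ultimately show ?thesis by (elim containable_mono) auto
qed

text \<open>A level lowers the uniformity by one, costs N / Q + 1, divides the density constant by
  \<kappa> and raises the degree constant by one; hence \<alpha> / \<kappa> ^ (s - j) and s + 1 - j.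
  The value of \<kappa> covers the factor M * 2^j lost in charging saturated sets, and \<eta> is so
  small that fewer than \<eta> N lost vertices are negligible on every level.\<close>

lemma containable_level:
  fixes Q N \<alpha> \<eta> \<kappa> b :: real
  assumes fin: "finite A0" and Q: "Q \<ge> 1" and N: "N > 0" and \<alpha>: "\<alpha> > 0"
    and cA: "real (card A0) \<le> N" and b: "b \<ge> 0"
    and \<kappa>: "\<kappa> = 4 * real s * 2 ^ s" and \<eta>: "\<eta> = \<alpha> / (4 * real s * \<kappa> ^ s)"
    and shrunk: "\<And>A. A \<subseteq> A0 \<Longrightarrow> \<eta> * N \<le> real (card (A0 - A)) \<Longrightarrow> containable good A b \<I>0"
  shows "1 \<le> j \<Longrightarrow> j \<le> s \<Longrightarrow> A \<subseteq> A0 \<Longrightarrow> \<I> \<subseteq> \<I>0 \<Longrightarrow> G \<subseteq> nsets A0 j \<Longrightarrow>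
    (\<And>T. T \<noteq> {} \<Longrightarrow> real (hdeg G T) * Q ^ card T \<le> real (s + 1 - j) * Q ^ j) \<Longrightarrow>
    \<alpha> / \<kappa> ^ (s - j) * N * Q ^ j \<le> real (card G) * Q \<Longrightarrow>
    (\<And>I E. I \<in> \<I> \<Longrightarrow> E \<in> G \<Longrightarrow> \<not> E \<subseteq> I) \<Longrightarrow>
    containable good A (b + real j * (N / Q + 1)) \<I>"
proof (induction j arbitrary: A \<I> G)
  case 0
  then show ?case by simp
next
  case (Suc j)
  have s: "s \<ge> 1" using Suc.prems by simp
  have \<kappa>1: "\<kappa> \<ge> 4"
  proof -
    have "real s * 2 ^ s \<ge> 1 * 1" using s by (intro mult_mono) auto
    then show ?thesis by (simp add: \<kappa>)
  qed
  have Qpos: "Q > 0" using Q by simp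
  define \<alpha>' where "\<alpha>' = \<alpha> / \<kappa> ^ (s - Suc j)"
  have \<alpha>': "\<alpha>' > 0" using \<alpha> \<kappa>1 by (simp add: \<alpha>'_def)
  have \<eta>\<alpha>': "\<eta> * (4 * real s) \<le> \<alpha>'"
  proof -
    have "\<kappa> ^ (s - Suc j) \<le> \<kappa> ^ s" using \<kappa>1 by (intro power_increasing) auto
    then have "\<alpha> / \<kappa> ^ s \<le> \<alpha>'" unfolding \<alpha>'_def using \<alpha> \<kappa>1 by (intro divide_left_mono) auto
    then show ?thesis using s by (simp add: \<eta>)
  qed
  have big: "\<alpha>' * N * Q ^ j \<le> real (card G)"
  proof -
    have "(\<alpha>' * N * Q ^ j) * Q \<le> real (card G) * Q"
      using Suc.prems(7) by (simp add: \<alpha>'_def mult_ac)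
    then show ?thesis using Qpos by simp
  qed
  have shrunk': "containable good A b \<I>'" if "A \<subseteq> A0" "\<I>' \<subseteq> \<I>" "\<eta> * N \<le> real (card (A0 - A))" for A \<I>'
    by (rule containable_mono[OF shrunk[OF that(1,3)]]) (use that Suc.prems in auto)
  have rest0: "0 \<le> real j * (N / Q + 1)" using N Qpos by simp
  show ?case
  proof (cases "j = 0")
    \<comment> \<open>At the bottom the forbidden sets are single vertices, which no member of the
      family contains. There are at least \<eta> N of them, so dropping them for free leads to the
      shrunken case.\<close>
    case True
    have finG: "finite G" using finite_subset_nsets[OF Suc.prems(5) fin] .
    have G1: "\<And>E. E \<in> G \<Longrightarrow> \<exists>v. E = {v} \<and> v \<in> A0"
      using Suc.prems(5) True by (auto simp: nsets_one)
    have cG: "card G = card (\<Union>G)"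
    proof -
      have "G = (\<lambda>v. {v}) ` \<Union>G" using G1 by fastforce
      moreover have "card ((\<lambda>v. {v}) ` \<Union>G) = card (\<Union>G)" by (rule card_image) auto
      ultimately show ?thesis by simp
    qed
    have "\<eta> * N \<le> \<alpha>' * N"
    proof -
      have "\<eta> * 1 \<le> \<eta> * (4 * real s)" using s \<alpha> \<kappa>1 by (intro mult_left_mono) (auto simp: \<eta>)
      then show ?thesis using \<eta>\<alpha>' N by (intro mult_right_mono) auto
    qed
    also have "\<dots> \<le> real (card (\<Union>G))" using big True cG by simp
    also have "\<dots> \<le> real (card (A0 - (A - \<Union>G)))"
      using fin G1 by (intro of_nat_mono card_mono) auto
    finally have "containable good (A - \<Union>G) b \<I>"
      using Suc.prems(3) by (intro shrunk') auto
    then have "containable good A b \<I>"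
    proof (rule containable_drop)
      fix I assume "I \<in> \<I>"
      then show "I \<inter> A \<subseteq> A - \<Union>G" using Suc.prems(8) G1 by fastforce
    qed auto
    then show ?thesis by (rule containable_mono) (use N Qpos True in auto)
  next
    case False
    then have j: "j \<ge> 1" by simp
    define M where "M = real (s + 1 - Suc j)"
    define b' where "b' = b + real j * (N / Q + 1)"
    have M: "0 \<le> M" "M \<le> real s" "1 \<le> M" using Suc.prems(2) by (auto simp: M_def)
    have sj: "s - j = Suc (s - Suc j)" using Suc.prems(2) by simp
    have Mj: "M + 1 = real (s + 1 - j)" using Suc.prems(2) by (simp add: M_def of_nat_diff)
    define \<gamma> where "\<gamma> = \<alpha> / \<kappa> ^ (s - j)"
    have \<gamma>\<kappa>: "\<gamma> * \<kappa> = \<alpha>'" using \<kappa>1 by (simp add: \<gamma>_def \<alpha>'_def sj)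
    have \<gamma>0: "\<gamma> > 0" using \<alpha> \<kappa>1 by (simp add: \<gamma>_def)
    have "containable good A (b' + (N / Q + 1)) \<I>"
    proof (rule containable_level_step[OF fin Suc.prems(5) j Q N \<alpha>' M(1) less_imp_le[OF \<gamma>0] cA
          Suc.prems(6)[folded M_def] big _ _ _ Suc.prems(8) _ _ Suc.prems(3)])
      have "\<eta> * M \<le> \<eta> * real s" using M \<alpha> \<kappa>1 by (intro mult_left_mono) (auto simp: \<eta>)
      then show "\<eta> * M \<le> \<alpha>' / 4" using \<eta>\<alpha>' by linarith
      have "M * 2 ^ j \<le> real s * 2 ^ s"
        using M Suc.prems(2) by (intro mult_mono power_increasing) auto
      then have "\<gamma> * (M * 2 ^ j) \<le> \<gamma> * (real s * 2 ^ s)"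
        using \<gamma>0 by (intro mult_left_mono) auto
      then show "\<gamma> * M * 2 ^ j \<le> \<alpha>' / 4" using \<gamma>\<kappa> by (simp add: \<kappa> mult_ac)
      have "\<gamma> * 4 \<le> \<gamma> * \<kappa>" using \<gamma>0 \<kappa>1 by (intro mult_left_mono) auto
      then show "\<gamma> \<le> \<alpha>' / 4" using \<gamma>\<kappa> by simp
      show "containable good A b' \<I>'" if "A \<subseteq> A0" "\<I>' \<subseteq> \<I>" "\<eta> * N \<le> real (card (A0 - A))" for A \<I>'
        by (rule containable_mono[OF shrunk'[OF that]]) (use rest0 in \<open>auto simp: b'_def\<close>)
      show "containable good A b' \<I>'"
        if "A \<subseteq> A0" "\<I>' \<subseteq> \<I>" "G' \<subseteq> nsets A0 j"
          "\<And>T. T \<noteq> {} \<Longrightarrow> real (hdeg G' T) * Q ^ card T \<le> (M + 1) * Q ^ j"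
          "\<gamma> * N * Q ^ j \<le> real (card G') * Q"
          "\<And>I E. I \<in> \<I>' \<Longrightarrow> E \<in> G' \<Longrightarrow> \<not> E \<subseteq> I" for A \<I>' G'
        unfolding b'_def
        by (rule Suc.IH[OF j _ that(1) _ that(3) that(4)[unfolded Mj] that(5)[unfolded \<gamma>_def] that(6)])
          (use that(2) Suc.prems in auto)
    qed
    then show ?thesis by (simp add: b'_def algebra_simps)
  qed
qed

text \<open>A set \<open>A\<close> that is not good spans enough edges to start the top level, and
  every branch of the algorithm goes on until at least \<eta> N vertices of \<open>A\<close> are
  gone. After \<open>t\<close> such rounds, t \<ge> 1 / \<eta>, nothing would be left, and each
  round costs s (N / Q + 1); so K = t s works.\<close>

theorem hypergraph_containers:
  fixes \<alpha> :: real and s :: nat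
  assumes \<alpha>: "\<alpha> > 0" and s: "s \<ge> 1"
  obtains K where "K > 0"
    "\<And>(V :: 'a set) H (Q :: real). finite V \<Longrightarrow> V \<noteq> {} \<Longrightarrow> H \<subseteq> nsets V s \<Longrightarrow> Q \<ge> 1 \<Longrightarrow>
       (\<And>T. T \<noteq> {} \<Longrightarrow> real (hdeg H T) * Q ^ card T \<le> Q ^ s) \<Longrightarrow>
       containable (\<lambda>C. real (card {E\<in>H. E \<subseteq> C}) * Q < \<alpha> * real (card V) * Q ^ s) V
         (K * (real (card V) / Q + 1)) {I. \<forall>E\<in>H. \<not> E \<subseteq> I}"
proof -
  define \<kappa> :: real where "\<kappa> = 4 * real s * 2 ^ s"
  define \<eta> where "\<eta> = \<alpha> / (4 * real s * \<kappa> ^ s)"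
  define t where "t = nat \<lceil>1 / \<eta>\<rceil>"
  have \<kappa>: "\<kappa> > 0" using s by (simp add: \<kappa>_def)
  have \<eta>: "\<eta> > 0" using \<alpha> s \<kappa> by (simp add: \<eta>_def)
  have t: "1 \<le> real t * \<eta>"
  proof -
    have "1 / \<eta> \<le> real t" unfolding t_def by linarith
    then show ?thesis using \<eta> by (simp add: field_simps)
  qed
  show ?thesis
  proof (rule that)
    show "real (t * s) > 0" using t s \<eta> by (cases "t = 0") auto
    fix V :: "'a set" and H and Q :: real
    assume fin: "finite V" and ne: "V \<noteq> {}" and H: "H \<subseteq> nsets V s" and Q: "Q \<ge> 1"
      and deg: "\<And>T. T \<noteq> {} \<Longrightarrow> real (hdeg H T) * Q ^ card T \<le> Q ^ s"
    define N where "N = real (card V)"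
    define good where "good = (\<lambda>C. real (card {E\<in>H. E \<subseteq> C}) * Q < \<alpha> * N * Q ^ s)"
    define \<I> where "\<I> = {I. \<forall>E\<in>H. \<not> E \<subseteq> I}"
    have N: "N > 0" using fin ne by (simp add: N_def card_gt_0_iff)
    have finH: "finite H" using finite_subset_nsets[OF H fin] .
    have main: "containable good A (real (i * s) * (N / Q + 1)) \<I>"
      if "A \<subseteq> V" "real (card A) \<le> real i * (\<eta> * N)" for A i
      using that
    proof (induction i arbitrary: A)
      case 0
      then have "A = {}" using fin finite_subset by fastforce
      then have "{E\<in>H. E \<subseteq> A} = {}" using H s by (auto simp: nsets_def)
      then have "card {E\<in>H. E \<subseteq> A} = 0" by (simp only: card.empty)
      then have "good A" using \<alpha> N Q unfolding good_def by simp
      then show ?case by (rule containable_stop) simp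
    next
      case (Suc i)
      have NQ: "0 \<le> N / Q + 1" using N Q by simp
      show ?case
      proof (cases "good A")
        case True
        then show ?thesis using NQ by (intro containable_stop) auto
      next
        case False
        have finA: "finite A" using Suc.prems fin finite_subset by blast
        have 1: "containable good A' (real (i * s) * (N / Q + 1)) \<I>"
          if "A' \<subseteq> A" "\<eta> * N \<le> real (card (A - A'))" for A'
        proof (rule Suc.IH)
          show "A' \<subseteq> V" using that Suc.prems by blast
          have "real (card (A - A')) = real (card A) - real (card A')"
            using that(1) finA by (metis card_Diff_subset card_mono finite_subset of_nat_diff)
          then show "real (card A') \<le> real i * (\<eta> * N)"
            using that(2) Suc.prems(2) by (simp add: algebra_simps)
        qed
        have cA: "real (card A) \<le> N"
          using card_mono[OF fin Suc.prems(1)] by (simp add: N_def)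
        have b0: "0 \<le> real (i * s) * (N / Q + 1)" using NQ by simp
        have "containable good A (real (i * s) * (N / Q + 1) + real s * (N / Q + 1)) \<I>"
        proof (rule containable_level[OF finA Q N \<alpha> cA b0 \<kappa>_def \<eta>_def 1, where G = "{E\<in>H. E \<subseteq> A}"])
          show "{E\<in>H. E \<subseteq> A} \<subseteq> nsets A s" using H by (auto simp: nsets_def)
          show "real (hdeg {E\<in>H. E \<subseteq> A} T) * Q ^ card T \<le> real (s + 1 - s) * Q ^ s" if "T \<noteq> {}" for T
          proof -
            have "hdeg {E\<in>H. E \<subseteq> A} T \<le> hdeg H T"
              unfolding hdeg_def using finH by (intro card_mono) auto
            then have "real (hdeg {E\<in>H. E \<subseteq> A} T) * Q ^ card T \<le> real (hdeg H T) * Q ^ card T"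
              using Q by (intro mult_right_mono) auto
            then show ?thesis using deg[OF that] by simp
          qed
          show "\<alpha> / \<kappa> ^ (s - s) * N * Q ^ s \<le> real (card {E \<in> H. E \<subseteq> A}) * Q"
            using False by (simp add: good_def)
        qed (use s in \<open>auto simp: \<I>_def\<close>)
        then show ?thesis by (simp add: algebra_simps)
      qed
    qed
    have "containable good V (real (t * s) * (N / Q + 1)) \<I>"
    proof (rule main[OF order_refl])
      have "1 * N \<le> real t * \<eta> * N" using t N by (intro mult_right_mono) auto
      then show "real (card V) \<le> real t * (\<eta> * N)" by (simp add: N_def mult.assoc)
    qed
    then show "containable (\<lambda>C. real (card {E\<in>H. E \<subseteq> C}) * Q < \<alpha> * real (card V) * Q ^ s) V
         (real (t * s) * (real (card V) / Q + 1)) {I. \<forall>E\<in>H. \<not> E \<subseteq> I}"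
      by (simp only: good_def N_def \<I>_def)
  qed
qed

section \<open>The 1-statement\<close>

abbreviation few_cliques :: "nat \<Rightarrow> nat \<Rightarrow> nat \<Rightarrow> real \<Rightarrow> nat set set \<Rightarrow> bool" where
  "few_cliques k l n \<epsilon> C \<equiv> real (card {K \<in> nsets {..<n} k. nsets K l \<subseteq> C}) \<le> \<epsilon> * real (n choose k)"

abbreviation clique_free :: "nat \<Rightarrow> nat \<Rightarrow> nat \<Rightarrow> nat set set set" where
  "clique_free k l n \<equiv> {I. \<forall>K\<in>nsets {..<n} k. \<not> nsets K l \<subseteq> I}"

section \<open>Supersaturation: few containers miss many edges\<close>

lemma card_supersets_le:
  assumes "finite V" "W \<subseteq> V" "card W \<le> k"
  shows "card {K \<in> nsets V k. W \<subseteq> K} \<le> (card V - card W) choose (k - card W)"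
proof -
  have finW: "finite W" using assms finite_subset by blast
  have "(\<lambda>K. K - W) ` {K \<in> nsets V k. W \<subseteq> K} \<subseteq> nsets (V - W) (k - card W)"
    using finW by (auto simp: nsets_def card_Diff_subset)
  moreover have "inj_on (\<lambda>K. K - W) {K \<in> nsets V k. W \<subseteq> K}"
  proof (rule inj_onI)
    fix K L assume "K \<in> {K \<in> nsets V k. W \<subseteq> K}" "L \<in> {K \<in> nsets V k. W \<subseteq> K}" "K - W = L - W"
    then show "K = L" by (metis (no_types, lifting) Un_Diff_cancel2 mem_Collect_eq sup.absorb1)
  qed
  ultimately have "card {K \<in> nsets V k. W \<subseteq> K} \<le> card (nsets (V - W) (k - card W))"
    using assms by (intro card_inj_on_le) (auto intro: finite_imp_finite_nsets)
  then show ?thesis using assms finW by (simp add: card_nsets card_Diff_subset)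
qed

text \<open>Colour an l-set by the index of some container that has it, and by the extra colour r if
  there is none. Every R'-set contains a monochromatic k-set, so double counting gives at least (n
  choose k) / c of these, with c = R' choose k. Less than half of this number comes from the
  containers. The remaining k-sets have only uncovered l-subsets, and an uncovered l-set serves at
  most (n - l) choose (k - l) of them.\<close>

lemma ramsey_supersaturation:
  fixes l k r :: nat
  assumes l: "1 \<le> l" and lk: "l \<le> k"
  obtains \<epsilon> \<delta> :: real and n0 :: nat where "\<epsilon> > 0" "\<delta> > 0"
    "\<And>n C. n \<ge> n0 \<Longrightarrow>
      (\<And>i. i < r \<Longrightarrow> few_cliques k l n \<epsilon> (C i)) \<Longrightarrow>
      \<delta> * real (n choose l) \<le> real (card (nsets {..<n} l - (\<Union>i<r. C i)))"
proof -
  obtain R :: nat where R0: "partn_lst {..<R} (replicate (Suc r) k) l"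
    using ramsey_full[of "replicate (Suc r) k" l] by blast
  define R' where "R' = max R k"
  have R: "partn_lst {..<R'} (replicate (Suc r) k) l"
    by (rule partn_lst_greater_resource[OF R0]) (simp add: R'_def)
  have kR: "k \<le> R'" by (simp add: R'_def)
  define c where "c = real (R' choose k)"
  have c: "c \<ge> 1" using kR by (simp add: c_def Suc_le_eq)
  \<comment> \<open>With this \<epsilon> the r containers contribute at most (n choose k) / 2 after
    multiplication by c. The factor 2 c in \<delta> comes from the other half, and k choose l from
    passing from n choose k to n choose l.\<close>
  define \<epsilon> where "\<epsilon> = 1 / (2 * real (Suc r) * c)"
  define \<delta> where "\<delta> = 1 / (2 * c * real (k choose l))"
  have kl: "real (k choose l) \<ge> 1" using lk by (simp add: Suc_le_eq)
  show ?thesis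
  proof (rule that[of \<epsilon> \<delta> R'])
    show "\<epsilon> > 0" "\<delta> > 0" using c lk by (simp_all add: \<epsilon>_def \<delta>_def zero_less_mult_iff)
    fix n :: nat and C :: "nat \<Rightarrow> nat set set"
    assume n: "R' \<le> n"
      and few: "\<And>i. i < r \<Longrightarrow> few_cliques k l n \<epsilon> (C i)"
    define D where "D = nsets {..<n} l - (\<Union>i<r. C i)"
    define B where "B = (\<lambda>i. {K \<in> nsets {..<n} k. nsets K l \<subseteq> C i})"
    define BD where "BD = {K \<in> nsets {..<n} k. nsets K l \<subseteq> D}"
    define Mono where "Mono = (\<Union>i<r. B i) \<union> BD"
    define col where "col = (\<lambda>e. if \<exists>i<r. e \<in> C i then SOME i. i < r \<and> e \<in> C i else r)"
    have finV: "finite (nsets {..<n} k)" "finite (nsets {..<n} l)" "finite (nsets {..<n} R')"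
      by (simp_all add: finite_imp_finite_nsets)
    have finB: "finite (B i)" "finite BD" for i using finV by (simp_all add: B_def BD_def)
    have finD: "finite D" using finV by (simp add: D_def)
    have col1: "col e < r \<and> e \<in> C (col e) \<or> col e = r \<and> e \<notin> (\<Union>i<r. C i)" for e
    proof (cases "\<exists>i<r. e \<in> C i")
      case True
      then have "(SOME i. i < r \<and> e \<in> C i) < r \<and> e \<in> C (SOME i. i < r \<and> e \<in> C i)"
        by (rule someI_ex)
      with True show ?thesis by (simp add: col_def)
    qed (auto simp: col_def)
    have ex: "\<exists>K\<in>Mono. K \<subseteq> X" if X: "X \<in> nsets {..<n} R'" for X
    proof -
      have Xf: "finite X" "card X = R'" "X \<subseteq> {..<n}" using X by (auto simp: nsets_def)
      then obtain h where h: "bij_betw h {..<R'} X"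
        using ex_bij_betw_nat_finite[of X] by (auto simp: atLeast0LessThan)
      have "(\<lambda>e. col (h ` e)) \<in> nsets {..<R'} l \<rightarrow> {..<Suc r}"
      proof
        fix e show "col (h ` e) \<in> {..<Suc r}" using col1[of "h ` e"] by auto
      qed
      from partn_lstE[OF R this] obtain i Y where i: "i < Suc r" "Y \<in> nsets {..<R'} k"
        and mono: "(\<lambda>e. col (h ` e)) ` nsets Y l \<subseteq> {i}"
        by (auto simp del: replicate_Suc)
      define K where "K = h ` Y"
      have Y: "Y \<subseteq> {..<R'}" "finite Y" "card Y = k" using i by (auto simp: nsets_def)
      have inj: "inj_on h Y" using h Y(1) by (meson bij_betw_def inj_on_subset)
      have K: "K \<subseteq> X" using h Y by (auto simp: K_def bij_betw_def)
      then have Kn: "K \<in> nsets {..<n} k"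
        using Y inj Xf by (auto simp: nsets_def K_def card_image)
      have im: "nsets K l = (\<lambda>e. h ` e) ` nsets Y l"
        using bij_betw_nsets[of h Y K l] inj by (simp add: bij_betw_def K_def)
      have colK: "col e = i" if "e \<in> nsets K l" for e
        using that mono unfolding im by auto
      have "K \<in> Mono"
      proof (cases "i < r")
        case True
        have "nsets K l \<subseteq> C i"
        proof
          fix e assume "e \<in> nsets K l"
          then show "e \<in> C i" using colK[of e] col1[of e] True by auto
        qed
        then show ?thesis using Kn True by (auto simp: Mono_def B_def)
      next
        case False
        have "nsets K l \<subseteq> D"
        proof
          fix e assume e: "e \<in> nsets K l"
          then have "e \<notin> (\<Union>i<r. C i)" using colK[of e] col1[of e] False by auto
          moreover have "e \<in> nsets {..<n} l" using e Kn by (auto simp: nsets_def)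
          ultimately show "e \<in> D" by (simp add: D_def)
        qed
        then show ?thesis using Kn by (auto simp: Mono_def BD_def)
      qed
      then show ?thesis using K by blast
    qed
    have finM: "finite Mono" using finB by (simp add: Mono_def)
    have Mk: "K \<in> nsets {..<n} k" if "K \<in> Mono" for K
      using that by (auto simp: Mono_def B_def BD_def)
    have "n choose R' \<le> card (\<Union>K\<in>Mono. {X \<in> nsets {..<n} R'. K \<subseteq> X})"
    proof -
      have "nsets {..<n} R' \<subseteq> (\<Union>K\<in>Mono. {X \<in> nsets {..<n} R'. K \<subseteq> X})"
      proof
        fix X assume X: "X \<in> nsets {..<n} R'"
        from ex[OF X] obtain K where "K \<in> Mono" "K \<subseteq> X" ..
        then show "X \<in> (\<Union>K\<in>Mono. {X \<in> nsets {..<n} R'. K \<subseteq> X})" using X by auto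
      qed
      then have "card (nsets {..<n} R') \<le> card (\<Union>K\<in>Mono. {X \<in> nsets {..<n} R'. K \<subseteq> X})"
        using finM finV by (intro card_mono) auto
      then show ?thesis by (simp add: card_nsets)
    qed
    also have "\<dots> \<le> (\<Sum>K\<in>Mono. card {X \<in> nsets {..<n} R'. K \<subseteq> X})"
      by (rule card_UN_le[OF finM])
    also have "\<dots> \<le> (\<Sum>K\<in>Mono. (n - k) choose (R' - k))"
    proof (rule sum_mono)
      fix K assume "K \<in> Mono"
      then have "K \<subseteq> {..<n}" "card K = k" using Mk by (auto simp: nsets_def)
      then show "card {X \<in> nsets {..<n} R'. K \<subseteq> X} \<le> (n - k) choose (R' - k)"
        using card_supersets_le[of "{..<n}" K R'] kR by simp
    qed
    finally have "n choose R' \<le> card Mono * ((n - k) choose (R' - k))" by simp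
    then have "(n choose R') * (R' choose k) \<le> card Mono * ((n - k) choose (R' - k)) * (R' choose k)"
      by (rule mult_right_mono) simp
    then have "(n choose k) * ((n - k) choose (R' - k)) \<le> (card Mono * (R' choose k)) * ((n - k) choose (R' - k))"
      unfolding choose_mult[OF kR n] by (simp only: mult_ac)
    moreover have "(n - k) choose (R' - k) > 0" using n by simp
    ultimately have "(n choose k) \<le> card Mono * (R' choose k)"
      by (metis mult_le_cancel2)
    then have m1: "real (n choose k) \<le> real (card Mono) * c"
      unfolding c_def by (metis of_nat_le_iff of_nat_mult)
    have "card Mono \<le> card (\<Union>i<r. B i) + card BD"
      unfolding Mono_def by (rule card_Un_le)
    also have "\<dots> \<le> (\<Sum>i<r. card (B i)) + card BD"
      using card_UN_le[of "{..<r}" B] by simp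
    finally have "real (card Mono) \<le> (\<Sum>i<r. real (card (B i))) + real (card BD)"
      by (metis of_nat_add of_nat_le_iff of_nat_sum)
    also have "(\<Sum>i<r. real (card (B i))) \<le> real r * (\<epsilon> * real (n choose k))"
      using few sum_bounded_above[of "{..<r}" "\<lambda>i. real (card (B i))" "\<epsilon> * real (n choose k)"]
      by (simp add: B_def)
    finally have m2: "real (card Mono) \<le> real r * (\<epsilon> * real (n choose k)) + real (card BD)" by simp
    have "BD \<subseteq> (\<Union>e\<in>D. {K \<in> nsets {..<n} k. e \<subseteq> K})"
    proof
      fix K assume K: "K \<in> BD"
      then have "finite K" "card K = k" by (auto simp: BD_def nsets_def)
      then obtain e where e: "e \<subseteq> K" "card e = l" "finite e"
        using lk obtain_subset_with_card_n[of l K] by metis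
      then have "e \<in> nsets K l" by (simp add: nsets_def)
      then show "K \<in> (\<Union>e\<in>D. {K \<in> nsets {..<n} k. e \<subseteq> K})"
        using K e by (auto simp: BD_def)
    qed
    then have "card BD \<le> card (\<Union>e\<in>D. {K \<in> nsets {..<n} k. e \<subseteq> K})"
      using finD finV by (intro card_mono) auto
    also have "\<dots> \<le> (\<Sum>e\<in>D. card {K \<in> nsets {..<n} k. e \<subseteq> K})" by (rule card_UN_le[OF finD])
    also have "\<dots> \<le> (\<Sum>e\<in>D. (n - l) choose (k - l))"
    proof (rule sum_mono)
      fix e assume "e \<in> D"
      then have "e \<subseteq> {..<n}" "card e = l" by (auto simp: D_def nsets_def)
      then show "card {K \<in> nsets {..<n} k. e \<subseteq> K} \<le> (n - l) choose (k - l)"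
        using card_supersets_le[of "{..<n}" e k] lk by simp
    qed
    finally have m3: "real (card BD) \<le> real (card D) * real ((n - l) choose (k - l))"
      by (simp flip: of_nat_mult)
    have m4: "real (n choose k) * real (k choose l) = real (n choose l) * real ((n - l) choose (k - l))"
      using choose_mult[of l k n] lk n kR by (simp flip: of_nat_mult)
    define x where "x = real (n choose k)"
    define w where "w = real ((n - l) choose (k - l))"
    have w: "w > 0" using n kR by (simp add: w_def)
    have "x \<le> (real r * (\<epsilon> * x) + real (card D) * w) * c"
    proof -
      have "x \<le> real (card Mono) * c" using m1 by (simp add: x_def)
      also have "\<dots> \<le> (real r * (\<epsilon> * x) + real (card D) * w) * c"
        using m2 m3 c by (intro mult_right_mono) (auto simp: x_def w_def)
      finally show ?thesis .
    qed
    also have "\<dots> = (real r / real (Suc r)) * (x / 2) + real (card D) * w * c"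
    proof -
      have "\<epsilon> * c = 1 / (2 * real (Suc r))" using c by (simp add: \<epsilon>_def)
      moreover have "real r * (\<epsilon> * x) * c = real r * x * (\<epsilon> * c)" by (simp only: mult_ac)
      ultimately have "real r * (\<epsilon> * x) * c = real r * x * (1 / (2 * real (Suc r)))" by (simp only:)
      then show ?thesis by (simp add: distrib_right)
    qed
    also have "(real r / real (Suc r)) * (x / 2) \<le> 1 * (x / 2)"
      by (intro mult_right_mono) (auto simp: x_def)
    finally have "x \<le> 1 * (x / 2) + real (card D) * w * c" by simp
    then have "x \<le> 2 * (real (card D) * w * c)" by linarith
    then have "x \<le> 2 * c * real (card D) * w" by (simp add: mult_ac)
    then have "x * real (k choose l) \<le> 2 * c * real (card D) * w * real (k choose l)"
      by (rule mult_right_mono) simp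
    then have "real (n choose l) * w \<le> (2 * c * real (card D) * real (k choose l)) * w"
      using m4 by (simp add: x_def w_def mult_ac)
    then have "real (n choose l) \<le> 2 * c * real (card D) * real (k choose l)" using w by simp
    then show "\<delta> * real (n choose l) \<le> real (card (nsets {..<n} l - (\<Union>i<r. C i)))"
    proof -
      have "2 * c * real (k choose l) > 0" using c lk by (simp add: zero_less_mult_iff)
      then show ?thesis
        using \<open>real (n choose l) \<le> _\<close> by (simp add: \<delta>_def D_def[symmetric] pos_divide_le_eq mult_ac)
    qed
  qed
qed

section \<open>Containers for clique-free hypergraphs\<close>

definition clique_scale :: "nat \<Rightarrow> nat \<Rightarrow> nat \<Rightarrow> real" where
  "clique_scale l k n = real n powr (1 / clique_ratio l k)"

definition clique_family :: "nat \<Rightarrow> nat \<Rightarrow> nat \<Rightarrow> nat set set set" where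
  "clique_family l k n = (\<lambda>K. nsets K l) ` nsets {..<n} k"

lemma clique_scale_ge_1: "2 \<le> l \<Longrightarrow> l < k \<Longrightarrow> 1 \<le> n \<Longrightarrow> 1 \<le> clique_scale l k n"
  unfolding clique_scale_def clique_ratio_def by (intro ge_one_powr_ge_zero) (auto simp: Suc_le_eq)

lemma clique_ratio_ge_1:
  assumes "2 \<le> l" "l < k"
  shows "1 \<le> clique_ratio l k"
proof -
  have "real k \<le> real (k choose l)" using choose_ge_self[of l k] assms by simp
  then show ?thesis using assms by (simp add: clique_ratio_def)
qed

text \<open>With s = k choose l and Q = \<open>clique_scale l k n\<close>, the reciprocal of the
  threshold, the exponent (s - 1) / m is k - l. So the quantity N Q^(s - 1) of the container
  theorem, N = n choose l, equals N n^(k - l), which has the order of n choose k.\<close>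

lemma clique_scale_power:
  assumes "2 \<le> l" "l < k" "1 \<le> n"
  shows "clique_scale l k n ^ (k choose l) = clique_scale l k n * real n ^ (k - l)"
proof -
  let ?s = "k choose l"
  have s: "?s = Suc (?s - 1)" "real (?s - 1) = real ?s - 1" using assms by (simp_all add: Suc_le_eq of_nat_diff)
  have r: "clique_ratio l k > 0" using clique_ratio_ge_1[OF assms(1,2)] by simp
  have "clique_scale l k n ^ (?s - 1) = real n powr (1 / clique_ratio l k * (real ?s - 1))"
    using assms s(2) by (simp add: clique_scale_def powr_powr flip: powr_realpow)
  also have "1 / clique_ratio l k * (real ?s - 1) = real (k - l)"
    using r assms by (simp add: clique_ratio_def field_simps of_nat_diff)
  also have "real n powr real (k - l) = real n ^ (k - l)" using assms(3) by (intro powr_realpow) simp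
  finally show ?thesis by (subst s(1)) simp
qed

text \<open>If \<open>T\<close> spans v vertices, it has at most v choose l elements and lies in at
  most n^(k - v) cliques. What remains is (v choose l) - 1 \<le> m (v - l), which is balancedness,
  with equality for v = l and v = k.\<close>

lemma hdeg_clique_family:
  assumes l: "2 \<le> l" and k: "l < k" and n: "1 \<le> n" and T: "T \<noteq> {}"
  shows "real (hdeg (clique_family l k n) T) * clique_scale l k n ^ card T \<le> clique_scale l k n ^ (k choose l)"
proof (cases "\<exists>K\<in>nsets {..<n} k. T \<subseteq> nsets K l")
  case False
  then have "{E \<in> clique_family l k n. T \<subseteq> E} = {}" by (auto simp: clique_family_def)
  then have "hdeg (clique_family l k n) T = 0" unfolding hdeg_def by (simp only: card.empty)
  then show ?thesis by (simp add: clique_scale_def)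
next
  case True
  then obtain K where K: "K \<in> nsets {..<n} k" "T \<subseteq> nsets K l" by blast
  define W where "W = \<Union>T"
  define v where "v = card W"
  define Q where "Q = clique_scale l k n"
  define m where "m = clique_ratio l k"
  have m: "m > 0" using clique_ratio_ge_1[OF l k] by (simp add: m_def)
  have Q1: "Q \<ge> 1" using clique_scale_ge_1[OF l k n] by (simp add: Q_def)
  have Kf: "finite K" "card K = k" "K \<subseteq> {..<n}" using K by (auto simp: nsets_def)
  have WK: "W \<subseteq> K" using K(2) by (auto simp: W_def nsets_def)
  have finW: "finite W" using WK Kf finite_subset by blast
  have vk: "v \<le> k" using card_mono[OF Kf(1) WK] Kf by (simp add: v_def)
  have TW: "T \<subseteq> nsets W l" using K(2) by (auto simp: W_def nsets_def)
  obtain e where e: "e \<in> T" using T by blast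
  have lv: "l \<le> v"
  proof -
    have "e \<subseteq> W" "card e = l" using e TW by (auto simp: nsets_def)
    then show ?thesis using card_mono[OF finW] by (auto simp: v_def)
  qed
  have cT: "card T \<le> v choose l"
    using card_mono[OF finite_imp_finite_nsets[OF finW] TW] finW by (simp add: card_nsets v_def)
  have finK: "finite {K \<in> nsets {..<n} k. W \<subseteq> K}"
    by (rule finite_subset[of _ "nsets {..<n} k"]) (auto simp: finite_imp_finite_nsets)
  have "{E \<in> clique_family l k n. T \<subseteq> E} \<subseteq> (\<lambda>K. nsets K l) ` {K \<in> nsets {..<n} k. W \<subseteq> K}"
  proof
    fix E assume "E \<in> {E \<in> clique_family l k n. T \<subseteq> E}"
    then obtain K where K: "K \<in> nsets {..<n} k" "E = nsets K l" "T \<subseteq> nsets K l"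
      by (auto simp: clique_family_def)
    then have "W \<subseteq> K" by (auto simp: W_def nsets_def)
    with K show "E \<in> (\<lambda>K. nsets K l) ` {K \<in> nsets {..<n} k. W \<subseteq> K}" by blast
  qed
  then have "hdeg (clique_family l k n) T \<le> card ((\<lambda>K. nsets K l) ` {K \<in> nsets {..<n} k. W \<subseteq> K})"
    unfolding hdeg_def using finK by (intro card_mono) simp_all
  also have "\<dots> \<le> card {K \<in> nsets {..<n} k. W \<subseteq> K}"
    by (rule card_image_le[OF finK])
  also have "\<dots> \<le> (n - v) choose (k - v)"
    using card_supersets_le[of "{..<n}" W k] WK Kf vk by (simp add: v_def)
  also have "\<dots> \<le> n ^ (k - v)"
    by (rule order.trans[OF binomial_right_mono choose_le_power]) simp
  finally have "real (hdeg (clique_family l k n) T) \<le> real n ^ (k - v)"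
    by (metis of_nat_le_iff of_nat_power)
  then have "real (hdeg (clique_family l k n) T) * Q ^ card T \<le> real n ^ (k - v) * Q ^ (v choose l)"
    using Q1 cT by (intro mult_mono power_increasing) auto
  also have "\<dots> = real n powr (real (k - v) + real (v choose l) / m)"
    using n by (simp add: Q_def clique_scale_def m_def powr_add powr_powr flip: powr_realpow)
  also have "\<dots> \<le> real n powr (real (k choose l) / m)"
  proof (rule powr_mono)
    have "real (v choose l) - 1 \<le> m * (real v - real l)"
    proof (cases "v = l \<or> v = k")
      case True
      then show ?thesis using k by (auto simp: m_def clique_ratio_def)
    next
      case False
      then have "clique_ratio l v < m" using clique_ratio_less[OF l, of v k] lv vk by (simp add: m_def)
      then show ?thesis using False lv by (simp add: clique_ratio_def field_simps)
    qed
    moreover have "real (k choose l) - 1 = m * (real k - real l)" using k by (simp add: m_def clique_ratio_def)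
    ultimately have "m * real (k - v) + real (v choose l) \<le> real (k choose l)"
      using vk by (simp add: of_nat_diff algebra_simps)
    then have "(m * real (k - v) + real (v choose l)) / m \<le> real (k choose l) / m"
      using m by (intro divide_right_mono) auto
    then show "real (k - v) + real (v choose l) / m \<le> real (k choose l) / m"
      using m by (simp add: add_divide_distrib)
  qed (use n in simp)
  also have "\<dots> = Q ^ (k choose l)"
    using n by (simp add: Q_def clique_scale_def m_def powr_powr flip: powr_realpow)
  finally show ?thesis by (simp add: Q_def)
qed

lemma clique_containers:
  assumes l: "2 \<le> l" and k: "l < k" and \<epsilon>: "\<epsilon> > 0"
  obtains K :: real and n0 :: nat where "K > 0"
    "\<And>n. n \<ge> n0 \<Longrightarrow> containable (few_cliques k l n \<epsilon>)
       (nsets {..<n} l) (K * (real (n choose l) / clique_scale l k n + 1))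
       (clique_free k l n)"
proof -
  \<comment> \<open>Chosen so that \<kappa> N n^(k - l) \<le> n choose k once n \<ge> 2 k, where N =
    n choose l. The container theorem for \<epsilon> \<kappa> then leaves at most \<epsilon> (n
    choose k) cliques in a container.\<close>
  define \<kappa> where "\<kappa> = 1 / ((2 * real k) ^ (k - l) * real (k choose l))"
  have kl: "real (k choose l) > 0" using k by simp
  have \<kappa>: "\<kappa> > 0" using k kl by (simp add: \<kappa>_def zero_less_mult_iff)
  have "\<epsilon> * \<kappa> > 0" "1 \<le> k choose l" using \<epsilon> \<kappa> k by (simp_all add: Suc_le_eq)
  from hypergraph_containers[OF this, where 'a = "nat set"] obtain K where K: "K > 0"
    "\<And>(V :: nat set set) H (Q :: real). finite V \<Longrightarrow> V \<noteq> {} \<Longrightarrow> H \<subseteq> nsets V (k choose l) \<Longrightarrow> Q \<ge> 1 \<Longrightarrow>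
       (\<And>T. T \<noteq> {} \<Longrightarrow> real (hdeg H T) * Q ^ card T \<le> Q ^ (k choose l)) \<Longrightarrow>
       containable (\<lambda>C. real (card {E\<in>H. E \<subseteq> C}) * Q < (\<epsilon> * \<kappa>) * real (card V) * Q ^ (k choose l)) V
         (K * (real (card V) / Q + 1)) {I. \<forall>E\<in>H. \<not> E \<subseteq> I}" by blast
  show ?thesis
  proof (rule that[OF K(1)])
    fix n assume n: "2 * k \<le> n"
    define Q where "Q = clique_scale l k n"
    define V where "V = nsets {..<n} l"
    define H where "H = clique_family l k n"
    have n1: "1 \<le> n" using n k by simp
    have cV: "card V = n choose l" by (simp add: V_def card_nsets)
    have finV: "finite V" by (simp add: V_def finite_imp_finite_nsets)
    have "card V > 0" using n k by (simp add: cV)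
    then have V: "V \<noteq> {}" by auto
    have Q: "Q \<ge> 1" using clique_scale_ge_1[OF l k n1] by (simp add: Q_def)
    have HV: "H \<subseteq> nsets V (k choose l)"
    proof
      fix E assume "E \<in> H"
      then obtain K' where K': "K' \<in> nsets {..<n} k" "E = nsets K' l" by (auto simp: H_def clique_family_def)
      then have "finite K'" "card K' = k" "K' \<subseteq> {..<n}" by (auto simp: nsets_def)
      then show "E \<in> nsets V (k choose l)"
        using K' card_nsets[of K' l] nsets_mono[of K' "{..<n}" l] finite_imp_finite_nsets[of K' l]
        unfolding nsets_def[of V] by (simp add: V_def)
    qed
    have "containable (\<lambda>C. real (card {E\<in>H. E \<subseteq> C}) * Q < (\<epsilon> * \<kappa>) * real (card V) * Q ^ (k choose l)) V
         (K * (real (card V) / Q + 1)) {I. \<forall>E\<in>H. \<not> E \<subseteq> I}"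
      by (rule K(2)[OF finV V HV Q]) (use hdeg_clique_family[OF l k n1] in \<open>simp add: H_def Q_def\<close>)
    moreover have "few_cliques k l n \<epsilon> C"
      if C: "real (card {E\<in>H. E \<subseteq> C}) * Q < (\<epsilon> * \<kappa>) * real (card V) * Q ^ (k choose l)" for C
    proof -
      have "{E\<in>H. E \<subseteq> C} = (\<lambda>K. nsets K l) ` {K \<in> nsets {..<n} k. nsets K l \<subseteq> C}"
        by (auto simp: H_def clique_family_def)
      moreover have "inj_on (\<lambda>K. nsets K l) {K \<in> nsets {..<n} k. nsets K l \<subseteq> C}"
        by (rule inj_on_subset[OF inj_on_nsets_right[of l k "{..<n}"]]) (use l k in auto)
      ultimately have c: "card {E\<in>H. E \<subseteq> C} = card {K \<in> nsets {..<n} k. nsets K l \<subseteq> C}"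
        by (simp add: card_image)
      have "real (card {E\<in>H. E \<subseteq> C}) * Q < (\<epsilon> * \<kappa> * real (n choose l) * real n ^ (k - l)) * Q"
        using C clique_scale_power[OF l k n1] by (simp add: cV Q_def mult_ac)
      then have "real (card {E\<in>H. E \<subseteq> C}) < \<epsilon> * \<kappa> * real (n choose l) * real n ^ (k - l)"
        using Q by simp
      also have "\<dots> = \<epsilon> * (\<kappa> * real (n choose l) * real n ^ (k - l))" by simp
      also have "\<dots> \<le> \<epsilon> * real (n choose k)"
      proof (rule mult_left_mono)
        have "real n ^ (k - l) / (2 * real k) ^ (k - l) = (real n / (2 * real k)) ^ (k - l)"
          by (simp add: power_divide)
        also have "\<dots> \<le> (real (n - l) / real (k - l)) ^ (k - l)"
        proof (rule power_mono)
          have "real n * real (k - l) \<le> real n * real k" by (intro mult_left_mono) auto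
          also have "\<dots> \<le> real (n - l) * (2 * real k)"
          proof -
            have "n \<le> 2 * (n - l)" using n k by simp
            then have "n * k \<le> 2 * (n - l) * k" by (rule mult_right_mono) simp
            then have "n * k \<le> (n - l) * (2 * k)" by (simp only: mult_ac)
            then show ?thesis by (metis of_nat_le_iff of_nat_mult of_nat_numeral)
          qed
          finally show "real n / (2 * real k) \<le> real (n - l) / real (k - l)"
            using k by (simp add: field_simps)
        qed simp
        also have "\<dots> \<le> real ((n - l) choose (k - l))"
          using n k by (intro binomial_ge_n_over_k_pow_k) simp
        finally have 1: "real n ^ (k - l) / (2 * real k) ^ (k - l) \<le> real ((n - l) choose (k - l))" .
        have 2: "real (n choose k) * real (k choose l) = real (n choose l) * real ((n - l) choose (k - l))"
          using choose_mult[of l k n] k n by (simp flip: of_nat_mult)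
        have "\<kappa> * real (n choose l) * real n ^ (k - l) =
            real (n choose l) * (real n ^ (k - l) / (2 * real k) ^ (k - l)) / real (k choose l)"
          by (simp add: \<kappa>_def)
        also have "\<dots> \<le> real (n choose l) * real ((n - l) choose (k - l)) / real (k choose l)"
          using 1 by (intro divide_right_mono mult_left_mono) auto
        also have "\<dots> = real (n choose k)" using 2 kl by (simp add: field_simps)
        finally show "\<kappa> * real (n choose l) * real n ^ (k - l) \<le> real (n choose k)" .
      qed (use \<epsilon> in simp)
      finally show ?thesis using c by simp
    qed
    moreover have "{I. \<forall>E\<in>H. \<not> E \<subseteq> I} = clique_free k l n"
      by (auto simp: H_def clique_family_def)
    ultimately show "containable (few_cliques k l n \<epsilon>)
       (nsets {..<n} l) (K * (real (n choose l) / clique_scale l k n + 1))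
       (clique_free k l n)"
      by (simp add: containable_good_mono V_def[symmetric] Q_def[symmetric] cV)
  qed
qed

section \<open>The union bound over fingerprints\<close>

lemma sum_Pow_power_card:
  fixes z :: real
  assumes "finite V"
  shows "(\<Sum>U\<in>Pow V. z ^ card U) = (1 + z) ^ card V"
proof -
  have "(1 + z) ^ card V = (\<Prod>x\<in>V. z + 1)" by (simp add: add.commute)
  also have "\<dots> = (\<Sum>U\<in>Pow V. (\<Prod>x\<in>U. z) * (\<Prod>x\<in>V-U. 1))" by (rule prod_add[OF assms])
  finally show ?thesis by simp
qed

text \<open>Exponential tilting: for card U \<le> B and y \<ge> 1 the summand is at most y powr B *
  (x / y)^card U. The restriction on \<open>U\<close> can then be dropped and the binomial theorem
  applies. A large y makes the exponential factor small, at the price y powr B.\<close>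

lemma sum_small_subsets_le:
  fixes x y B :: real
  assumes fin: "finite V" and x: "x \<ge> 0" and y: "y \<ge> 1"
  shows "(\<Sum>U\<in>{U \<in> Pow V. real (card U) \<le> B}. x ^ card U) \<le> y powr B * exp (x / y * real (card V))"
proof -
  have "(\<Sum>U\<in>{U \<in> Pow V. real (card U) \<le> B}. x ^ card U)
      \<le> (\<Sum>U\<in>{U \<in> Pow V. real (card U) \<le> B}. y powr B * (x / y) ^ card U)"
  proof (rule sum_mono)
    fix U assume "U \<in> {U \<in> Pow V. real (card U) \<le> B}"
    then have "y ^ card U \<le> y powr B" using y by (subst powr_realpow[symmetric]) (auto intro: powr_mono)
    then have "y ^ card U * (x / y) ^ card U \<le> y powr B * (x / y) ^ card U"
      using x y by (intro mult_right_mono) auto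
    then show "x ^ card U \<le> y powr B * (x / y) ^ card U"
      using y by (simp flip: power_mult_distrib)
  qed
  also have "\<dots> \<le> (\<Sum>U\<in>Pow V. y powr B * (x / y) ^ card U)"
    using fin x y by (intro sum_mono2) auto
  also have "\<dots> = y powr B * (1 + x / y) ^ card V"
    by (simp add: sum_Pow_power_card[OF fin] flip: sum_distrib_left)
  also have "\<dots> \<le> y powr B * exp (x / y) ^ card V"
    using x y by (intro mult_left_mono power_mono) auto
  also have "exp (x / y) ^ card V = exp (x / y * real (card V))"
    by (subst exp_of_nat_mult[symmetric]) (simp add: mult.commute)
  finally show ?thesis .
qed

text \<open>If a colouring has no monochromatic clique, then the edges of \<open>U\<close>, the
  union of the r fingerprints, are present, and all l-sets outside \<open>U\<close> and the
  containers are absent. A fixed \<open>U\<close> admits 2^(r * card U) tuples of subsets; together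
  with p^card U this is the sum of \<open>sum_small_subsets_le\<close> for x = 2^r p.\<close>

lemma prob_not_ramsey_le:
  fixes K \<epsilon> \<delta> p :: real
  defines "bern \<equiv> \<lambda>l n p. Pi_pmf (nsets {..<n} l) False (\<lambda>_. bernoulli_pmf p)"
  assumes p: "0 \<le> p" "p \<le> 1" and \<delta>: "\<delta> > 0"
    and cont: "containable (few_cliques k l n \<epsilon>)
       (nsets {..<n} l) b (clique_free k l n)"
    and sat: "\<And>C. (\<And>i. i < r \<Longrightarrow> few_cliques k l n \<epsilon> (C i)) \<Longrightarrow>
      2 * \<delta> * real (n choose l) \<le> real (card (nsets {..<n} l - (\<Union>i<r. C i)))"
    and b: "real r * b \<le> \<delta> * real (n choose l)" and y: "y \<ge> 1"
    and good0: "0 \<le> \<epsilon>" "1 \<le> l" "l \<le> k"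
  shows "measure_pmf.prob (bern l n p)
      {X. \<not> arrows l r k {..<n} {e \<in> nsets {..<n} l. X e}}
    \<le> y powr (real r * b) * exp ((2 ^ r / y - \<delta>) * p * real (n choose l))"
proof -
  define V where "V = nsets {..<n} l"
  define N where "N = real (n choose l)"
  define good where "good = few_cliques k l n \<epsilon>"
  have finV: "finite V" by (simp add: V_def finite_imp_finite_nsets)
  have cV: "real (card V) = N" by (simp add: V_def N_def card_nsets)
  from cont obtain f where f: "\<forall>I\<in>clique_free k l n. \<exists>S. fingerprint good V b f I S"
    unfolding containable_def V_def good_def ..
  \<comment> \<open>The union bound also runs over tuples of sets that are nobody's fingerprints.
    The default {} is good because it contains no clique, so that supersaturation applies to every
    tuple.\<close>
  define g where "g = (\<lambda>S. if good (f S) then f S else {})"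
  have good_g: "good (g S)" for S
  proof (cases "good (f S)")
    case False
    have "{K \<in> nsets {..<n} k. nsets K l \<subseteq> {}} = {}"
    proof (rule ccontr)
      assume "{K \<in> nsets {..<n} k. nsets K l \<subseteq> {}} \<noteq> {}"
      then obtain K where "K \<in> nsets {..<n} k" "nsets K l = {}" by auto
      then have "finite K" "card K = k" by (simp_all add: nsets_def)
      then have "k choose l = 0" using card_nsets[of K l] \<open>nsets K l = {}\<close> by simp
      then show False using good0 by simp
    qed
    then have "card {K \<in> nsets {..<n} k. nsets K l \<subseteq> {}} = 0" by (simp only: card.empty)
    then show ?thesis using False good0 by (simp add: g_def good_def)
  qed (simp add: g_def)
  define Us where "Us = {U \<in> Pow V. real (card U) \<le> real r * b}"
  \<comment> \<open>Removing \<open>U\<close> makes the required and the forbidden edges disjoint.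
    Since card U \<le> \<delta> N, at least \<delta> N of the 2 \<delta> N uncovered l-sets
    survive.\<close>
  define D where "D = (\<lambda>U \<sigma>. V - (\<Union>i<r. g (\<sigma> i)) - U)"
  define cyl where "cyl = (\<lambda>U \<sigma>. {X :: nat set \<Rightarrow> bool. (\<forall>e\<in>U. X e) \<and> (\<forall>e\<in>D U \<sigma>. \<not> X e)})"
  have finU: "finite Us" "\<And>U. U \<in> Us \<Longrightarrow> finite U"
    using finV by (auto simp: Us_def intro: finite_subset)
  have finP: "finite (PiE {..<r} (\<lambda>_. Pow U))" "card (PiE {..<r} (\<lambda>_. Pow U)) = (2 ^ r) ^ card U"
    if "U \<in> Us" for U :: "nat set set"
  proof -
    have U: "finite U" by (rule finU(2)[OF that])
    show "finite (PiE {..<r} (\<lambda>_. Pow U))" using U by (intro finite_PiE) auto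
    show "card (PiE {..<r} (\<lambda>_. Pow U)) = (2 ^ r) ^ card U"
      using U by (simp add: card_PiE card_Pow mult.commute flip: power_mult)
  qed
  have sub: "{X. \<not> arrows l r k {..<n} {e \<in> V. X e}}
      \<subseteq> (\<Union>U\<in>Us. \<Union>\<sigma>\<in>PiE {..<r} (\<lambda>_. Pow U). cyl U \<sigma>)"
  proof
    fix X assume "X \<in> {X. \<not> arrows l r k {..<n} {e \<in> V. X e}}"
    then have "\<not> arrows l r k {..<n} {e \<in> V. X e}" by simp
    then obtain col where col: "col \<in> {e \<in> V. X e} \<rightarrow> {..<r}"
      "\<And>K i. K \<in> nsets {..<n} k \<Longrightarrow> nsets K l \<subseteq> {e \<in> V. X e} \<Longrightarrow> \<not> (\<forall>e\<in>nsets K l. col e = i)"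
      unfolding ramsey_for_complete_iff[OF finite_lessThan] by blast
    define I where "I = (\<lambda>i. {e \<in> V. X e \<and> col e = i})"
    have indep: "I i \<in> clique_free k l n" for i
    proof -
      have "\<not> nsets K l \<subseteq> I i" if K: "K \<in> nsets {..<n} k" for K
      proof
        assume s: "nsets K l \<subseteq> I i"
        then have "nsets K l \<subseteq> {e \<in> V. X e}" "\<forall>e\<in>nsets K l. col e = i" by (auto simp: I_def)
        then show False using col(2)[OF K] by blast
      qed
      then show ?thesis by blast
    qed
    have "\<forall>i. \<exists>S. fingerprint good V b f (I i) S" using bspec[OF f indep] by blast
    from choice[OF this] obtain S where "\<forall>i. fingerprint good V b f (I i) (S i)" ..
    then have S: "\<forall>i. S i \<subseteq> I i \<inter> V \<and> real (card (S i)) \<le> b \<and>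
        f (S i) \<subseteq> V \<and> I i \<inter> V \<subseteq> S i \<union> f (S i) \<and> good (f (S i))" by (simp add: fingerprint_def)
    define U where "U = (\<Union>i<r. S i)"
    define \<sigma> where "\<sigma> = restrict S {..<r}"
    have UV: "U \<subseteq> V" using S by (auto simp: U_def)
    have "real (card U) \<le> real (\<Sum>i<r. card (S i))"
      unfolding U_def by (intro of_nat_mono card_UN_le) simp
    also have "\<dots> = (\<Sum>i<r. real (card (S i)))" by simp
    also have "\<dots> \<le> real r * b" using S sum_bounded_above[of "{..<r}" "\<lambda>i. real (card (S i))" b] by simp
    finally have "U \<in> Us" using UV by (simp add: Us_def)
    moreover have "\<sigma> \<in> PiE {..<r} (\<lambda>_. Pow U)" by (auto simp: \<sigma>_def U_def)
    moreover have "X \<in> cyl U \<sigma>"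
    proof -
      have "X e" if "e \<in> U" for e
      proof -
        from that obtain i where "e \<in> S i" by (auto simp: U_def)
        then have "e \<in> I i" using S by blast
        then show ?thesis by (simp add: I_def)
      qed
      moreover have "\<not> X e" if e: "e \<in> D U \<sigma>" for e
      proof
        assume "X e"
        then have "e \<in> I (col e)" "e \<in> V" "col e < r" using e col(1) by (auto simp: I_def D_def)
        then have "e \<in> S (col e) \<union> f (S (col e))" using S by blast
        moreover have "g (\<sigma> (col e)) = f (S (col e))" using \<open>col e < r\<close> S by (simp add: g_def \<sigma>_def)
        ultimately show False using e \<open>col e < r\<close> by (auto simp: D_def U_def)
      qed
      ultimately show ?thesis by (simp add: cyl_def)
    qed
    ultimately show "X \<in> (\<Union>U\<in>Us. \<Union>\<sigma>\<in>PiE {..<r} (\<lambda>_. Pow U). cyl U \<sigma>)" by blast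
  qed
  let ?P = "measure_pmf.prob (bern l n p)"
  have cylP: "?P (cyl U \<sigma>) \<le> p ^ card U * exp (- (p * \<delta> * N))" if U: "U \<in> Us" for U \<sigma>
  proof -
    have "?P (cyl U \<sigma>) = p ^ card U * (1 - p) ^ card (D U \<sigma>)"
      unfolding cyl_def bern_def
      by (rule prob_bernoulli_cylinder) (use U p finV in \<open>auto simp: Us_def D_def V_def\<close>)
    moreover have "(1 - p) ^ card (D U \<sigma>) \<le> exp (- (p * \<delta> * N))"
    proof -
      have "2 * \<delta> * N \<le> real (card (V - (\<Union>i<r. g (\<sigma> i))))"
        using sat[of "\<lambda>i. g (\<sigma> i)"] good_g by (simp add: good_def V_def N_def)
      moreover have "card (V - (\<Union>i<r. g (\<sigma> i))) \<le> card (D U \<sigma>) + card U"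
      proof -
        have "card (V - (\<Union>i<r. g (\<sigma> i))) \<le> card (D U \<sigma> \<union> U)"
          using finV finU(2)[OF U] by (intro card_mono) (auto simp: D_def)
        also have "\<dots> \<le> card (D U \<sigma>) + card U" by (rule card_Un_le)
        finally show ?thesis .
      qed
      moreover have "real (card U) \<le> \<delta> * N" using U b by (simp add: Us_def N_def)
      ultimately have "\<delta> * N \<le> real (card (D U \<sigma>))" by linarith
      then have "p * (\<delta> * N) \<le> p * real (card (D U \<sigma>))" using p by (intro mult_left_mono)
      moreover have "(1 - p) ^ card (D U \<sigma>) \<le> exp (- p) ^ card (D U \<sigma>)"
        using p exp_ge_add_one_self[of "- p"] by (intro power_mono) auto
      moreover have "exp (- p) ^ card (D U \<sigma>) = exp (- (p * real (card (D U \<sigma>))))"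
        by (simp add: exp_of_nat_mult[symmetric] mult.commute)
      ultimately show ?thesis by (simp add: mult.assoc order.trans)
    qed
    ultimately show ?thesis using p by (simp add: mult_left_mono)
  qed
  have "?P {X. \<not> arrows l r k {..<n} {e \<in> V. X e}}
      \<le> ?P (\<Union>U\<in>Us. \<Union>\<sigma>\<in>PiE {..<r} (\<lambda>_. Pow U). cyl U \<sigma>)"
    by (intro measure_pmf.finite_measure_mono sub) simp
  also have "\<dots> \<le> (\<Sum>U\<in>Us. ?P (\<Union>\<sigma>\<in>PiE {..<r} (\<lambda>_. Pow U). cyl U \<sigma>))"
    by (rule measure_pmf.finite_measure_subadditive_finite) (use finU in auto)
  also have "\<dots> \<le> (\<Sum>U\<in>Us. \<Sum>\<sigma>\<in>PiE {..<r} (\<lambda>_. Pow U). ?P (cyl U \<sigma>))"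
    using finP by (intro sum_mono measure_pmf.finite_measure_subadditive_finite) auto
  also have "\<dots> \<le> (\<Sum>U\<in>Us. \<Sum>\<sigma>\<in>PiE {..<r} (\<lambda>_. Pow U). p ^ card U * exp (- (p * \<delta> * N)))"
    by (intro sum_mono cylP)
  also have "\<dots> = (\<Sum>U\<in>Us. (2 ^ r * p) ^ card U) * exp (- (p * \<delta> * N))"
    using finP by (simp add: sum_distrib_right power_mult_distrib mult.assoc)
  also have "\<dots> \<le> (y powr (real r * b) * exp (2 ^ r * p / y * N)) * exp (- (p * \<delta> * N))"
    unfolding Us_def using sum_small_subsets_le[OF finV, of "2 ^ r * p" y "real r * b"] p y cV
    by (intro mult_right_mono) auto
  also have "\<dots> = y powr (real r * b) * exp ((2 ^ r / y - \<delta>) * p * N)"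
    by (simp add: mult.assoc algebra_simps flip: exp_add)
  finally show ?thesis by (simp add: V_def N_def)
qed

text \<open>As m \<ge> 1, the scale is at most n, and l \<ge> 2 leaves one factor n. The failure
  probability will be exponentially small in N / Q, so this quantity has to tend to
  infinity.\<close>

lemma choose_over_scale_ge:
  assumes l: "2 \<le> l" and k: "l < k" and n: "l \<le> n"
  shows "real n / real l ^ l \<le> real (n choose l) / clique_scale l k n"
proof -
  have n1: "1 \<le> n" using l n by simp
  have Q: "clique_scale l k n \<ge> 1" by (rule clique_scale_ge_1[OF l k n1])
  have "clique_scale l k n \<le> real n powr 1"
    unfolding clique_scale_def using clique_ratio_ge_1[OF l k] n1 by (intro powr_mono) auto
  then have Qn: "clique_scale l k n \<le> real n" using n1 by simp
  have "real n / real l ^ l * clique_scale l k n \<le> real n / real l ^ l * real n"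
    using Qn by (intro mult_left_mono) auto
  also have "\<dots> = real n ^ 2 / real l ^ l" by (simp add: power2_eq_square)
  also have "\<dots> \<le> real n ^ l / real l ^ l"
    using l n1 by (intro divide_right_mono power_increasing) auto
  also have "\<dots> = (real n / real l) ^ l" by (simp add: power_divide)
  also have "\<dots> \<le> real (n choose l)" using binomial_ge_n_over_k_pow_k[OF n] .
  finally show ?thesis using Q by (simp add: pos_le_divide_eq)
qed

theorem ramsey_one_statement:
  fixes l k r :: nat
  assumes l: "2 \<le> l" and k: "l < k" and r: "1 \<le> r"
  obtains C :: real where "C > 0"
    "\<And>p :: nat \<Rightarrow> real. (\<And>n. 0 \<le> p n \<and> p n \<le> 1) \<Longrightarrow>
      eventually (\<lambda>n. p n \<ge> C / clique_scale l k n) sequentially \<Longrightarrow>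
      (\<lambda>n. ramsey_prob l r k n (p n)) \<longlonglongrightarrow> 1"
proof -
  have "1 \<le> l" "l \<le> k" using l k by auto
  from ramsey_supersaturation[OF this, of r] obtain \<epsilon> \<delta>2 :: real and n0 where \<epsilon>: "\<epsilon> > 0" and \<delta>2: "\<delta>2 > 0" and
    sat: "\<And>n C. n \<ge> n0 \<Longrightarrow>
      (\<And>i. i < r \<Longrightarrow> few_cliques k l n \<epsilon> (C i)) \<Longrightarrow>
      \<delta>2 * real (n choose l) \<le> real (card (nsets {..<n} l - (\<Union>i<r. C i)))" by blast
  define \<delta> where "\<delta> = \<delta>2 / 2"
  have \<delta>: "\<delta> > 0" using \<delta>2 by (simp add: \<delta>_def)
  from clique_containers[OF l k \<epsilon>] obtain K n1 where K: "K > 0" and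
    cont: "\<And>n. n \<ge> n1 \<Longrightarrow> containable (few_cliques k l n \<epsilon>)
       (nsets {..<n} l) (K * (real (n choose l) / clique_scale l k n + 1))
       (clique_free k l n)" by blast
  \<comment> \<open>The tilting parameter is large enough for 2^r / y \<le> \<delta> / 4.\<close>
  define y where "y = max 1 (2 ^ r * 4 / \<delta>)"
  have y: "y \<ge> 1" "2 ^ r / y \<le> \<delta> / 4" using \<delta> by (auto simp: y_def field_simps max_def)
  have lny: "ln y \<ge> 0" using y by simp
  \<comment> \<open>The factor 2 absorbs the + 1 of the fingerprint bound, as N / Q \<ge> 1. The
    resulting r b (1 + 4 ln y) \<le> \<delta> p N bounds the entropy r b ln y by \<delta> p N / 4;
    the tilt costs as much again, and - \<delta> p N / 2 is left in the exponent.\<close>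
  define C where "C = 2 * real r * K * (1 + 4 * ln y) / \<delta>"
  have C: "C > 0" using K r \<delta> lny by (simp add: C_def zero_less_mult_iff add_pos_nonneg)
  show ?thesis
  proof (rule that[OF C])
    fix p :: "nat \<Rightarrow> real"
    assume p: "\<And>n. 0 \<le> p n \<and> p n \<le> 1" and pC: "eventually (\<lambda>n. p n \<ge> C / clique_scale l k n) sequentially"
    let ?Pr = "\<lambda>n. ramsey_prob l r k n (p n)"
    have bound: "eventually (\<lambda>n. 1 - exp (- (\<delta> / 2 * C / real l ^ l) * real n) \<le> ?Pr n) sequentially"
      using pC eventually_ge_at_top[of n0] eventually_ge_at_top[of n1] eventually_ge_at_top[of "l ^ l"]
        eventually_ge_at_top[of l]
    proof eventually_elim
      case (elim n)
      define N where "N = real (n choose l)"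
      define Q where "Q = clique_scale l k n"
      define b where "b = K * (N / Q + 1)"
      have Q1: "Q \<ge> 1" using clique_scale_ge_1[OF l k, of n] elim(5) l by (simp add: Q_def)
      have NQ: "real n / real l ^ l \<le> N / Q"
        unfolding N_def Q_def by (rule choose_over_scale_ge[OF l k elim(5)])
      have "1 \<le> real n / real l ^ l" using elim(4) l by (simp add: field_simps flip: of_nat_power)
      then have NQ1: "1 \<le> N / Q" using NQ by linarith
      have N0: "N \<ge> 0" by (simp add: N_def)
      have pN: "C * (N / Q) \<le> p n * N"
      proof -
        have "C / Q * N \<le> p n * N" using elim(1) N0 by (intro mult_right_mono) (auto simp: Q_def)
        then show ?thesis by simp
      qed
      have rb: "real r * b \<le> 2 * real r * K * (N / Q)"
      proof -
        have "real r * K * (N / Q + 1) \<le> real r * K * (2 * (N / Q))"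
          using NQ1 K by (intro mult_left_mono) auto
        then show ?thesis by (simp add: b_def mult_ac)
      qed
      also have "\<dots> * (1 + 4 * ln y) = \<delta> * (C * (N / Q))" using \<delta> by (simp add: C_def)
      also have "\<dots> \<le> \<delta> * (p n * N)" using pN \<delta> by (intro mult_left_mono) auto
      finally have key: "real r * b * (1 + 4 * ln y) \<le> \<delta> * (p n * N)" using lny by simp
      have b0: "0 \<le> real r * b" using K NQ1 by (simp add: b_def)
      have rbN: "real r * b \<le> \<delta> * N"
      proof -
        have "real r * b * 1 \<le> real r * b * (1 + 4 * ln y)" using b0 lny by (intro mult_left_mono) auto
        also have "\<dots> \<le> \<delta> * (p n * N)" by (rule key)
        also have "\<dots> \<le> \<delta> * (1 * N)" using p[of n] \<delta> N0 by (intro mult_left_mono mult_right_mono) auto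
        finally show ?thesis by simp
      qed
      have "measure_pmf.prob (Pi_pmf (nsets {..<n} l) False (\<lambda>_. bernoulli_pmf (p n)))
          {X. \<not> arrows l r k {..<n} {e \<in> nsets {..<n} l. X e}}
          \<le> y powr (real r * b) * exp ((2 ^ r / y - \<delta>) * p n * real (n choose l))"
      proof (rule prob_not_ramsey_le[OF _ _ \<delta>])
        show "containable (few_cliques k l n \<epsilon>)
            (nsets {..<n} l) b (clique_free k l n)"
          using cont[OF elim(3)] by (simp add: b_def N_def Q_def)
        show "2 * \<delta> * real (n choose l) \<le> real (card (nsets {..<n} l - (\<Union>i<r. C i)))"
          if "\<And>i. i < r \<Longrightarrow> few_cliques k l n \<epsilon> (C i)" for C
          using sat[OF elim(2) that] by (simp add: \<delta>_def)
        show "real r * b \<le> \<delta> * real (n choose l)" using rbN by (simp add: N_def)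
      qed (use p y \<epsilon> l k in auto)
      also have "y powr (real r * b) * exp ((2 ^ r / y - \<delta>) * p n * real (n choose l))
          = exp (real r * b * ln y + (2 ^ r / y - \<delta>) * (p n * N))"
        using y by (simp add: powr_def N_def mult.assoc flip: exp_add)
      also have "\<dots> \<le> exp (- (\<delta> / 2 * C / real l ^ l) * real n)"
      proof (subst exp_le_cancel_iff)
        have pN0: "0 \<le> p n * N" using p[of n] N0 by simp
        have 1: "(2 ^ r / y - \<delta>) * (p n * N) \<le> (\<delta> / 4 - \<delta>) * (p n * N)"
          using y(2) pN0 by (intro mult_right_mono diff_right_mono)
        have 2: "real r * b * ln y \<le> \<delta> * (p n * N) / 4" using key b0 by (simp add: algebra_simps)
        have "C * (real n / real l ^ l) \<le> C * (N / Q)" using NQ C by (intro mult_left_mono) auto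
        then have "C * (real n / real l ^ l) \<le> p n * N" using pN by linarith
        then have "\<delta> / 2 * (C * (real n / real l ^ l)) \<le> \<delta> / 2 * (p n * N)"
          using \<delta> by (intro mult_left_mono) auto
        then have 3: "\<delta> / 2 * C / real l ^ l * real n \<le> \<delta> * (p n * N) / 2" by simp
        have 4: "(\<delta> / 4 - \<delta>) * (p n * N) = - 3 * (\<delta> * (p n * N)) / 4" by (simp add: algebra_simps)
        show "real r * b * ln y + (2 ^ r / y - \<delta>) * (p n * N) \<le> - (\<delta> / 2 * C / real l ^ l) * real n"
          using 1 2 3 4 by linarith
      qed
      finally have "measure_pmf.prob (random_hypergraph l n (p n)) {G. \<not> ramsey_for l r (complete_hypergraph l k) G}
          \<le> exp (- (\<delta> / 2 * C / real l ^ l) * real n)"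
        by (subst prob_random_hypergraph)
      moreover have "{G. \<not> ramsey_for l r (complete_hypergraph l k) G} =
          space (measure_pmf (random_hypergraph l n (p n))) - {G. ramsey_for l r (complete_hypergraph l k) G}"
        by auto
      ultimately show ?case
        using measure_pmf.prob_compl[of "{G. ramsey_for l r (complete_hypergraph l k) G}" "random_hypergraph l n (p n)"]
        by simp
    qed
    define a where "a = \<delta> / 2 * C / real l ^ l"
    have "a > 0" using \<delta> C l by (simp add: a_def)
    then have "(\<lambda>n. 1 - exp (- a * real n)) \<longlonglongrightarrow> 1" by real_asymp
    then have lim: "(\<lambda>n. 1 - exp (- (\<delta> / 2 * C / real l ^ l) * real n)) \<longlonglongrightarrow> 1"
      by (simp only: a_def)
    show "?Pr \<longlonglongrightarrow> 1"
      by (rule tendsto_sandwich[OF bound _ lim tendsto_const]) (simp add: eventually_sequentially)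
  qed
qed

section \<open>Edge-minimal hypergraphs without good 2-colourings\<close>

definition cliques :: "nat \<Rightarrow> nat \<Rightarrow> 'a set set \<Rightarrow> 'a set set" where
  "cliques k l \<E> = {K. finite K \<and> card K = k \<and> nsets K l \<subseteq> \<E>}"

definition good_colouring :: "nat \<Rightarrow> nat \<Rightarrow> 'a set set \<Rightarrow> ('a set \<Rightarrow> bool) \<Rightarrow> bool" where
  "good_colouring k l \<E> c \<longleftrightarrow> (\<forall>K\<in>cliques k l \<E>. \<forall>b. \<exists>e\<in>nsets K l. c e \<noteq> b)"

definition two_colourable :: "nat \<Rightarrow> nat \<Rightarrow> 'a set set \<Rightarrow> bool" where
  "two_colourable k l \<E> \<longleftrightarrow> (\<exists>c. good_colouring k l \<E> c)"

lemma good_colouringD: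
  "good_colouring k l \<E> c \<Longrightarrow> K \<in> cliques k l \<E> \<Longrightarrow> \<exists>e\<in>nsets K l. c e \<noteq> b"
  by (simp add: good_colouring_def)

lemma two_colourableI:
  fixes c :: "'a set \<Rightarrow> bool"
  assumes "\<And>K b. K \<in> cliques k l \<E> \<Longrightarrow> \<exists>e\<in>nsets K l. c e \<noteq> b"
  shows "two_colourable k l \<E>"
  unfolding two_colourable_def good_colouring_def by (intro exI[of _ c] ballI allI assms)

text \<open>There is no ambient vertex set: the vertices are those in \<open>\<Union>\<E>\<close>,
  so none is isolated, and minimality refers to edges only.\<close>

definition critical :: "nat \<Rightarrow> nat \<Rightarrow> 'a set set \<Rightarrow> bool" where
  "critical k l \<E> \<longleftrightarrow> finite \<E> \<and> (\<forall>e\<in>\<E>. finite e \<and> card e = l) \<and>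
     \<not> two_colourable k l \<E> \<and> (\<forall>\<F>. \<F> \<subset> \<E> \<longrightarrow> two_colourable k l \<F>)"

lemma ex_critical:
  assumes "finite \<E>" "\<And>e. e \<in> \<E> \<Longrightarrow> finite e \<and> card e = l" "\<not> two_colourable k l \<E>"
  shows "\<exists>\<F>\<subseteq>\<E>. critical k l \<F>"
  using assms
proof (induction rule: finite_psubset_induct)
  case (psubset \<E>)
  show ?case
  proof (cases "\<exists>\<F>\<subset>\<E>. \<not> two_colourable k l \<F>")
    case True
    then obtain \<F> where \<F>: "\<F> \<subset> \<E>" "\<not> two_colourable k l \<F>" by blast
    then have "\<exists>\<G>\<subseteq>\<F>. critical k l \<G>" using psubset by blast
    with \<F>(1) show ?thesis by blast
  next
    case False
    then have "critical k l \<E>" using psubset.hyps psubset.prems by (simp add: critical_def)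
    then show ?thesis by blast
  qed
qed

lemma critical_nonempty:
  assumes crit: "critical k l \<E>" and k: "l \<le> k"
  shows "\<E> \<noteq> {}"
proof
  assume e: "\<E> = {}"
  have "two_colourable k l \<E>"
  proof (rule two_colourableI)
    fix K b assume "K \<in> cliques k l \<E>"
    then have "finite K" "card K = k" "nsets K l = {}" by (auto simp: cliques_def e)
    then show "\<exists>e\<in>nsets K l. True \<noteq> b" using k by (simp add: nsets_eq_empty_iff)
  qed
  then show False using crit by (simp add: critical_def)
qed

text \<open>If no clique other than \<open>K\<close> contains \<open>f\<close>, a good colouring of
  \<open>\<E> - {f}\<close> extends to \<open>f\<close> by the colour opposite to that of another
  edge of \<open>K\<close>. As \<open>K\<close> is arbitrary, the lemma provides a first clique
  through \<open>f\<close> as well as one that differs from a given clique.\<close>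

lemma critical_edge_two_cliques:
  assumes crit: "critical k l \<E>" and l: "2 \<le> l" and k: "l < k" and f: "f \<in> \<E>"
  shows "\<exists>K'\<in>cliques k l \<E>. f \<in> nsets K' l \<and> K' \<noteq> K"
proof (rule ccontr)
  assume "\<not> ?thesis"
  then have uniq: "\<And>K'. K' \<in> cliques k l \<E> \<Longrightarrow> f \<in> nsets K' l \<Longrightarrow> K' = K" by blast
  have "\<E> - {f} \<subset> \<E>" using f by blast
  then have "two_colourable k l (\<E> - {f})" using crit by (simp add: critical_def)
  then obtain c where c: "good_colouring k l (\<E> - {f}) c"
    by (auto simp: two_colourable_def)
  define c' where "c' = (\<lambda>e. if e = f then \<not> c (SOME g. g \<in> nsets K l \<and> g \<noteq> f) else c e)"
  have "\<exists>e\<in>nsets K' l. c' e \<noteq> b" if K': "K' \<in> cliques k l \<E>" for K' b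
  proof (cases "f \<in> nsets K' l")
    case False
    then have "K' \<in> cliques k l (\<E> - {f})" using K' by (auto simp: cliques_def)
    from good_colouringD[OF c this, of b] obtain e where "e \<in> nsets K' l" "c e \<noteq> b" ..
    then show ?thesis using False by (auto simp: c'_def)
  next
    case True
    then have KK: "K' = K" using uniq K' by blast
    have "card (nsets K l) = k choose l" using K' KK by (simp add: cliques_def card_nsets)
    moreover have "k choose l > 1"
    proof -
      have "(l choose l) * 1 < (Suc l choose l) * 1" using l by simp
      also have "\<dots> \<le> k choose l" using k binomial_right_mono[of "Suc l" k l] by simp
      finally show ?thesis by simp
    qed
    ultimately have "\<not> nsets K l \<subseteq> {f}" using card_mono[of "{f}" "nsets K l"] by auto
    then have "\<exists>g. g \<in> nsets K l \<and> g \<noteq> f" by blast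
    from someI_ex[OF this] have g: "(SOME g. g \<in> nsets K l \<and> g \<noteq> f) \<in> nsets K l"
      "(SOME g. g \<in> nsets K l \<and> g \<noteq> f) \<noteq> f" by auto
    then have "c' (SOME g. g \<in> nsets K l \<and> g \<noteq> f) \<noteq> c' f" by (simp add: c'_def)
    then show ?thesis using g(1) True KK by blast
  qed
  then have "two_colourable k l \<E>" by (rule two_colourableI)
  then show False using crit by (simp add: critical_def)
qed

text \<open>Otherwise no clique mixes edges of \<F> with edges of its complement, and good
  colourings of the two parts, available by minimality, combine to one of \<E>.\<close>

lemma critical_connected:
  assumes crit: "critical k l \<E>" and \<F>: "\<F> \<subset> \<E>" "\<F> \<noteq> {}"
  shows "\<exists>K\<in>cliques k l \<E>. nsets K l \<inter> \<F> \<noteq> {} \<and> \<not> nsets K l \<subseteq> \<F>"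
proof (rule ccontr)
  assume "\<not> ?thesis"
  then have sep: "\<And>K. K \<in> cliques k l \<E> \<Longrightarrow> nsets K l \<inter> \<F> = {} \<or> nsets K l \<subseteq> \<F>" by blast
  have "\<E> - \<F> \<subset> \<E>" using \<F> by blast
  then have "two_colourable k l \<F>" "two_colourable k l (\<E> - \<F>)"
    using crit \<F>(1) by (simp_all add: critical_def)
  then obtain c1 c2 where c1: "good_colouring k l \<F> c1" and c2: "good_colouring k l (\<E> - \<F>) c2"
    by (auto simp: two_colourable_def)
  define c where "c = (\<lambda>e. if e \<in> \<F> then c1 e else c2 e)"
  have "\<exists>e\<in>nsets K l. c e \<noteq> b" if K: "K \<in> cliques k l \<E>" for K b
  proof (cases "nsets K l \<subseteq> \<F>")
    case True
    then have "K \<in> cliques k l \<F>" using K by (simp add: cliques_def)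
    from good_colouringD[OF c1 this, of b] obtain e where "e \<in> nsets K l" "c1 e \<noteq> b" ..
    then show ?thesis using True by (auto simp: c_def)
  next
    case False
    then have dis: "nsets K l \<inter> \<F> = {}" using sep[OF K] by blast
    then have "K \<in> cliques k l (\<E> - \<F>)" using K by (auto simp: cliques_def)
    from good_colouringD[OF c2 this, of b] obtain e where "e \<in> nsets K l" "c2 e \<noteq> b" ..
    then show ?thesis using dis by (auto simp: c_def)
  qed
  then have "two_colourable k l \<E>" by (rule two_colourableI)
  then show False using crit by (simp add: critical_def)
qed

section \<open>Degrees of vertices in critical hypergraphs\<close>

definition star :: "'a \<Rightarrow> nat \<Rightarrow> 'a set \<Rightarrow> 'a set set" where
  "star x l K = {e \<in> nsets K l. x \<in> e}"

lemma card_star: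
  assumes "finite K" "x \<in> K" "1 \<le> l"
  shows "card (star x l K) = (card K - 1) choose (l - 1)"
proof -
  have "bij_betw (insert x) (nsets (K - {x}) (l - 1)) (star x l K)"
  proof (rule bij_betwI[where g = "\<lambda>e. e - {x}"])
    show "insert x \<in> nsets (K - {x}) (l - 1) \<rightarrow> star x l K"
      using assms by (auto simp: nsets_def star_def card_insert_if)
    show "(\<lambda>e. e - {x}) \<in> star x l K \<rightarrow> nsets (K - {x}) (l - 1)"
      by (auto simp: nsets_def star_def)
  qed (auto simp: nsets_def star_def)
  then have "card (star x l K) = card (nsets (K - {x}) (l - 1))" by (metis bij_betw_same_card)
  also have "\<dots> = card (K - {x}) choose (l - 1)" using assms by (intro card_nsets) auto
  finally show ?thesis using assms by simp
qed

lemma finite_star: "finite K \<Longrightarrow> finite (star x l K)"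
  by (rule finite_subset[OF _ finite_imp_finite_nsets[of K l]]) (auto simp: star_def)

text \<open>The cliques through \<open>x\<close> that the colouring \<open>c\<close> of the edges avoiding \<open>x\<close> threatens to make
  monochromatic in colour \<open>b\<close>.\<close>

definition threats :: "nat \<Rightarrow> nat \<Rightarrow> 'a set set \<Rightarrow> 'a \<Rightarrow> ('a set \<Rightarrow> bool) \<Rightarrow> bool \<Rightarrow> 'a set set" where
  "threats k l \<E> x c b = {K \<in> cliques k l \<E>. x \<in> K \<and> (\<forall>e\<in>nsets K l. x \<notin> e \<longrightarrow> c e = b)}"

text \<open>An l-subset of \<open>K \<inter> K'\<close> that avoids \<open>x\<close> would need both
  colours. So \<open>K \<inter> K'\<close> has at most l elements, and the only edge that both stars
  can contain is \<open>K \<inter> K'\<close> itself.\<close>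

lemma opposite_threats_inter:
  assumes K: "K \<in> threats k l \<E> x c b" and K': "K' \<in> threats k l \<E> x c (\<not> b)" and l: "1 \<le> l"
  shows "card (star x l K \<inter> star x l K') \<le> 1"
proof -
  have fin: "finite K" "finite K'" using K K' by (auto simp: threats_def cliques_def)
  have c: "card (K \<inter> K' - {x}) < l"
  proof (rule ccontr)
    assume "\<not> ?thesis"
    then obtain e where e: "e \<subseteq> K \<inter> K' - {x}" "card e = l" "finite e"
      using obtain_subset_with_card_n[of l "K \<inter> K' - {x}"] by (metis not_le)
    then have "e \<in> nsets K l" "e \<in> nsets K' l" "x \<notin> e" by (auto simp: nsets_def)
    then show False using K K' by (auto simp: threats_def)
  qed
  have "e = K \<inter> K'" if "e \<in> star x l K \<inter> star x l K'" for e
  proof -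
    have e: "e \<subseteq> K \<inter> K'" "card e = l" "x \<in> e" using that by (auto simp: star_def nsets_def)
    have "x \<in> K \<inter> K'" using e by blast
    then have "card (K \<inter> K') \<le> l" using c fin by (simp add: card_Diff_singleton)
    then show ?thesis using e fin by (intro card_seteq) auto
  qed
  then have "star x l K \<inter> star x l K' \<subseteq> {K \<inter> K'}" by blast
  then show ?thesis using card_mono[of "{K \<inter> K'}"] by simp
qed

lemma sum_small_inter_le:
  assumes "finite \<M>" "S \<subseteq> \<Union>\<M>" "\<And>M. M \<in> \<M> \<Longrightarrow> card (S \<inter> M) \<le> 1"
  shows "card S \<le> card \<M>"
proof -
  have "S = (\<Union>M\<in>\<M>. S \<inter> M)" using assms(2) by blast
  then have "card S \<le> (\<Sum>M\<in>\<M>. card (S \<inter> M))" using card_UN_le[OF assms(1), of "\<lambda>M. S \<inter> M"] by simp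
  also have "\<dots> \<le> (\<Sum>M\<in>\<M>. 1)" by (intro sum_mono assms(3))
  finally show ?thesis by simp
qed

text \<open>Take a maximal family of threats of colour b with disjoint stars. Give the edges of
  these stars the colour opposite to b and all other edges at \<open>x\<close> the colour b. Some
  clique is monochromatic; it contains \<open>x\<close> by the choice of \<open>c\<close>, and by
  maximality its colour is not b. It is thus an opposite threat whose star is covered by the packed
  stars. Each of them shares at most one edge with it, so there are at least as many as the star has
  edges.\<close>

lemma star_packing:
  assumes l: "2 \<le> l" and k: "l < k"
    and fin: "finite \<E>" "\<And>e. e \<in> \<E> \<Longrightarrow> finite e" and nc: "\<not> two_colourable k l \<E>"
    and c: "\<forall>K\<in>cliques k l \<E>. x \<notin> K \<longrightarrow> (\<forall>b. \<exists>e\<in>nsets K l. c e \<noteq> b)"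
  shows "\<exists>\<M>\<subseteq>threats k l \<E> x c b. finite \<M> \<and> disjoint_family_on (star x l) \<M> \<and>
    (k - 1) choose (l - 1) \<le> card \<M>"
proof -
  let ?a = "(k - 1) choose (l - 1)"
  let ?T = "threats k l \<E> x c b"
  have a0: "?a > 0" using l k by simp
  have cstar: "card (star x l K) = ?a" if "K \<in> cliques k l \<E>" "x \<in> K" for K
    using that card_star[of K x l] l by (simp add: cliques_def)
  have finT: "finite ?T"
  proof (rule finite_subset)
    show "?T \<subseteq> Pow (\<Union>\<E>)"
    proof
      fix K assume "K \<in> ?T"
      then have K: "finite K" "card K = k" "nsets K l \<subseteq> \<E>" "x \<in> K" by (auto simp: threats_def cliques_def)
      show "K \<in> Pow (\<Union>\<E>)"
      proof
        show "K \<subseteq> \<Union>\<E>"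
        proof
          fix y assume y: "y \<in> K"
          have "card (star y l K) > 0" using card_star[OF K(1) y, of l] l k K(2) by simp
          then obtain e where "e \<in> star y l K" by (metis card.empty ex_in_conv less_irrefl)
          then show "y \<in> \<Union>\<E>" using K(3) by (auto simp: star_def)
        qed
      qed
    qed
    show "finite (Pow (\<Union>\<E>))" using fin by auto
  qed
  define \<A> where "\<A> = {\<M>. \<M> \<subseteq> ?T \<and> disjoint_family_on (star x l) \<M>}"
  have "finite \<A>" using finT by (intro finite_subset[of \<A> "Pow ?T"]) (auto simp: \<A>_def)
  moreover have "\<A> \<noteq> {}"
  proof -
    have "{} \<in> \<A>" by (simp add: \<A>_def disjoint_family_on_def)
    then show ?thesis by blast
  qed
  ultimately obtain \<M> where \<M>: "\<M> \<in> \<A>" "\<And>\<N>. \<N> \<in> \<A> \<Longrightarrow> \<M> \<subseteq> \<N> \<Longrightarrow> \<M> = \<N>"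
    using finite_has_maximal[of \<A>] by metis
  have \<M>T: "\<M> \<subseteq> ?T" and disj: "disjoint_family_on (star x l) \<M>" using \<M>(1) by (auto simp: \<A>_def)
  have fin\<M>: "finite \<M>" using \<M>T finT finite_subset by blast
  have meet: "star x l K \<inter> (\<Union>M\<in>\<M>. star x l M) \<noteq> {}" if K: "K \<in> ?T" for K
  proof
    assume e: "star x l K \<inter> (\<Union>M\<in>\<M>. star x l M) = {}"
    have ne: "star x l K \<noteq> {}" using cstar[of K] K a0 by (auto simp: threats_def)
    have "insert K \<M> \<in> \<A>"
      using K \<M>T disj e by (auto simp: \<A>_def disjoint_family_on_def)
    then have "K \<in> \<M>" using \<M>(2)[of "insert K \<M>"] by blast
    then show False using e ne by blast
  qed
  define c' where "c' = (\<lambda>e. if x \<in> e then (if e \<in> (\<Union>M\<in>\<M>. star x l M) then \<not> b else b) else c e)"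
  have "\<not> good_colouring k l \<E> c'" using nc by (auto simp: two_colourable_def)
  then obtain K b' where K: "K \<in> cliques k l \<E>" and mono: "\<And>e. e \<in> nsets K l \<Longrightarrow> c' e = b'"
    unfolding good_colouring_def by auto
  have xK: "x \<in> K"
  proof (rule ccontr)
    assume x: "x \<notin> K"
    have "\<exists>e\<in>nsets K l. c e \<noteq> b'" using bspec[OF c K] x by simp
    then obtain e where e: "e \<in> nsets K l" "c e \<noteq> b'" ..
    then have "x \<notin> e" using x by (auto simp: nsets_def)
    then show False using mono[OF e(1)] e(2) by (simp add: c'_def)
  qed
  have KT: "K \<in> threats k l \<E> x c b'"
  proof -
    have "c e = b'" if "e \<in> nsets K l" "x \<notin> e" for e
      using mono[OF that(1)] that(2) by (simp add: c'_def)
    then show ?thesis using K xK by (simp add: threats_def)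
  qed
  have b': "b' = (\<not> b)"
  proof (rule ccontr)
    assume "b' \<noteq> (\<not> b)"
    then have "b' = b" by blast
    then have "star x l K \<inter> (\<Union>M\<in>\<M>. star x l M) \<noteq> {}" using meet[of K] KT by simp
    then obtain e where e: "e \<in> star x l K" "e \<in> (\<Union>M\<in>\<M>. star x l M)" by blast
    then have "c' e = (\<not> b)" "e \<in> nsets K l" by (auto simp: c'_def star_def)
    then show False using mono \<open>b' = b\<close> by blast
  qed
  have "star x l K \<subseteq> \<Union>(star x l ` \<M>)"
  proof
    fix e assume "e \<in> star x l K"
    then have "e \<in> nsets K l" "x \<in> e" by (auto simp: star_def)
    then have "c' e = (\<not> b)" using mono b' by blast
    then show "e \<in> \<Union>(star x l ` \<M>)" using \<open>x \<in> e\<close> by (auto simp: c'_def split: if_splits)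
  qed
  then have "card (star x l K) \<le> card (star x l ` \<M>)"
  proof (rule sum_small_inter_le[rotated])
    fix S assume "S \<in> star x l ` \<M>"
    then obtain M where M: "M \<in> \<M>" "S = star x l M" by blast
    then show "card (star x l K \<inter> S) \<le> 1"
      using opposite_threats_inter[of M k l \<E> x c b K] \<M>T KT b' l by (auto simp: Int_commute)
  qed (use fin\<M> in auto)
  also have "\<dots> \<le> card \<M>" by (rule card_image_le[OF fin\<M>])
  finally have "?a \<le> card \<M>" using cstar[OF K xK] by simp
  then show ?thesis using \<M>T fin\<M> disj by blast
qed

lemma card_Union_stars:
  assumes "finite \<M>" "disjoint_family_on (star x l) \<M>" "\<And>K. K \<in> \<M> \<Longrightarrow> finite K \<and> card K = k \<and> x \<in> K" "1 \<le> l"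
  shows "card (\<Union>M\<in>\<M>. star x l M) = card \<M> * ((k - 1) choose (l - 1))"
proof -
  have "card (\<Union>M\<in>\<M>. star x l M) = (\<Sum>M\<in>\<M>. card (star x l M))"
    using assms by (intro card_UN_disjoint) (simp_all add: disjoint_family_on_def finite_star)
  also have "\<dots> = (\<Sum>M\<in>\<M>. (k - 1) choose (l - 1))"
  proof (rule sum.cong)
    fix M assume "M \<in> \<M>"
    then have "finite M" "card M = k" "x \<in> M" using assms(3) by auto
    then show "card (star x l M) = (k - 1) choose (l - 1)" using card_star[of M x l] assms(4) by simp
  qed simp
  finally show ?thesis by simp
qed

lemma critical_colouring_avoiding:
  assumes crit: "critical k l \<E>" and x: "x \<in> \<Union>\<E>"
  obtains c :: "'a set \<Rightarrow> bool" where "\<forall>K\<in>cliques k l \<E>. x \<notin> K \<longrightarrow> (\<forall>b. \<exists>e\<in>nsets K l. c e \<noteq> b)"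
proof -
  have "{e \<in> \<E>. x \<notin> e} \<subset> \<E>" using x by blast
  then have "two_colourable k l {e \<in> \<E>. x \<notin> e}" using crit by (simp add: critical_def)
  then obtain c where c: "good_colouring k l {e \<in> \<E>. x \<notin> e} c"
    by (auto simp: two_colourable_def)
  show ?thesis
  proof (rule that, intro ballI impI allI)
    fix K b assume "K \<in> cliques k l \<E>" "x \<notin> K"
    then have "K \<in> cliques k l {e \<in> \<E>. x \<notin> e}" by (auto simp: cliques_def nsets_def)
    then show "\<exists>e\<in>nsets K l. c e \<noteq> b" by (rule good_colouringD[OF c])
  qed
qed

text \<open>With a = (k - 1) choose (l - 1), a packing consists of at least a disjoint stars at
  \<open>x\<close>, each with a edges.\<close>

lemma critical_degree_ge:
  assumes crit: "critical k l \<E>" and l: "2 \<le> l" and k: "l < k" and x: "x \<in> \<Union>\<E>"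
  shows "((k - 1) choose (l - 1))\<^sup>2 \<le> card {e \<in> \<E>. x \<in> e}"
proof -
  let ?a = "(k - 1) choose (l - 1)"
  have fin: "finite \<E>" "\<And>e. e \<in> \<E> \<Longrightarrow> finite e" "\<not> two_colourable k l \<E>"
    using crit by (auto simp: critical_def)
  obtain c :: "'a set \<Rightarrow> bool"
    where c: "\<forall>K\<in>cliques k l \<E>. x \<notin> K \<longrightarrow> (\<forall>b. \<exists>e\<in>nsets K l. c e \<noteq> b)"
    using critical_colouring_avoiding[OF crit x] .
  from star_packing[OF l k fin c, of True] obtain \<M> where
    \<M>: "\<M> \<subseteq> threats k l \<E> x c True" "finite \<M>" "disjoint_family_on (star x l) \<M>" "?a \<le> card \<M>" by blast
  have "?a\<^sup>2 \<le> card \<M> * ?a" using \<M>(4) by (simp add: power2_eq_square)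
  also have "\<dots> = card (\<Union>M\<in>\<M>. star x l M)"
    by (rule card_Union_stars[symmetric]) (use \<M> l in \<open>auto simp: threats_def cliques_def\<close>)
  also have "\<dots> \<le> card {e \<in> \<E>. x \<in> e}"
    using fin \<M>(1) by (intro card_mono) (auto simp: star_def threats_def cliques_def)
  finally show ?thesis .
qed


text \<open>If \<open>k = l + 1\<close> and the degree bound is attained, the stars of both packings partition the
  edges at \<open>x\<close> and every star of one packing meets every star of the other. Two cliques of the
  same packing then share exactly \<open>x\<close> on the one hand and \<open>l - 1\<close> vertices on the other.\<close>

lemma critical_degree_gt:
  assumes crit: "critical (Suc l) l \<E>" and l: "3 \<le> l" and x: "x \<in> \<Union>\<E>"
  shows "l\<^sup>2 < card {e \<in> \<E>. x \<in> e}"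
proof (rule ccontr)
  define L where "L = {e \<in> \<E>. x \<in> e}"
  assume "\<not> ?thesis"
  then have cL: "card L \<le> l * l" by (simp add: L_def power2_eq_square)
  have fin: "finite \<E>" "\<And>e. e \<in> \<E> \<Longrightarrow> finite e" "\<not> two_colourable (Suc l) l \<E>"
    using crit by (auto simp: critical_def)
  have finL: "finite L" using fin by (simp add: L_def)
  obtain c :: "'a set \<Rightarrow> bool"
    where c: "\<forall>K\<in>cliques (Suc l) l \<E>. x \<notin> K \<longrightarrow> (\<forall>b. \<exists>e\<in>nsets K l. c e \<noteq> b)"
    using critical_colouring_avoiding[OF crit x] .
  have a: "(Suc l - 1) choose (l - 1) = l" using l binomial_symmetric[of "l - 1" l] by simp
  have l2: "2 \<le> l" using l by simp
  have "\<exists>\<M>\<subseteq>threats (Suc l) l \<E> x c b. finite \<M> \<and> disjoint_family_on (star x l) \<M> \<and>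
      card \<M> = l \<and> (\<Union>M\<in>\<M>. star x l M) = L" for b
  proof -
    from star_packing[OF l2 lessI fin c, of b] obtain \<M> where
      \<M>: "\<M> \<subseteq> threats (Suc l) l \<E> x c b" "finite \<M>" "disjoint_family_on (star x l) \<M>" "l \<le> card \<M>"
      unfolding a by blast
    have "card (\<Union>M\<in>\<M>. star x l M) = card \<M> * ((Suc l - 1) choose (l - 1))"
      by (rule card_Union_stars) (use \<M> l in \<open>auto simp: threats_def cliques_def\<close>)
    then have 1: "card (\<Union>M\<in>\<M>. star x l M) = card \<M> * l" unfolding a .
    have sub: "(\<Union>M\<in>\<M>. star x l M) \<subseteq> L"
      using \<M>(1) by (auto simp: L_def star_def threats_def cliques_def)
    have "card \<M> * l \<le> l * l" using card_mono[OF finL sub] cL unfolding 1 by (rule order.trans)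
    then have cM: "card \<M> = l" using \<M>(4) l by simp
    have "(\<Union>M\<in>\<M>. star x l M) = L"
      by (rule card_subset_eq[OF finL sub]) (use card_mono[OF finL sub] 1 cL cM in simp)
    then show ?thesis using \<M> cM by blast
  qed
  note packing = this
  from packing[of True] obtain \<M> where \<M>: "\<M> \<subseteq> threats (Suc l) l \<E> x c True" "finite \<M>"
    "disjoint_family_on (star x l) \<M>" "card \<M> = l" "(\<Union>M\<in>\<M>. star x l M) = L" by blast
  from packing[of False] obtain \<N> where \<N>: "\<N> \<subseteq> threats (Suc l) l \<E> x c False" "finite \<N>"
    "disjoint_family_on (star x l) \<N>" "card \<N> = l" "(\<Union>M\<in>\<N>. star x l M) = L" by blast
  have \<M>f: "finite M" "card M = Suc l" "x \<in> M" if "M \<in> \<M>" for M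
    using that \<M>(1) by (auto simp: threats_def cliques_def)
  have \<N>f: "finite M" "card M = Suc l" "x \<in> M" if "M \<in> \<N>" for M
    using that \<N>(1) by (auto simp: threats_def cliques_def)
  have meet: "star x l A \<inter> star x l B \<noteq> {}" if A: "A \<in> \<M>" and B: "B \<in> \<N>" for A B
  proof
    assume e: "star x l A \<inter> star x l B = {}"
    have "card (star x l B) \<le> card (star x l ` (\<M> - {A}))"
    proof (rule sum_small_inter_le)
      show "star x l B \<subseteq> \<Union>(star x l ` (\<M> - {A}))"
      proof
        fix g assume g: "g \<in> star x l B"
        then have "g \<in> L" using \<N>(5) B by blast
        then obtain M where "M \<in> \<M>" "g \<in> star x l M" using \<M>(5) by blast
        moreover have "M \<noteq> A" using g e \<open>g \<in> star x l M\<close> by blast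
        ultimately show "g \<in> \<Union>(star x l ` (\<M> - {A}))" by blast
      qed
      fix S assume "S \<in> star x l ` (\<M> - {A})"
      then obtain M where "M \<in> \<M>" "S = star x l M" by blast
      then show "card (star x l B \<inter> S) \<le> 1"
        using opposite_threats_inter[of M "Suc l" l \<E> x c True B] \<M>(1) \<N>(1) B l
        by (auto simp: Int_commute)
    qed (use \<M> in auto)
    also have "\<dots> \<le> card (\<M> - {A})" using \<M>(2) by (intro card_image_le) auto
    also have "\<dots> < l" using \<M>(2,4) A l by simp
    finally have "card (star x l B) < l" .
    moreover have "card (star x l B) = l" using card_star[of B x l] \<N>f[OF B] l a by simp
    ultimately show False by simp
  qed
  have "\<exists>A1 A2. A1 \<in> \<M> \<and> A2 \<in> \<M> \<and> A1 \<noteq> A2"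
  proof (rule ccontr)
    assume "\<not> ?thesis"
    then have "card \<M> \<le> 1" using card_le_Suc0_iff_eq[OF \<M>(2)] by auto
    then show False using \<M>(4) l by simp
  qed
  then obtain A1 A2 where A: "A1 \<in> \<M>" "A2 \<in> \<M>" "A1 \<noteq> A2" by blast
  have fA: "finite A1" "finite A2" using A \<M>f by auto
  have xA: "x \<in> A1 \<inter> A2" using A \<M>f by auto
  have small: "card (A1 \<inter> A2) < l"
  proof (rule ccontr)
    assume "\<not> ?thesis"
    then have "l - 1 \<le> card (A1 \<inter> A2 - {x})" using xA fA by (simp add: card_Diff_singleton)
    then obtain e where e: "e \<subseteq> A1 \<inter> A2 - {x}" "card e = l - 1" "finite e"
      using obtain_subset_with_card_n by metis
    then have "insert x e \<in> star x l A1 \<inter> star x l A2"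
      using xA l by (auto simp: star_def nsets_def card_insert_if)
    then show False using \<M>(3) A by (auto simp: disjoint_family_on_def)
  qed
  \<comment> \<open>The edge \<open>A1 - {y}\<close> lies in the star of some \<open>B\<close> of
    the other packing, whose star meets that of \<open>A2\<close> in an edge \<open>g\<close>. Two
    l-subsets of the (l + 1)-set \<open>B\<close> share at least l - 1 elements, and
    \<open>g\<close> is contained in \<open>A2\<close>.\<close>
  have large: "l - 1 \<le> card (A1 \<inter> A2 - {y})" if y: "y \<in> A1" "y \<noteq> x" for y
  proof -
    have "A1 - {y} \<in> star x l A1"
      using y \<M>f[OF A(1)] by (auto simp: star_def nsets_def)
    then have "A1 - {y} \<in> L" using \<M>(5) A(1) by blast
    then obtain B where B: "B \<in> \<N>" "A1 - {y} \<in> star x l B" using \<N>(5) by blast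
    from meet[OF A(2) B(1)] obtain g where g: "g \<in> star x l A2" "g \<in> star x l B" by blast
    have g': "g \<subseteq> A2" "g \<subseteq> B" "card g = l" "finite g" using g by (auto simp: star_def nsets_def)
    have "A1 - {y} \<subseteq> B" using B(2) by (auto simp: star_def nsets_def)
    then have "card ((A1 - {y}) \<union> g) \<le> Suc l"
      using g' \<N>f[OF B(1)] card_mono[of B "(A1 - {y}) \<union> g"] by auto
    moreover have "card (A1 - {y}) = l" using y \<M>f[OF A(1)] by simp
    moreover have "card (A1 - {y}) + card g = card ((A1 - {y}) \<union> g) + card ((A1 - {y}) \<inter> g)"
      using fA g' by (intro card_Un_Int) auto
    ultimately have "l - 1 \<le> card ((A1 - {y}) \<inter> g)" using g'(3) by linarith
    also have "\<dots> \<le> card (A1 \<inter> A2 - {y})" using g' fA by (intro card_mono) auto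
    finally show ?thesis .
  qed
  have "A1 \<inter> A2 \<subseteq> {x}"
  proof
    fix y assume y: "y \<in> A1 \<inter> A2"
    show "y \<in> {x}"
    proof (rule ccontr)
      assume "y \<notin> {x}"
      then have "l - 1 \<le> card (A1 \<inter> A2) - 1" using large[of y] y fA by (simp add: card_Diff_singleton)
      moreover have "card (A1 \<inter> A2) > 0" using y fA by (auto simp: card_gt_0_iff)
      ultimately show False using small l by linarith
    qed
  qed
  then have AA: "A1 \<inter> A2 = {x}" using xA by blast
  have "card (A1 - {x}) = l" using \<M>f[OF A(1)] by simp
  then obtain y where "y \<in> A1 - {x}" using l by (metis card.empty ex_in_conv not_numeral_le_zero)
  then have "l - 1 \<le> card ({x} - {y})" using large[of y] AA by simp
  also have "\<dots> \<le> 1" using card_mono[of "{x}" "{x} - {y}"] by simp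
  finally show False using l by simp
qed

section \<open>Edge density of critical hypergraphs\<close>

lemma sum_degrees:
  assumes "finite \<E>" "\<And>e. e \<in> \<E> \<Longrightarrow> finite e \<and> card e = l"
  shows "(\<Sum>x\<in>\<Union>\<E>. card {e \<in> \<E>. x \<in> e}) = l * card \<E>"
proof -
  have fin: "finite (\<Union>\<E>)" using assms by auto
  have "(\<Sum>x\<in>\<Union>\<E>. card {e \<in> \<E>. x \<in> e}) = (\<Sum>x\<in>\<Union>\<E>. \<Sum>e\<in>\<E>. if x \<in> e then 1 else 0)"
    using assms(1) by (simp add: sum.If_cases Int_def)
  also have "\<dots> = (\<Sum>e\<in>\<E>. \<Sum>x\<in>\<Union>\<E>. if x \<in> e then 1 else 0)" by (rule sum.swap)
  also have "\<dots> = (\<Sum>e\<in>\<E>. l)"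
  proof (rule sum.cong)
    fix e assume e: "e \<in> \<E>"
    then have "\<Union>\<E> \<inter> {x. x \<in> e} = e" by blast
    then show "(\<Sum>x\<in>\<Union>\<E>. if x \<in> e then 1 else 0) = l" using fin assms(2)[OF e] by (simp add: sum.If_cases)
  qed simp
  finally show ?thesis by simp
qed

text \<open>Greedy colouring: \<open>W\<close> grows by single vertices while \<E> stays fixed, and
  the at most four neighbours of a new vertex leave one of the five colours free.\<close>

lemma five_colouring:
  assumes "finite W" "finite \<E>" "\<And>x. x \<in> W \<Longrightarrow> card {e \<in> \<E>. x \<in> e} \<le> 4"
  shows "\<exists>f :: 'a \<Rightarrow> nat. (\<forall>u. f u < 5) \<and> (\<forall>u\<in>W. \<forall>v\<in>W. u \<noteq> v \<longrightarrow> {u, v} \<in> \<E> \<longrightarrow> f u \<noteq> f v)"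
  using assms(1,3)
proof (induction W rule: finite_induct)
  case empty
  then show ?case by (intro exI[of _ "\<lambda>_. 0"]) auto
next
  case (insert x W)
  have "\<exists>f :: 'a \<Rightarrow> nat. (\<forall>u. f u < 5) \<and> (\<forall>u\<in>W. \<forall>v\<in>W. u \<noteq> v \<longrightarrow> {u, v} \<in> \<E> \<longrightarrow> f u \<noteq> f v)"
    by (rule insert.IH) (use insert.prems in auto)
  then obtain f :: "'a \<Rightarrow> nat"
    where f0: "(\<forall>u. f u < 5) \<and> (\<forall>u\<in>W. \<forall>v\<in>W. u \<noteq> v \<longrightarrow> {u, v} \<in> \<E> \<longrightarrow> f u \<noteq> f v)" ..
  have f: "\<And>u. f u < 5" "\<And>u v. u \<in> W \<Longrightarrow> v \<in> W \<Longrightarrow> u \<noteq> v \<Longrightarrow> {u, v} \<in> \<E> \<Longrightarrow> f u \<noteq> f v"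
    using f0 by simp_all
  define N where "N = {u \<in> W. {u, x} \<in> \<E>}"
  have "card N \<le> card {e \<in> \<E>. x \<in> e}"
  proof (rule card_inj_on_le[where f = "\<lambda>u. {u, x}"])
    show "inj_on (\<lambda>u. {u, x}) N" by (auto simp: inj_on_def doubleton_eq_iff)
  qed (use assms(2) in \<open>auto simp: N_def\<close>)
  then have "card N \<le> 4" using insert.prems[of x] by simp
  then have "card (f ` N) \<le> 4" using card_image_le[of N f] insert.hyps by (simp add: N_def)
  then have "\<not> {..<5} \<subseteq> f ` N"
    using card_mono[of "f ` N" "{..<5::nat}"] insert.hyps by (auto simp: N_def)
  then obtain i where i: "i < 5" "i \<notin> f ` N" by blast
  show ?case
  proof (intro exI[of _ "f(x := i)"] conjI allI ballI impI)
    fix u show "(f(x := i)) u < 5" using f(1) i(1) by simp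
  next
    fix u v assume uv: "u \<in> insert x W" "v \<in> insert x W" "u \<noteq> v" "{u, v} \<in> \<E>"
    show "(f(x := i)) u \<noteq> (f(x := i)) v"
    proof (cases "u = x \<or> v = x")
      case True
      then obtain w where w: "w \<in> N" "{u, v} = {w, x}" "w \<noteq> x"
      proof (elim disjE)
        assume "u = x" then show ?thesis using uv that[of v] by (auto simp: N_def insert_commute)
      next
        assume "v = x" then show ?thesis using uv that[of u] by (auto simp: N_def)
      qed
      then show ?thesis using i(2) by (auto simp: doubleton_eq_iff)
    next
      case False
      then show ?thesis using uv f(2) by auto
    qed
  qed
qed

text \<open>The colouring of \<open>K\<^sub>5\<close> by a pentagon and its complement is pulled back along a proper
  vertex colouring with five colours.\<close>

lemma pentagon_colouring:
  "\<forall>i\<in>set [0..<5]. \<forall>j\<in>set [0..<5]. \<forall>h\<in>set [0..<5]. i \<noteq> j \<longrightarrow> j \<noteq> h \<longrightarrow> i \<noteq> h \<longrightarrow>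
    (\<forall>b. \<not> ((j = Suc i mod 5 \<or> i = Suc j mod 5) = b \<and> (h = Suc j mod 5 \<or> j = Suc h mod 5) = b \<and>
      (h = Suc i mod 5 \<or> i = Suc h mod 5) = b))"
  by code_simp

text \<open>Four is the general degree bound for k = 3 and l = 2. The vertex colouring is proper, so
  a triangle goes to a triangle of K_5, and none of those is monochromatic.\<close>

lemma two_colourable_of_degree_le_4:
  assumes "finite \<E>" "\<And>e. e \<in> \<E> \<Longrightarrow> finite e" "\<And>x. x \<in> \<Union>\<E> \<Longrightarrow> card {e \<in> \<E>. x \<in> e} \<le> 4"
  shows "two_colourable 3 2 \<E>"
proof -
  have "finite (\<Union>\<E>)" using assms by auto
  from five_colouring[OF this assms(1,3)] obtain f :: "'a \<Rightarrow> nat"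
    where f0: "(\<forall>u. f u < 5) \<and> (\<forall>u\<in>\<Union>\<E>. \<forall>v\<in>\<Union>\<E>. u \<noteq> v \<longrightarrow> {u, v} \<in> \<E> \<longrightarrow> f u \<noteq> f v)" ..
  have f: "f u < 5" "u \<noteq> v \<Longrightarrow> {u, v} \<in> \<E> \<Longrightarrow> f u \<noteq> f v" for u v
    using f0 by (simp, blast)
  define c where "c = (\<lambda>e. \<exists>u v. e = {u, v} \<and> f v = Suc (f u) mod 5)"
  have c: "c {u, v} \<longleftrightarrow> f v = Suc (f u) mod 5 \<or> f u = Suc (f v) mod 5" for u v
    unfolding c_def by (metis doubleton_eq_iff)
  show ?thesis
  proof (rule two_colourableI[where c = c])
    fix K :: "'a set" and b assume "K \<in> cliques 3 2 \<E>"
    then have K: "card K = 3" "nsets K 2 \<subseteq> \<E>" by (auto simp: cliques_def)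
    from K(1) obtain u v w where uvw: "K = {u, v, w}" "u \<noteq> v" "v \<noteq> w" "u \<noteq> w"
      by (metis card_3_iff)
    then have e: "{u, v} \<in> nsets K 2" "{v, w} \<in> nsets K 2" "{u, w} \<in> nsets K 2"
      by (auto simp: nsets_def)
    then have "f u \<noteq> f v" "f v \<noteq> f w" "f u \<noteq> f w" using K(2) uvw f(2) by blast+
    then have "\<not> (c {u, v} = b \<and> c {v, w} = b \<and> c {u, w} = b)"
      using pentagon_colouring[rule_format, of "f u" "f v" "f w" b] f(1) unfolding c by simp
    then show "\<exists>e\<in>nsets K 2. c e \<noteq> b" using e by blast
  qed
qed

text \<open>By the handshake identity it is enough that l (s - 1) < (k - l) deg x, where s = k
  choose l. With a = (k - 1) choose (l - 1) the left side is k a - l, and deg x \<ge> a^2. For k - l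
  \<ge> 2 this suffices, since (k - l) a \<ge> 2 (k - 1) \<ge> k. For k = l + 1 both sides would be
  l^2, so \<open>critical_degree_gt\<close> is needed. For triangles strictness is available at one
  vertex only, which is enough in the sum.\<close>

lemma critical_dense:
  assumes crit: "critical k l \<E>" and l: "2 \<le> l" and k: "l < k"
  shows "((k choose l) - 1) * card (\<Union>\<E>) < (k - l) * card \<E>"
proof -
  let ?a = "(k - 1) choose (l - 1)"
  let ?d = "\<lambda>x. card {e \<in> \<E>. x \<in> e}"
  have fin: "finite \<E>" "\<And>e. e \<in> \<E> \<Longrightarrow> finite e \<and> card e = l" and nc: "\<not> two_colourable k l \<E>"
    using crit by (auto simp: critical_def)
  have finV: "finite (\<Union>\<E>)" using fin by auto
  obtain e where e: "e \<in> \<E>" using critical_nonempty[OF crit less_imp_le[OF k]] by blast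
  then have "e \<noteq> {}" using fin(2)[of e] l by auto
  then have ne: "\<Union>\<E> \<noteq> {}" using e by blast
  have ka: "l * ((k choose l) - 1) = k * ?a - l"
  proof -
    obtain l' k' where "l = Suc l'" "k = Suc k'" using l k by (cases l; cases k) auto
    then show ?thesis using Suc_times_binomial[of l' k'] by (simp add: diff_mult_distrib2)
  qed
  show ?thesis
  proof (cases "k = 3 \<and> l = 2")
    case True
    have d4: "4 \<le> ?d x" if "x \<in> \<Union>\<E>" for x
      using critical_degree_ge[OF crit l k that] True by simp
    have "\<exists>x\<in>\<Union>\<E>. ?d x > 4"
    proof (rule ccontr)
      assume "\<not> ?thesis"
      then have "two_colourable 3 2 \<E>"
        using fin by (intro two_colourable_of_degree_le_4) (auto simp: not_less)
      then show False using nc True by simp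
    qed
    then have "(\<Sum>x\<in>\<Union>\<E>. 4) < (\<Sum>x\<in>\<Union>\<E>. ?d x)"
      using finV d4 by (intro sum_strict_mono_ex1) auto
    then have "4 * card (\<Union>\<E>) < 2 * card \<E>" using sum_degrees[OF fin] True by simp
    then show ?thesis using True by (simp add: eval_nat_numeral)
  next
    case False
    have deg: "l * ((k choose l) - 1) < (k - l) * ?d x" if x: "x \<in> \<Union>\<E>" for x
    proof (cases "k = Suc l")
      case True
      then have l3: "3 \<le> l" using False l by linarith
      have "l\<^sup>2 < ?d x" using critical_degree_gt[OF _ l3 x] crit True by simp
      moreover have "?a = l" using True l binomial_symmetric[of "l - 1" l] by simp
      ultimately show ?thesis using ka True by (simp add: power2_eq_square)
    next
      case F: False
      then have "2 \<le> k - l" using k by simp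
      have ak: "k - 1 \<le> ?a" using choose_ge_self[of "l - 1" "k - 1"] l k by simp
      have "k \<le> (k - l) * ?a"
      proof -
        have "k \<le> 2 * (k - 1)" using k l by simp
        also have "\<dots> \<le> (k - l) * ?a" using ak \<open>2 \<le> k - l\<close> by (intro mult_mono) auto
        finally show ?thesis .
      qed
      then have "k * ?a \<le> (k - l) * ?a * ?a" by (rule mult_right_mono) simp
      also have "\<dots> \<le> (k - l) * ?d x"
        using critical_degree_ge[OF crit l k x] by (simp add: power2_eq_square mult.assoc)
      finally have "k * ?a \<le> (k - l) * ?d x" .
      moreover have "k * ?a > 0" using k l by simp
      ultimately show ?thesis using ka l by linarith
    qed
    have "(\<Sum>x\<in>\<Union>\<E>. l * ((k choose l) - 1)) < (\<Sum>x\<in>\<Union>\<E>. (k - l) * ?d x)"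
      using finV ne deg by (intro sum_strict_mono) auto
    then have "l * (((k choose l) - 1) * card (\<Union>\<E>)) < l * ((k - l) * card \<E>)"
      using sum_degrees[OF fin] by (simp add: sum_distrib_left[symmetric] mult_ac)
    then show ?thesis by simp
  qed
qed

section \<open>The 0-statement\<close>

definition seq_edges :: "nat \<Rightarrow> 'a set list \<Rightarrow> 'a set set" where
  "seq_edges l Ks = (\<Union>K\<in>set Ks. nsets K l)"

definition seq_verts :: "'a set list \<Rightarrow> 'a set" where
  "seq_verts Ks = \<Union>(set Ks)"

lemma seq_edges_Cons: "seq_edges l (K # Ks) = nsets K l \<union> seq_edges l Ks"
  by (simp add: seq_edges_def)

lemma seq_verts_Cons: "seq_verts (K # Ks) = K \<union> seq_verts Ks"
  by (simp add: seq_verts_def)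

text \<open>A regular step that follows a regular step (or the initial clique) has to be attached at this
  edge, which is new in the latest clique. As there is no choice of the edge, such a step costs only
  a constant factor in the union bound. If there is no new edge, the value is arbitrary.\<close>

definition handle :: "nat \<Rightarrow> 'a set list \<Rightarrow> 'a set" where
  "handle l Ks = (SOME f. f \<in> nsets (hd Ks) l \<and> f \<notin> seq_edges l (tl Ks))"

text \<open>The lists of Booleans record, latest step first, which steps are degenerate.\<close>

definition explore_step :: "nat \<Rightarrow> nat \<Rightarrow> bool \<Rightarrow> bool list \<Rightarrow> 'a set \<Rightarrow> 'a set list \<Rightarrow> bool" where
  "explore_step k l b bs K Ks \<longleftrightarrow>
    (if b then l < card (K \<inter> seq_verts Ks) \<and> \<not> nsets K l \<subseteq> seq_edges l Ks
     else K \<inter> seq_verts Ks \<in> (if bs \<noteq> [] \<and> hd bs then seq_edges l Ks else {handle l Ks} \<inter> seq_edges l Ks))"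

text \<open>The latest clique comes first. Explorations are classified by the pattern of their
  steps: the total weight of a class can be estimated by recursion on the pattern, and there are
  only 2^t patterns of length t.\<close>

fun explorations :: "nat \<Rightarrow> nat \<Rightarrow> 'a set \<Rightarrow> bool list \<Rightarrow> 'a set list set" where
  "explorations k l V [] = (\<lambda>K. [K]) ` nsets V k"
| "explorations k l V (b # bs) =
    (\<Union>Ks\<in>explorations k l V bs. (\<lambda>K. K # Ks) ` {K \<in> nsets V k. explore_step k l b bs K Ks})"

lemma explorations_Cons_iff:
  "K # Ks \<in> explorations k l V (b # bs) \<longleftrightarrow>
    Ks \<in> explorations k l V bs \<and> K \<in> nsets V k \<and> explore_step k l b bs K Ks"
  by auto

lemma explorations_length: "Ks \<in> explorations k l V bs \<Longrightarrow> length Ks = Suc (length bs)"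
  by (induction bs arbitrary: Ks) auto

lemma explorations_subset: "Ks \<in> explorations k l V bs \<Longrightarrow> set Ks \<subseteq> nsets V k"
proof (induction bs arbitrary: Ks)
  case (Cons b bs)
  then obtain K Ks' where "Ks = K # Ks'" "K \<in> nsets V k" "Ks' \<in> explorations k l V bs" by auto
  with Cons.IH[of Ks'] show ?case by simp
qed auto

lemma clique_in_nsets:
  assumes "K \<in> cliques k l \<E>" "\<E> \<subseteq> nsets V l" "1 \<le> l" "l \<le> k"
  shows "K \<in> nsets V k"
proof -
  have K: "finite K" "card K = k" "nsets K l \<subseteq> nsets V l" using assms by (auto simp: cliques_def)
  have "K = \<Union>(nsets K l)" using Union_nsets[of K l] K assms by simp
  also have "\<dots> \<subseteq> \<Union>(nsets V l)" using K(3) by (rule Union_mono)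
  also have "\<dots> \<subseteq> V" by (auto simp: nsets_def)
  finally show ?thesis using K by (simp add: nsets_def)
qed

lemma finite_explorations: "finite V \<Longrightarrow> finite (explorations k l V bs)"
proof (induction bs)
  case (Cons b bs)
  have "finite {K \<in> nsets V k. explore_step k l b bs K Ks}" for Ks
    by (rule finite_subset[OF _ finite_imp_finite_nsets[OF Cons.prems, of k]]) auto
  then show ?case using Cons by auto
qed (simp add: finite_imp_finite_nsets)

lemma seq_size:
  assumes "set Ks \<subseteq> nsets V k"
  shows "finite (seq_verts Ks)" "finite (seq_edges l Ks)"
    "card (seq_verts Ks) \<le> k * length Ks" "card (seq_edges l Ks) \<le> (k choose l) * length Ks"
proof -
  have K: "finite K" "card K = k" if "K \<in> set Ks" for K using that assms by (auto simp: nsets_def)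
  show "finite (seq_verts Ks)" "finite (seq_edges l Ks)"
    using K by (auto simp: seq_verts_def seq_edges_def finite_imp_finite_nsets)
  have "card (seq_verts Ks) \<le> (\<Sum>K\<in>set Ks. card K)"
    unfolding seq_verts_def using card_UN_le[of "set Ks" "\<lambda>K. K"] by simp
  also have "\<dots> = k * card (set Ks)" using K by simp
  also have "\<dots> \<le> k * length Ks" by (intro mult_left_mono card_length) simp
  finally show "card (seq_verts Ks) \<le> k * length Ks" .
  have "card (seq_edges l Ks) \<le> (\<Sum>K\<in>set Ks. card (nsets K l))"
    unfolding seq_edges_def by (rule card_UN_le) simp
  also have "\<dots> = (k choose l) * card (set Ks)" using K by (simp add: card_nsets)
  also have "\<dots> \<le> (k choose l) * length Ks" by (intro mult_left_mono card_length) simp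
  finally show "card (seq_edges l Ks) \<le> (k choose l) * length Ks" .
qed

lemma seq_edgesD:
  assumes "set Ks \<subseteq> nsets V k" "e \<in> seq_edges l Ks"
  shows "e \<subseteq> seq_verts Ks" "finite e" "card e = l"
  using assms by (auto simp: seq_edges_def seq_verts_def nsets_def)

lemma card_seq_Cons:
  assumes "set Ks \<subseteq> nsets V k" "finite K"
  shows "card (seq_edges l (K # Ks)) = card (seq_edges l Ks) + card (nsets K l - seq_edges l Ks)"
    "card (seq_verts (K # Ks)) = card (seq_verts Ks) + card (K - seq_verts Ks)"
proof -
  note fin = seq_size(1)[OF assms(1)] seq_size(2)[OF assms(1), of l]
  have "seq_edges l (K # Ks) = seq_edges l Ks \<union> (nsets K l - seq_edges l Ks)"
    by (auto simp: seq_edges_Cons)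
  moreover have "card (seq_edges l Ks \<union> (nsets K l - seq_edges l Ks))
      = card (seq_edges l Ks) + card (nsets K l - seq_edges l Ks)"
    using fin finite_imp_finite_nsets[OF assms(2), of l] by (intro card_Un_disjoint) auto
  ultimately show "card (seq_edges l (K # Ks)) = card (seq_edges l Ks) + card (nsets K l - seq_edges l Ks)"
    by (simp only:)
  have "seq_verts (K # Ks) = seq_verts Ks \<union> (K - seq_verts Ks)"
    by (auto simp: seq_verts_Cons)
  moreover have "card (seq_verts Ks \<union> (K - seq_verts Ks)) = card (seq_verts Ks) + card (K - seq_verts Ks)"
    using fin assms(2) by (intro card_Un_disjoint) auto
  ultimately show "card (seq_verts (K # Ks)) = card (seq_verts Ks) + card (K - seq_verts Ks)"
    by (simp only:)
qed

text \<open>An old edge inside \<open>K\<close> has only old vertices, so it is contained in the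
  l-set \<open>K \<inter> seq_verts Ks\<close> and equal to it: nothing but the edge of attachment
  is shared.\<close>

lemma new_edges_regular:
  assumes Ks: "set Ks \<subseteq> nsets V k" and K: "K \<in> nsets V k" and reg: "K \<inter> seq_verts Ks \<in> seq_edges l Ks"
  shows "card (nsets K l - seq_edges l Ks) = (k choose l) - 1" "card (K - seq_verts Ks) = k - l"
proof -
  let ?h = "K \<inter> seq_verts Ks"
  have Kf: "finite K" "card K = k" using K by (auto simp: nsets_def)
  have h: "finite ?h" "card ?h = l" using seq_edgesD[OF Ks reg] by auto
  have "nsets K l \<inter> seq_edges l Ks = {?h}"
  proof
    show "{?h} \<subseteq> nsets K l \<inter> seq_edges l Ks" using reg h by (auto simp: nsets_def)
    show "nsets K l \<inter> seq_edges l Ks \<subseteq> {?h}"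
    proof
      fix e assume e: "e \<in> nsets K l \<inter> seq_edges l Ks"
      then have "e \<subseteq> ?h" "card e = l" using seq_edgesD[OF Ks, of e l] by (auto simp: nsets_def)
      then show "e \<in> {?h}" using h card_subset_eq[of ?h e] by simp
    qed
  qed
  then show "card (nsets K l - seq_edges l Ks) = (k choose l) - 1"
    using card_Diff_subset_Int[of "nsets K l" "seq_edges l Ks"] Kf by (simp add: card_nsets)
  show "card (K - seq_verts Ks) = k - l"
    using card_Diff_subset_Int[of K "seq_verts Ks"] h Kf by simp
qed

lemma regular_stepD:
  "explore_step k l False bs K Ks \<Longrightarrow> K \<inter> seq_verts Ks \<in> seq_edges l Ks"
  by (auto simp: explore_step_def split: if_splits)

text \<open>The quantity \<open>(k - l) e - (s - 1) v\<close>, where \<open>s = k choose l\<close>, is unchanged by a regular step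
  and grows by at least one in a degenerate step, because the cliques are strictly balanced.\<close>

lemma exploration_excess:
  assumes l: "2 \<le> l" and k: "l < k" and Ks: "Ks \<in> explorations k l V bs"
  shows "((k choose l) - 1) * card (seq_verts Ks) + k + count_list bs True
    \<le> (k - l) * card (seq_edges l Ks) + l * (k choose l)"
  using Ks
proof (induction bs arbitrary: Ks)
  case Nil
  then obtain K where K: "Ks = [K]" "finite K" "card K = k" by (auto simp: nsets_def)
  define s where "s = k choose l"
  have s: "s \<ge> 1" using k by (simp add: s_def Suc_le_eq)
  \<comment> \<open>The constants k and l s of the claim are those for which a single clique gives
    equality.\<close>
  have "(s - 1) * k + k = s * k" using s by (cases s) auto
  also have "\<dots> = (k - l) * s + l * s" using k by (simp add: add_mult_distrib[symmetric])
  finally show ?case using K by (simp add: seq_verts_def seq_edges_def card_nsets s_def)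
next
  case (Cons b bs)
  from Cons.prems obtain K Ks' where Ks: "Ks = K # Ks'" and Ks': "Ks' \<in> explorations k l V bs"
    and K: "K \<in> nsets V k" and step: "explore_step k l b bs K Ks'" by auto
  define s where "s = k choose l"
  define new where "new = card (nsets K l - seq_edges l Ks')"
  define u where "u = card (K \<inter> seq_verts Ks')"
  have s: "s \<ge> 1" using k by (simp add: s_def Suc_le_eq)
  have sub: "set Ks' \<subseteq> nsets V k" by (rule explorations_subset[OF Ks'])
  have Kf: "finite K" "card K = k" using K by (auto simp: nsets_def)
  have uk: "u \<le> k" using card_mono[of K "K \<inter> seq_verts Ks'"] Kf by (simp add: u_def)
  have nv: "card (K - seq_verts Ks') = k - u"
    using card_Diff_subset_Int[of K "seq_verts Ks'"] Kf by (simp add: u_def)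
  have gain: "(s - 1) * (k - u) + (if b then 1 else 0) \<le> (k - l) * new"
  proof (cases b)
    case False
    with step have "explore_step k l False bs K Ks'" by simp
    then have "K \<inter> seq_verts Ks' \<in> seq_edges l Ks'" by (rule regular_stepD)
    from new_edges_regular[OF sub K this] show ?thesis using False nv by (simp add: s_def new_def mult.commute)
  next
    case True
    then have u: "l < u" and notsub: "\<not> nsets K l \<subseteq> seq_edges l Ks'"
      using step by (simp_all add: explore_step_def u_def)
    have fin: "finite (nsets K l)" using Kf by (simp add: finite_imp_finite_nsets)
    have "nsets K l - seq_edges l Ks' \<noteq> {}" using notsub by blast
    then have new1: "1 \<le> new" using fin by (simp add: new_def Suc_le_eq card_gt_0_iff)
    show ?thesis
    \<comment> \<open>For u = k no vertex is new, but some edge is. For u < k the old edges in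
      \<open>K\<close> live on u vertices, and strict balancedness leaves a surplus.\<close>
    proof (cases "u = k")
      case True
      have "1 * 1 \<le> (k - l) * new" using new1 k by (intro mult_mono) auto
      then show ?thesis using True \<open>b\<close> by simp
    next
      case False
      then have uk': "u < k" using uk by simp
      have "nsets K l \<inter> seq_edges l Ks' \<subseteq> nsets (K \<inter> seq_verts Ks') l"
        using seq_edgesD[OF sub] by (auto simp: nsets_def)
      then have "card (nsets K l \<inter> seq_edges l Ks') \<le> u choose l"
        using card_mono[OF finite_imp_finite_nsets] Kf by (metis card_nsets finite_Int u_def)
      moreover have "card (nsets K l) = card (nsets K l \<inter> seq_edges l Ks') + new"
        using card_Int_Diff[OF fin, of "seq_edges l Ks'"] by (simp add: new_def)
      ultimately have "s \<le> (u choose l) + new" using Kf by (simp add: card_nsets s_def)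
      then have "(s - 1) * (k - l) \<le> (((u choose l) - 1) + new) * (k - l)"
        by (intro mult_right_mono) auto
      also have "\<dots> < (s - 1) * (u - l) + new * (k - l)"
        using clique_edges_less[OF l u uk'] by (simp add: s_def add_mult_distrib)
      finally have "(s - 1) * (k - l) < (s - 1) * (u - l) + new * (k - l)" .
      moreover have "(s - 1) * (k - l) = (s - 1) * (u - l) + (s - 1) * (k - u)"
        using u uk by (simp add: add_mult_distrib2[symmetric])
      ultimately show ?thesis using \<open>b\<close> by (simp add: mult.commute)
    qed
  qed
  have IH: "(s - 1) * card (seq_verts Ks') + k + count_list bs True \<le> (k - l) * card (seq_edges l Ks') + l * s"
    using Cons.IH[OF Ks'] by (simp add: s_def)
  have "(s - 1) * card (seq_verts Ks) = (s - 1) * card (seq_verts Ks') + (s - 1) * (k - u)"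
    using card_seq_Cons(2)[OF sub Kf(1)] nv by (simp add: Ks add_mult_distrib2)
  moreover have "(k - l) * card (seq_edges l Ks) = (k - l) * card (seq_edges l Ks') + (k - l) * new"
    using card_seq_Cons(1)[OF sub Kf(1), of l] by (simp add: Ks new_def add_mult_distrib2)
  moreover have "count_list (b # bs) True = count_list bs True + (if b then 1 else 0)" by simp
  ultimately show ?case using IH gain by (simp add: s_def)
qed

text \<open>After a degenerate step, connectivity provides a clique that meets the explored edges
  without being exhausted by them. Otherwise the latest clique was attached along a single edge or
  is the initial one, so the handle has a vertex not seen before; a second clique through the handle
  then has an unexplored edge. In both cases the new clique is regular if it meets the old vertices
  in exactly l of them, and degenerate otherwise.\<close>

lemma exploration_extend:
  assumes crit: "critical k l \<E>" and l: "2 \<le> l" and k: "l < k" and V: "\<E> \<subseteq> nsets V l"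
    and Ks: "Ks \<in> explorations k l V bs" and cl: "set Ks \<subseteq> cliques k l \<E>" and ne: "seq_edges l Ks \<noteq> \<E>"
  shows "\<exists>b K. K \<in> cliques k l \<E> \<and> K # Ks \<in> explorations k l V (b # bs)"
proof -
  have sub: "set Ks \<subseteq> nsets V k" by (rule explorations_subset[OF Ks])
  have clV: "K \<in> nsets V k" if "K \<in> cliques k l \<E>" for K
    by (rule clique_in_nsets[OF that V]) (use l k in auto)
  have fin: "finite (K \<inter> seq_verts Ks)" for K using seq_size(1)[OF sub] by simp
  have goal: ?thesis if K: "K \<in> cliques k l \<E>" and f: "f \<in> nsets K l" "f \<in> seq_edges l Ks"
    and new: "\<not> nsets K l \<subseteq> seq_edges l Ks" and hd: "\<not> (bs \<noteq> [] \<and> hd bs) \<Longrightarrow> f = handle l Ks" for K f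
  proof -
    have fK: "f \<subseteq> K \<inter> seq_verts Ks" "card f = l"
      using f seq_edgesD[OF sub f(2)] by (auto simp: nsets_def)
    show ?thesis
    proof (cases "card (K \<inter> seq_verts Ks) = l")
      case True
      then have "f = K \<inter> seq_verts Ks" using fK fin card_subset_eq by metis
      then have "explore_step k l False bs K Ks" using f hd by (auto simp: explore_step_def)
      then show ?thesis using K Ks clV unfolding explorations_Cons_iff by blast
    next
      case False
      then have "l < card (K \<inter> seq_verts Ks)" using card_mono[OF fin fK(1)] fK(2) by simp
      then have "explore_step k l True bs K Ks" using new by (simp add: explore_step_def)
      then show ?thesis using K Ks clV unfolding explorations_Cons_iff by blast
    qed
  qed
  show ?thesis
  proof (cases "bs \<noteq> [] \<and> hd bs")
    case True
    have "Ks \<noteq> []" using explorations_length[OF Ks] by auto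
    then have "seq_edges l Ks \<noteq> {}"
    proof -
      obtain K where "K \<in> set Ks" using hd_in_set[OF \<open>Ks \<noteq> []\<close>] by blast
      moreover from this have "finite K" "card K = k" using sub by (auto simp: nsets_def)
      ultimately have "K \<in> set Ks" "nsets K l \<noteq> {}" using k by (simp_all add: nsets_eq_empty_iff)
      then show ?thesis using \<open>K \<in> set Ks\<close> by (auto simp: seq_edges_def)
    qed
    moreover have "seq_edges l Ks \<subset> \<E>" using cl ne by (auto simp: seq_edges_def cliques_def)
    ultimately obtain K where K: "K \<in> cliques k l \<E>" "nsets K l \<inter> seq_edges l Ks \<noteq> {}" "\<not> nsets K l \<subseteq> seq_edges l Ks"
      using critical_connected[OF crit] by blast
    then obtain f where "f \<in> nsets K l" "f \<in> seq_edges l Ks" by blast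
    then show ?thesis using goal[OF K(1) _ _ K(3)] True by blast
  next
    case False
    obtain K0 rest where K0: "Ks = K0 # rest" using explorations_length[OF Ks] by (cases Ks) auto
    have K0f: "finite K0" "card K0 = k" "K0 \<in> cliques k l \<E>" "K0 \<in> nsets V k"
      using sub cl K0 by (auto simp: nsets_def)
    have restV: "set rest \<subseteq> nsets V k" using sub K0 by simp
    have s2: "2 \<le> k choose l" using choose_ge_self[of l k] l k by simp
    have small: "nsets K0 l - seq_edges l rest \<noteq> {} \<and> (\<forall>f\<in>nsets K0 l - seq_edges l rest. \<not> f \<subseteq> seq_verts rest)"
    proof (cases bs)
      case Nil
      then have "rest = []" using Ks K0 by auto
      moreover have "nsets K0 l \<noteq> {}" using K0f k by (auto simp: nsets_eq_empty_iff)
      moreover have "{} \<notin> nsets K0 l" using l by (auto simp: nsets_def)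
      ultimately show ?thesis by (auto simp: seq_edges_def seq_verts_def)
    next
      case (Cons b bs')
      then have "b = False" using False by simp
      then have "explore_step k l False bs' K0 rest" using Ks K0 Cons by auto
      then have reg: "K0 \<inter> seq_verts rest \<in> seq_edges l rest" by (rule regular_stepD)
      have "card (nsets K0 l - seq_edges l rest) = (k choose l) - 1"
        by (rule new_edges_regular(1)[OF restV K0f(4) reg])
      then have "card (nsets K0 l - seq_edges l rest) \<noteq> 0" using s2 by linarith
      then have "nsets K0 l - seq_edges l rest \<noteq> {}" by (metis card.empty)
      moreover have "\<not> f \<subseteq> seq_verts rest" if f: "f \<in> nsets K0 l - seq_edges l rest" for f
      proof
        assume "f \<subseteq> seq_verts rest"
        then have "f \<subseteq> K0 \<inter> seq_verts rest" "card f = l" using f by (auto simp: nsets_def)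
        moreover have "card (K0 \<inter> seq_verts rest) = l" "finite (K0 \<inter> seq_verts rest)"
          using seq_edgesD[OF restV reg] by auto
        ultimately have "f = K0 \<inter> seq_verts rest" using card_subset_eq by metis
        then show False using f reg by blast
      qed
      ultimately show ?thesis by blast
    qed
    have h: "handle l Ks \<in> nsets K0 l \<and> handle l Ks \<notin> seq_edges l rest"
      unfolding handle_def K0 list.sel by (rule someI_ex) (use small in blast)
    then obtain x where x: "x \<in> handle l Ks" "x \<notin> seq_verts rest" using small by blast
    have xK0: "x \<in> K0" using x h by (auto simp: nsets_def)
    have hE: "handle l Ks \<in> \<E>" using h K0f(3) by (auto simp: cliques_def)
    from critical_edge_two_cliques[OF crit l k hE, of K0] obtain K where
      K: "K \<in> cliques k l \<E>" "handle l Ks \<in> nsets K l" "K \<noteq> K0" by blast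
    have Kf: "finite K" "card K = k" using K by (auto simp: cliques_def)
    have xK: "x \<in> K" using x K(2) by (auto simp: nsets_def)
    \<comment> \<open>Explored edges through the new vertex \<open>x\<close> stem from
      \<open>K0\<close>. As l \<ge> 2, every vertex of \<open>K\<close> lies in an edge of
      \<open>K\<close> through \<open>x\<close>, so \<open>K\<close> would be contained in
      \<open>K0\<close>.\<close>
    have "\<not> nsets K l \<subseteq> seq_edges l Ks"
    proof
      assume s: "nsets K l \<subseteq> seq_edges l Ks"
      have "K \<subseteq> K0"
      proof
        fix y assume y: "y \<in> K"
        show "y \<in> K0"
        proof (cases "y = x")
          case False
          have "l - 2 \<le> card (K - {x, y})" using Kf k xK y False by (simp add: card_Diff_subset)
          then obtain e where e: "e \<subseteq> K - {x, y}" "card e = l - 2" "finite e"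
            using obtain_subset_with_card_n by metis
          have "card (insert x (insert y e)) = Suc (Suc (l - 2))"
          proof -
            have "y \<notin> e" "x \<notin> insert y e" using e False by auto
            then show ?thesis using e by simp
          qed
          then have g: "insert x (insert y e) \<in> nsets K l" using e xK y l by (auto simp: nsets_def)
          then have "insert x (insert y e) \<in> nsets K0 l \<or> insert x (insert y e) \<in> seq_edges l rest"
            using s by (auto simp: K0 seq_edges_Cons)
          moreover have "insert x (insert y e) \<notin> seq_edges l rest"
            using x(2) seq_edgesD(1)[OF restV] by blast
          ultimately show ?thesis by (auto simp: nsets_def)
        qed (use xK0 in simp)
      qed
      then have "K = K0" using K0f Kf card_subset_eq by metis
      then show False using K(3) by simp
    qed
    moreover have "handle l Ks \<in> seq_edges l Ks" using h by (simp add: K0 seq_edges_Cons)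
    ultimately show ?thesis using goal[OF K(1,2)] by blast
  qed
qed

text \<open>Induction on \<open>T\<close>: as long as there are fewer than \<open>D\<close>
  degenerate steps and \<E> is not exhausted, another step can be made.\<close>

lemma exploration_exists:
  assumes crit: "critical k l \<E>" and l: "2 \<le> l" and k: "l < k" and V: "\<E> \<subseteq> nsets V l" and D: "1 \<le> D"
  shows "\<exists>bs Ks. Ks \<in> explorations k l V bs \<and> set Ks \<subseteq> cliques k l \<E> \<and> length bs \<le> T \<and>
    count_list bs True \<le> D \<and> (length bs = T \<or> count_list bs True = D \<or> seq_edges l Ks = \<E>)"
proof (induction T)
  case 0
  have "\<E> \<noteq> {}" by (rule critical_nonempty[OF crit less_imp_le[OF k]])
  then obtain f where "f \<in> \<E>" by blast
  from critical_edge_two_cliques[OF crit l k this] obtain K where K: "K \<in> cliques k l \<E>" by blast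
  then have "K \<in> nsets V k" by (rule clique_in_nsets[OF _ V]) (use l k in auto)
  then show ?case using K by (intro exI[of _ "[]"] exI[of _ "[K]"]) auto
next
  case (Suc T)
  then obtain bs Ks where IH: "Ks \<in> explorations k l V bs" "set Ks \<subseteq> cliques k l \<E>" "length bs \<le> T"
    "count_list bs True \<le> D" "length bs = T \<or> count_list bs True = D \<or> seq_edges l Ks = \<E>" by blast
  show ?case
  proof (cases "count_list bs True = D \<or> seq_edges l Ks = \<E>")
    case True
    then show ?thesis using IH by (intro exI[of _ bs] exI[of _ Ks]) auto
  next
    case False
    then obtain b K where "K \<in> cliques k l \<E>" "K # Ks \<in> explorations k l V (b # bs)"
      using exploration_extend[OF crit l k V IH(1,2)] by blast
    then show ?thesis using IH False by (intro exI[of _ "b # bs"] exI[of _ "K # Ks"]) auto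
  qed
qed

section \<open>Total weight of the explorations with a given pattern\<close>

definition seq_weight :: "real \<Rightarrow> nat \<Rightarrow> nat \<Rightarrow> 'a set list \<Rightarrow> real" where
  "seq_weight c l n Ks = c ^ card (seq_edges l Ks) / real n ^ card (seq_verts Ks)"

text \<open>At most n^(k - card A) sets \<open>K\<close> have \<open>K \<inter> W = A\<close>, and
  the weight of their new vertices cancels exactly this number. An extension therefore costs one
  unit for each admissible intersection, whatever n is.\<close>

lemma sum_extensions_le:
  assumes "1 \<le> n" "finite \<A>" "finite W"
  shows "(\<Sum>K\<in>{K \<in> nsets {..<n} k. K \<inter> W \<in> \<A>}. 1 / real n ^ card (K - W)) \<le> real (card \<A>)"
proof -
  define F where "F = (\<lambda>A. {K \<in> nsets {..<n} k. K \<inter> W = A})"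
  have finF: "finite (F A)" for A
    by (rule finite_subset[of _ "nsets {..<n} k"]) (auto simp: F_def finite_imp_finite_nsets)
  have "{K \<in> nsets {..<n} k. K \<inter> W \<in> \<A>} = (\<Union>A\<in>\<A>. F A)" by (auto simp: F_def)
  then have "(\<Sum>K\<in>{K \<in> nsets {..<n} k. K \<inter> W \<in> \<A>}. 1 / real n ^ card (K - W))
      = (\<Sum>A\<in>\<A>. \<Sum>K\<in>F A. 1 / real n ^ card (K - W))"
    using assms(2) finF by (simp only:) (intro sum.UNION_disjoint, auto simp: F_def)
  also have "\<dots> \<le> (\<Sum>A\<in>\<A>. 1)"
  proof (rule sum_mono)
    fix A
    have c: "card (K - W) = k - card A" if "K \<in> F A" for K
    proof -
      have K: "finite K" "card K = k" "K \<inter> W = A" using that by (auto simp: F_def nsets_def)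
      then show ?thesis using card_Diff_subset_Int[of K W] assms(3) by auto
    qed
    have "card (F A) \<le> card (nsets {..<n} (k - card A))"
    proof (rule card_inj_on_le[where f = "\<lambda>K. K - W"])
      show "inj_on (\<lambda>K. K - W) (F A)"
      proof (rule inj_onI)
        fix K L assume "K \<in> F A" "L \<in> F A" "K - W = L - W"
        then have "K \<inter> W = L \<inter> W" "K - W = L - W" by (auto simp: F_def)
        then have "(K \<inter> W) \<union> (K - W) = (L \<inter> W) \<union> (L - W)" by (simp only:)
        then show "K = L" by (simp only: Int_Diff_Un)
      qed
      show "(\<lambda>K. K - W) ` F A \<subseteq> nsets {..<n} (k - card A)"
      proof
        fix L assume "L \<in> (\<lambda>K. K - W) ` F A"
        then obtain K where K: "K \<in> F A" "L = K - W" by blast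
        then have "finite K" "K \<subseteq> {..<n}" by (auto simp: F_def nsets_def)
        then show "L \<in> nsets {..<n} (k - card A)" using c[OF K(1)] K(2) by (auto simp: nsets_def)
      qed
    qed (simp add: finite_imp_finite_nsets)
    also have "\<dots> \<le> n ^ (k - card A)" using choose_le_power by (simp add: card_nsets)
    finally have le: "real (card (F A)) \<le> real n ^ (k - card A)" by (metis of_nat_le_iff of_nat_power)
    have "(\<Sum>K\<in>F A. 1 / real n ^ card (K - W)) = real (card (F A)) / real n ^ (k - card A)"
      using c by simp
    also have "\<dots> \<le> 1" using le assms(1) by (simp add: divide_le_eq_1)
    finally show "(\<Sum>K\<in>F A. 1 / real n ^ card (K - W)) \<le> 1" .
  qed
  finally show ?thesis by simp
qed

text \<open>A set with at most k elements is coded by a list of length k, padded with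
  \<open>None\<close>.\<close>

lemma card_small_subsets_le:
  assumes "finite W"
  shows "card {A. A \<subseteq> W \<and> card A \<le> k} \<le> (card W + 1) ^ k"
proof -
  let ?X = "{xs. set xs \<subseteq> insert None (Some ` W) \<and> length xs = k}"
  have finX: "finite ?X" using assms by (intro finite_lists_length_eq) auto
  have "{A. A \<subseteq> W \<and> card A \<le> k} \<subseteq> (\<lambda>xs. {x. Some x \<in> set xs}) ` ?X"
  proof
    fix A assume A: "A \<in> {A. A \<subseteq> W \<and> card A \<le> k}"
    then have "finite A" using assms finite_subset by auto
    then obtain xs where xs: "set xs = A" "length xs = card A"
      using finite_distinct_list distinct_card by metis
    define ys where "ys = map Some xs @ replicate (k - card A) None"
    have "set ys \<subseteq> insert None (Some ` W)" using A xs by (auto simp: ys_def)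
    moreover have "length ys = k" using A xs by (simp add: ys_def)
    moreover have "{x. Some x \<in> set ys} = A" using xs by (auto simp: ys_def)
    ultimately show "A \<in> (\<lambda>xs. {x. Some x \<in> set xs}) ` ?X" by blast
  qed
  then have "card {A. A \<subseteq> W \<and> card A \<le> k} \<le> card ((\<lambda>xs. {x. Some x \<in> set xs}) ` ?X)"
    using finX by (intro card_mono) auto
  also have "\<dots> \<le> card ?X" by (rule card_image_le[OF finX])
  also have "\<dots> = card (insert None (Some ` W)) ^ k"
    using assms by (intro card_lists_length_eq) auto
  also have "card (insert None (Some ` W)) = card W + 1"
    using assms by (simp add: card_image)
  finally show ?thesis .
qed

text \<open>The cases differ in the possible intersections of the new clique with the old vertices:
  any small subset for a degenerate step, where the power of c is estimated by 1; any old edge for a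
  regular step after a degenerate one; the handle alone for the other regular steps. A regular step
  brings exactly (k choose l) - 1 factors c.\<close>

lemma sum_step_le:
  fixes c :: real and b :: bool
  assumes k: "l < k" and n: "1 \<le> n" and c: "0 < c" "c \<le> 1"
    and Ks: "Ks \<in> explorations k l {..<n} bs" and T: "length bs < T"
  defines "S \<equiv> \<Sum>K\<in>{K \<in> nsets {..<n} k. explore_step k l b bs K Ks}. seq_weight c l n (K # Ks)"
  shows "b \<Longrightarrow> S \<le> (real k * real T + 1) ^ k * seq_weight c l n Ks"
    and "\<not> b \<Longrightarrow> bs \<noteq> [] \<and> hd bs \<Longrightarrow>
      S \<le> c ^ ((k choose l) - 1) * (real (k choose l) * real T) * seq_weight c l n Ks"
    and "\<not> b \<Longrightarrow> \<not> (bs \<noteq> [] \<and> hd bs) \<Longrightarrow> S \<le> c ^ ((k choose l) - 1) * seq_weight c l n Ks"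
proof -
  define W where "W = seq_verts Ks"
  define w where "w = seq_weight c l n Ks"
  have sub: "set Ks \<subseteq> nsets {..<n} k" by (rule explorations_subset[OF Ks])
  have len: "length Ks \<le> T" using explorations_length[OF Ks] T by simp
  have finW: "finite W" "finite (seq_edges l Ks)" using seq_size[OF sub] by (simp_all add: W_def)
  have w0: "w \<ge> 0" using c by (simp add: w_def seq_weight_def)
  have weight: "seq_weight c l n (K # Ks) =
      w * (c ^ card (nsets K l - seq_edges l Ks) / real n ^ card (K - W))" if "K \<in> nsets {..<n} k" for K
  proof -
    have "finite K" using that by (auto simp: nsets_def)
    then show ?thesis
      using card_seq_Cons[OF sub, of K] by (simp add: seq_weight_def w_def W_def power_add)
  qed
  have reg: "(\<Sum>K\<in>X. seq_weight c l n (K # Ks)) \<le> c ^ ((k choose l) - 1) * real (card \<A>) * w"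
    if X: "X = {K \<in> nsets {..<n} k. K \<inter> W \<in> \<A>}" and A: "\<A> \<subseteq> seq_edges l Ks" for X \<A>
  proof -
    have finA: "finite \<A>" using A finW finite_subset by blast
    have "(\<Sum>K\<in>X. seq_weight c l n (K # Ks))
        = (\<Sum>K\<in>X. w * c ^ ((k choose l) - 1) * (1 / real n ^ card (K - W)))"
    proof (rule sum.cong)
      fix K assume K: "K \<in> X"
      then have "K \<in> nsets {..<n} k" "K \<inter> seq_verts Ks \<in> seq_edges l Ks" using A by (auto simp: X W_def)
      then show "seq_weight c l n (K # Ks) = w * c ^ ((k choose l) - 1) * (1 / real n ^ card (K - W))"
        using weight new_edges_regular(1)[OF sub] by simp
    qed simp
    also have "\<dots> = w * c ^ ((k choose l) - 1) * (\<Sum>K\<in>X. 1 / real n ^ card (K - W))"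
      by (rule sum_distrib_left[symmetric])
    also have "\<dots> \<le> w * c ^ ((k choose l) - 1) * real (card \<A>)"
      unfolding X using w0 c by (intro mult_left_mono sum_extensions_le n finA finW) auto
    finally show ?thesis by (simp add: mult_ac)
  qed
  show "S \<le> (real k * real T + 1) ^ k * seq_weight c l n Ks" if b
  proof -
    define \<A> where "\<A> = {A. A \<subseteq> W \<and> card A \<le> k}"
    have finA: "finite \<A>" using finW by (simp add: \<A>_def)
    have "S \<le> (\<Sum>K\<in>{K \<in> nsets {..<n} k. explore_step k l b bs K Ks}. w * (1 / real n ^ card (K - W)))"
      unfolding S_def
    proof (rule sum_mono)
      fix K assume K: "K \<in> {K \<in> nsets {..<n} k. explore_step k l b bs K Ks}"
      have "c ^ card (nsets K l - seq_edges l Ks) \<le> 1" using c by (intro power_le_one) auto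
      then have "w * (c ^ card (nsets K l - seq_edges l Ks) / real n ^ card (K - W))
          \<le> w * (1 / real n ^ card (K - W))"
        using w0 by (intro mult_left_mono divide_right_mono) auto
      then show "seq_weight c l n (K # Ks) \<le> w * (1 / real n ^ card (K - W))"
        using K weight by simp
    qed
    also have "\<dots> \<le> (\<Sum>K\<in>{K \<in> nsets {..<n} k. K \<inter> W \<in> \<A>}. w * (1 / real n ^ card (K - W)))"
    proof (rule sum_mono2)
      show "finite {K \<in> nsets {..<n} k. K \<inter> W \<in> \<A>}"
        by (rule finite_subset[of _ "nsets {..<n} k"]) (auto simp: finite_imp_finite_nsets)
      have "card (K \<inter> W) \<le> k" if "K \<in> nsets {..<n} k" for K
        using that card_mono[of K "K \<inter> W"] by (auto simp: nsets_def)
      then show "{K \<in> nsets {..<n} k. explore_step k l b bs K Ks} \<subseteq> {K \<in> nsets {..<n} k. K \<inter> W \<in> \<A>}"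
        by (auto simp: \<A>_def)
    qed (use w0 in simp)
    also have "\<dots> = w * (\<Sum>K\<in>{K \<in> nsets {..<n} k. K \<inter> W \<in> \<A>}. 1 / real n ^ card (K - W))"
      by (rule sum_distrib_left[symmetric])
    also have "\<dots> \<le> w * real (card \<A>)"
      using w0 by (intro mult_left_mono sum_extensions_le n finA finW)
    also have "\<dots> \<le> w * (real k * real T + 1) ^ k"
    proof (rule mult_left_mono[OF _ w0])
      have "card W \<le> k * T"
        unfolding W_def by (rule order.trans[OF seq_size(3)[OF sub] mult_left_mono[OF len]]) simp
      then have "real (card W) \<le> real k * real T" by (metis of_nat_le_iff of_nat_mult)
      then have "(real (card W) + 1) ^ k \<le> (real k * real T + 1) ^ k" by (simp add: power_mono)
      moreover have "real (card \<A>) \<le> real ((card W + 1) ^ k)"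
        unfolding \<A>_def by (intro of_nat_mono card_small_subsets_le finW)
      ultimately show "real (card \<A>) \<le> (real k * real T + 1) ^ k" by (simp add: add.commute)
    qed
    finally show ?thesis by (simp add: w_def mult.commute)
  qed
  show "S \<le> c ^ ((k choose l) - 1) * (real (k choose l) * real T) * seq_weight c l n Ks"
    if "\<not> b" "bs \<noteq> [] \<and> hd bs"
  proof -
    have "{K \<in> nsets {..<n} k. explore_step k l b bs K Ks} = {K \<in> nsets {..<n} k. K \<inter> W \<in> seq_edges l Ks}"
      using that by (auto simp: explore_step_def W_def)
    from reg[OF this order_refl] have "S \<le> c ^ ((k choose l) - 1) * real (card (seq_edges l Ks)) * w"
      by (simp add: S_def)
    also have "\<dots> \<le> c ^ ((k choose l) - 1) * (real (k choose l) * real T) * w"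
    proof -
      have "card (seq_edges l Ks) \<le> (k choose l) * T"
        by (rule order.trans[OF seq_size(4)[OF sub] mult_left_mono[OF len]]) simp
      then have "real (card (seq_edges l Ks)) \<le> real (k choose l) * real T" by (metis of_nat_le_iff of_nat_mult)
      then show ?thesis using w0 c by (intro mult_right_mono mult_left_mono) auto
    qed
    finally show ?thesis by (simp add: w_def)
  qed
  show "S \<le> c ^ ((k choose l) - 1) * seq_weight c l n Ks"
    if "\<not> b" "\<not> (bs \<noteq> [] \<and> hd bs)"
  proof -
    have "{K \<in> nsets {..<n} k. explore_step k l b bs K Ks}
        = {K \<in> nsets {..<n} k. K \<inter> W \<in> {handle l Ks} \<inter> seq_edges l Ks}"
      using that by (auto simp: explore_step_def W_def)
    from reg[OF this] have "S \<le> c ^ ((k choose l) - 1) * real (card ({handle l Ks} \<inter> seq_edges l Ks)) * w"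
      by (simp add: S_def)
    also have "\<dots> \<le> c ^ ((k choose l) - 1) * 1 * w"
    proof -
      have "card ({handle l Ks} \<inter> seq_edges l Ks) \<le> 1"
        using card_mono[of "{handle l Ks}" "{handle l Ks} \<inter> seq_edges l Ks"] by simp
      then show ?thesis using w0 c by (intro mult_right_mono mult_left_mono) auto
    qed
    finally show ?thesis by (simp add: w_def)
  qed
qed

lemma sum_explorations_Cons:
  assumes "finite V"
  shows "(\<Sum>Ks\<in>explorations k l V (b # bs). f Ks) =
    (\<Sum>Ks\<in>explorations k l V bs. \<Sum>K\<in>{K \<in> nsets V k. explore_step k l b bs K Ks}. f (K # Ks))"
proof -
  have fin: "finite {K \<in> nsets V k. explore_step k l b bs K Ks}" for Ks
    by (rule finite_subset[OF _ finite_imp_finite_nsets[OF assms, of k]]) auto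
  have "(\<Sum>Ks\<in>explorations k l V (b # bs). f Ks) =
    (\<Sum>Ks\<in>explorations k l V bs. \<Sum>L\<in>(\<lambda>K. K # Ks) ` {K \<in> nsets V k. explore_step k l b bs K Ks}. f L)"
    unfolding explorations.simps
    using finite_explorations[OF assms, of k l bs] fin by (intro sum.UNION_disjoint) auto
  also have "\<dots> = (\<Sum>Ks\<in>explorations k l V bs. \<Sum>K\<in>{K \<in> nsets V k. explore_step k l b bs K Ks}. f (K # Ks))"
    by (intro sum.cong refl) (simp add: sum.reindex inj_on_def)
  finally show ?thesis .
qed

text \<open>The factor on the left strengthens the induction: a degenerate step pays in advance for
  the choice of an edge by a regular step that may follow. So every degenerate step costs
  \<open>A1 * A2\<close>, and every regular step costs only \<open>z\<close>.\<close>

lemma sum_seq_weights_le: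
  fixes c :: real
  assumes k: "l < k" and n: "1 \<le> n" and c: "0 < c" "c \<le> 1" and T: "length bs \<le> T"
  defines "z \<equiv> c ^ ((k choose l) - 1)"
    and "A1 \<equiv> (real k * real T + 1) ^ k" and "A2 \<equiv> real (k choose l) * real T"
  shows "(\<Sum>Ks\<in>explorations k l {..<n} bs. seq_weight c l n Ks) * (if bs \<noteq> [] \<and> hd bs then A2 else 1)
    \<le> (A1 * A2) ^ count_list bs True * z ^ count_list bs False"
  using T
proof (induction bs)
  case Nil
  have "(\<Sum>Ks\<in>explorations k l {..<n} []. seq_weight c l n Ks)
      = (\<Sum>K\<in>nsets {..<n} k. seq_weight c l n [K])"
    by (simp add: sum.reindex inj_on_def)
  also have "\<dots> = (\<Sum>K\<in>nsets {..<n} k. c ^ (k choose l) * (1 / real n ^ k))"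
    by (intro sum.cong refl)
      (auto simp: seq_weight_def seq_edges_def seq_verts_def card_nsets nsets_def[of "{..<n}"])
  also have "\<dots> = c ^ (k choose l) * (real (n choose k) / real n ^ k)" by (simp add: card_nsets)
  also have "\<dots> \<le> 1 * 1"
  proof (rule mult_mono)
    have "real (n choose k) \<le> real n ^ k" using choose_le_power[of n k] by (metis of_nat_le_iff of_nat_power)
    then show "real (n choose k) / real n ^ k \<le> 1" using n by (simp add: divide_le_eq_1)
  qed (use c in \<open>auto intro: power_le_one\<close>)
  finally show ?case by simp
next
  case (Cons b bs)
  define B where "B = (\<Sum>Ks\<in>explorations k l {..<n} bs. seq_weight c l n Ks)"
  define B' where "B' = (\<Sum>Ks\<in>explorations k l {..<n} (b # bs). seq_weight c l n Ks)"
  have lenT: "length bs < T" "1 \<le> T" using Cons.prems by auto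
  have A: "A1 \<ge> 1" "A2 \<ge> 1"
  proof -
    show "A1 \<ge> 1" unfolding A1_def by (intro one_le_power) simp
    have "1 * 1 \<le> (k choose l) * T" using k lenT by (intro mult_mono) (auto simp: Suc_le_eq)
    then have "real (1 * 1) \<le> real ((k choose l) * T)" by (rule of_nat_mono)
    then show "A2 \<ge> 1" by (simp add: A2_def)
  qed
  have z: "z > 0" using c by (simp add: z_def)
  have B0: "B \<ge> 0" unfolding B_def using c by (intro sum_nonneg) (simp add: seq_weight_def)
  let ?fl = "if bs \<noteq> [] \<and> hd bs then A2 else 1"
  have IH: "B * ?fl \<le> (A1 * A2) ^ count_list bs True * z ^ count_list bs False"
    using Cons by (simp add: B_def)
  have le: "B' \<le> (\<Sum>Ks\<in>explorations k l {..<n} bs. x * seq_weight c l n Ks)"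
    if "\<And>Ks. Ks \<in> explorations k l {..<n} bs \<Longrightarrow>
      (\<Sum>K\<in>{K \<in> nsets {..<n} k. explore_step k l b bs K Ks}. seq_weight c l n (K # Ks))
        \<le> x * seq_weight c l n Ks" for x
    unfolding B'_def sum_explorations_Cons[OF finite_lessThan] using that by (rule sum_mono)
  have le': "B' \<le> x * B"
    if "\<And>Ks. Ks \<in> explorations k l {..<n} bs \<Longrightarrow>
      (\<Sum>K\<in>{K \<in> nsets {..<n} k. explore_step k l b bs K Ks}. seq_weight c l n (K # Ks))
        \<le> x * seq_weight c l n Ks" for x
    using le[OF that] by (simp add: B_def sum_distrib_left)
  have BB: "B \<le> B * ?fl" using B0 A by (simp add: mult_le_cancel_left1)
  show ?case
  proof (cases b)
    case True
    have "B' \<le> A1 * B"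
      by (rule le') (use sum_step_le(1)[OF k n c _ lenT(1)] True in \<open>simp add: A1_def\<close>)
    then have "B' * A2 \<le> (A1 * A2) * B" using A by (simp add: mult.commute mult.left_commute)
    also have "\<dots> \<le> (A1 * A2) * ((A1 * A2) ^ count_list bs True * z ^ count_list bs False)"
      using A BB IH by (intro mult_left_mono) auto
    finally show ?thesis using True by (simp add: B'_def)
  next
    case b: False
    have "B' \<le> z * (B * ?fl)"
    proof (cases "bs \<noteq> [] \<and> hd bs")
      case True
      have "B' \<le> (z * A2) * B"
        by (rule le') (use sum_step_le(2)[OF k n c _ lenT(1)] b True in \<open>simp add: A2_def z_def\<close>)
      then show ?thesis using True by (simp add: mult_ac)
    next
      case False
      have "B' \<le> z * B"
        by (rule le') (use sum_step_le(3)[OF k n c _ lenT(1)] b False in \<open>simp add: z_def\<close>)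
      then show ?thesis using False by (simp only: if_False mult_1_right)
    qed
    also have "\<dots> \<le> z * ((A1 * A2) ^ count_list bs True * z ^ count_list bs False)"
      using IH z by (intro mult_left_mono) auto
    finally show ?thesis using b by (simp add: B'_def mult_ac)
  qed
qed

text \<open>Dividing the hypothesis by (k choose l) - 1 gives v + x \<le> e / m, while Q^e = n powr
  (e / m) for Q = \<open>clique_scale l k n\<close>. Thus, up to n powr (- x), the weight bounds the
  probability that all e edges are present. The excess x is positive for dense explorations and may
  be negative for long ones.\<close>

lemma power_le_seq_weight:
  fixes p c x :: real
  assumes l: "2 \<le> l" and k: "l < k" and n: "1 \<le> n" and p: "0 \<le> p" "p \<le> c / clique_scale l k n"
    and x: "(real (k choose l) - 1) * (real v + x) \<le> real (k - l) * real e"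
  shows "p ^ e \<le> c ^ e / real n ^ v * real n powr (- x)"
proof -
  have s: "real (k choose l) - 1 > 0" using choose_ge_self[of l k] l k by simp
  have Q: "clique_scale l k n \<ge> 1" by (rule clique_scale_ge_1[OF l k n])
  have "real v + x \<le> real e / clique_ratio l k"
  proof -
    have "real e / clique_ratio l k = real (k - l) * real e / (real (k choose l) - 1)"
      using k s by (simp add: clique_ratio_def of_nat_diff mult.commute)
    then show ?thesis using x s by (simp add: pos_le_divide_eq mult.commute)
  qed
  then have "real n powr (real v + x) \<le> real n powr (real e / clique_ratio l k)"
    using n by (intro powr_mono) auto
  also have "\<dots> = clique_scale l k n ^ e"
    using n by (simp add: clique_scale_def powr_powr flip: powr_realpow)
  finally have Qe: "real n ^ v * real n powr x \<le> clique_scale l k n ^ e"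
    using n by (simp add: powr_add powr_realpow)
  have c0: "c \<ge> 0" using p Q by (smt (verit) divide_nonpos_pos divide_neg_pos)
  have "p ^ e \<le> (c / clique_scale l k n) ^ e" using p by (intro power_mono)
  also have "\<dots> = c ^ e / clique_scale l k n ^ e" by (simp add: power_divide)
  also have "\<dots> \<le> c ^ e / (real n ^ v * real n powr x)"
    using Qe n c0 Q by (intro divide_left_mono mult_pos_pos) auto
  also have "\<dots> = c ^ e / real n ^ v * real n powr (- x)" by (simp add: powr_minus_divide)
  finally show ?thesis .
qed

text \<open>More colours only help to avoid monochromatic cliques: a good 2-colouring is a colouring
  with r \<ge> 2 colours.\<close>

lemma not_two_colourable_if_ramsey:
  assumes r: "2 \<le> r" and V: "finite V"
    and ram: "arrows l r k V E"
  shows "\<not> two_colourable k l E"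
proof
  assume "two_colourable k l E"
  then obtain c where c: "good_colouring k l E c" by (auto simp: two_colourable_def)
  define col :: "'a set \<Rightarrow> nat" where "col = (\<lambda>e. if c e then 1 else 0)"
  have "col \<in> E \<rightarrow> {..<r}" using r by (auto simp: col_def)
  then obtain K i where K: "K \<in> nsets V k" "nsets K l \<subseteq> E" "\<forall>e\<in>nsets K l. col e = i"
    using ram unfolding ramsey_for_complete_iff[OF V] by blast
  then have "K \<in> cliques k l E" by (auto simp: cliques_def nsets_def)
  from good_colouringD[OF c this, of "i = 1"] obtain e where "e \<in> nsets K l" "c e \<noteq> (i = 1)" ..
  then show False using K(3) by (auto simp: col_def split: if_splits)
qed

lemma Union_seq_edges:
  assumes "set Ks \<subseteq> cliques k l \<E>" "1 \<le> l" "l \<le> k"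
  shows "\<Union>(seq_edges l Ks) = seq_verts Ks"
proof -
  have "\<Union>(nsets K l) = K" if "K \<in> set Ks" for K
  proof -
    have "K \<in> cliques k l \<E>" using that assms(1) by blast
    then show ?thesis using Union_nsets[of K l] assms by (simp add: cliques_def)
  qed
  then have "(\<Union>K\<in>set Ks. \<Union>(nsets K l)) = \<Union>(set Ks)" by simp
  moreover have "\<Union>(seq_edges l Ks) = (\<Union>K\<in>set Ks. \<Union>(nsets K l))" unfolding seq_edges_def by blast
  ultimately show ?thesis by (simp add: seq_verts_def)
qed

text \<open>The value of \<open>D\<close> cancels the constant l (k choose l) in
  \<open>exploration_excess\<close>, so the excess is positive after \<open>D\<close> degenerate
  steps. It is also positive when a critical subhypergraph is exhausted, by
  \<open>critical_dense\<close>. Hence both ways of stopping before \<open>T\<close> steps satisfy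
  the same inequality.\<close>

lemma exploration_witness:
  assumes l: "2 \<le> l" and k: "l < k" and E: "E \<subseteq> nsets V l" "finite V" and nc: "\<not> two_colourable k l E"
  defines "D \<equiv> l * (k choose l)"
  shows "\<exists>bs Ks. Ks \<in> explorations k l V bs \<and> seq_edges l Ks \<subseteq> E \<and> length bs \<le> T \<and> count_list bs True \<le> D \<and>
    (length bs = T \<or> ((k choose l) - 1) * card (seq_verts Ks) + 1 \<le> (k - l) * card (seq_edges l Ks))"
proof -
  have "finite E" by (rule finite_subset_nsets[OF E])
  moreover have "finite e \<and> card e = l" if "e \<in> E" for e using that E by (auto simp: nsets_def)
  ultimately obtain \<E> where \<E>: "\<E> \<subseteq> E" "critical k l \<E>" using ex_critical[OF _ _ nc] by blast
  have D: "1 \<le> D" using l k by (simp add: D_def Suc_le_eq)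
  have V: "\<E> \<subseteq> nsets V l" using \<E> E by blast
  from exploration_exists[OF \<E>(2) l k V D, of T] obtain bs Ks where
    Ks: "Ks \<in> explorations k l V bs" "set Ks \<subseteq> cliques k l \<E>" "length bs \<le> T" "count_list bs True \<le> D"
      "length bs = T \<or> count_list bs True = D \<or> seq_edges l Ks = \<E>" by blast
  have "seq_edges l Ks \<subseteq> E" using Ks(2) \<E>(1) unfolding seq_edges_def cliques_def by blast
  moreover have "((k choose l) - 1) * card (seq_verts Ks) + 1 \<le> (k - l) * card (seq_edges l Ks)"
    if "count_list bs True = D"
    using exploration_excess[OF l k Ks(1)] that k by (simp add: D_def)
  moreover have "((k choose l) - 1) * card (seq_verts Ks) + 1 \<le> (k - l) * card (seq_edges l Ks)"
    if "seq_edges l Ks = \<E>"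
  proof -
    have "\<Union>\<E> = seq_verts Ks" using Union_seq_edges[OF Ks(2)] that l k by simp
    then show ?thesis using critical_dense[OF \<E>(2) l k] that by simp
  qed
  ultimately show ?thesis using Ks by blast
qed

section \<open>The first moment computation\<close>

lemma finite_bool_lists: "finite {bs :: bool list. length bs \<le> T}"
  using finite_lists_length_le[of "UNIV :: bool set" T] by simp

lemma card_bool_lists: "card {bs :: bool list. length bs = t} = 2 ^ t"
  using card_lists_length_eq[of "UNIV :: bool set" t] by simp

lemma count_True_False: "count_list bs True + count_list bs False = length bs"
  by (induction bs) auto

text \<open>The two terms stand for the two kinds of witnesses. Positive excess gains n powr (- 1 /
  (s - 1)). A witness with \<open>T\<close> steps may lose n powr (2 l), but the total weight of all
  of these is at most M / 2^T. The factor \<open>M\<close> accounts for the at most l s degenerate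
  steps, each of which contributes \<open>A\<close> in place of \<open>z\<close>.\<close>

lemma prob_ramsey_le:
  fixes p :: real
  assumes l: "2 \<le> l" and k: "l < k" and r: "2 \<le> r" and n: "1 \<le> n" and T: "1 \<le> T"
    and p: "0 \<le> p" "p \<le> 1" "p \<le> (1 / 4) / clique_scale l k n"
  defines "s \<equiv> k choose l"
  defines "M \<equiv> (((real k * real T + 1) ^ k * (real s * real T)) / (1 / 4) ^ (s - 1)) ^ (l * s)"
  shows "ramsey_prob l r k n p
    \<le> M * (real T + 1) * real n powr (- (1 / (real s - 1))) + M * real n powr (2 * real l) * (1 / 2) ^ T"
proof -
  define V where "V = {..<n}"
  define c :: real where "c = 1 / 4"
  define z where "z = c ^ (s - 1)"
  define D where "D = l * s"
  define A where "A = (real k * real T + 1) ^ k * (real s * real T)"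
  define dense where "dense = (\<lambda>Ks :: nat set list. (s - 1) * card (seq_verts Ks) + 1 \<le> (k - l) * card (seq_edges l Ks))"
  define Bs where "Bs = {bs. length bs \<le> T \<and> count_list bs True \<le> D}"
  define cyl where "cyl = (\<lambda>Ks. {X :: nat set \<Rightarrow> bool. \<forall>e\<in>seq_edges l Ks. X e})"
  define P where "P = measure_pmf.prob (Pi_pmf (nsets V l) False (\<lambda>_. bernoulli_pmf p))"
  let ?w = "seq_weight c l n"
  let ?Ex = "explorations k l V"
  let ?\<theta> = "real n powr (- (1 / (real s - 1)))" and ?\<Lambda> = "real n powr (2 * real l)"
  have sk: "3 \<le> s" using choose_ge_self[of l k] l k by (simp add: s_def)
  have finV: "finite V" by (simp add: V_def)
  have finE: "finite (?Ex bs)" for bs by (rule finite_explorations[OF finV])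
  have finB: "finite Bs" by (rule finite_subset[OF _ finite_bool_lists[of T]]) (auto simp: Bs_def)
  have z: "0 < z" "z \<le> 1 / 4"
  proof -
    show "0 < z" by (simp add: z_def c_def)
    have "c ^ (s - 1) \<le> c ^ 1" using sk by (intro power_decreasing) (auto simp: c_def)
    then show "z \<le> 1 / 4" by (simp add: z_def c_def)
  qed
  have A1: "A \<ge> 1"
  proof -
    have "1 * 1 \<le> s * T" using sk T by (intro mult_mono) auto
    then have "real (1 * 1) \<le> real (s * T)" by (rule of_nat_mono)
    moreover have "1 \<le> (real k * real T + 1) ^ k" by (intro one_le_power) simp
    ultimately have "1 * 1 \<le> A" unfolding A_def by (intro mult_mono) auto
    then show ?thesis by simp
  qed
  have M: "M = A ^ D / z ^ D" unfolding M_def A_def z_def c_def D_def by (rule power_divide)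
  have M0: "M > 0" using A1 z by (simp add: M)
  have sumw: "(\<Sum>Ks\<in>?Ex bs. ?w Ks) \<le> M * z ^ length bs" if bs: "bs \<in> Bs" for bs
  proof -
    have b: "length bs \<le> T" "count_list bs True \<le> D" using bs by (auto simp: Bs_def)
    define fl where "fl = (if bs \<noteq> [] \<and> hd bs then real s * real T else 1)"
    have "1 * 1 \<le> s * T" using sk T by (intro mult_mono) auto
    then have "real (1 * 1) \<le> real (s * T)" by (rule of_nat_mono)
    then have fl: "fl \<ge> 1" by (simp add: fl_def)
    have w0: "0 \<le> (\<Sum>Ks\<in>?Ex bs. ?w Ks)" by (intro sum_nonneg) (simp add: seq_weight_def c_def)
    have "(\<Sum>Ks\<in>?Ex bs. ?w Ks) * 1 \<le> (\<Sum>Ks\<in>?Ex bs. ?w Ks) * fl"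
      using w0 fl by (intro mult_left_mono)
    also have "\<dots> \<le> A ^ count_list bs True * z ^ count_list bs False"
      unfolding fl_def A_def z_def s_def V_def
      by (rule sum_seq_weights_le[OF k n _ _ b(1)]) (simp_all add: c_def)
    also have "\<dots> \<le> A ^ D * (z ^ length bs / z ^ D)"
    proof (rule mult_mono)
      show "A ^ count_list bs True \<le> A ^ D" using A1 b(2) by (intro power_increasing)
      have "z ^ D \<le> z ^ count_list bs True" using z b(2) by (intro power_decreasing) auto
      then have "z ^ D * z ^ count_list bs False \<le> z ^ count_list bs True * z ^ count_list bs False"
        using z by (intro mult_right_mono) auto
      also have "\<dots> = z ^ length bs" by (simp add: count_True_False flip: power_add)
      finally show "z ^ count_list bs False \<le> z ^ length bs / z ^ D"
        using z by (simp add: pos_le_divide_eq mult.commute)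
    qed (use A1 z in auto)
    also have "\<dots> = M * z ^ length bs" by (simp add: M)
    finally show ?thesis by simp
  qed
  have cylP: "P (cyl Ks) = p ^ card (seq_edges l Ks)" if Ks: "Ks \<in> ?Ex bs" for Ks bs
  proof -
    have "seq_edges l Ks \<subseteq> nsets V l"
      using explorations_subset[OF Ks] by (fastforce simp: seq_edges_def nsets_def)
    then show ?thesis
      using prob_bernoulli_cylinder[of "nsets V l" "seq_edges l Ks" "{}" p] p finV
      by (simp add: P_def cyl_def finite_imp_finite_nsets)
  qed
  have dense_le: "P (cyl Ks) \<le> ?w Ks * ?\<theta>" if Ks: "Ks \<in> ?Ex bs" and d: "dense Ks" for Ks bs
  proof -
    have "real ((s - 1) * card (seq_verts Ks) + 1) \<le> real ((k - l) * card (seq_edges l Ks))"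
      using d unfolding dense_def by (rule of_nat_mono)
    then have "(real s - 1) * (real (card (seq_verts Ks)) + 1 / (real s - 1)) \<le> real (k - l) * real (card (seq_edges l Ks))"
      using sk by (simp add: of_nat_diff distrib_left)
    then show ?thesis
      unfolding cylP[OF Ks] seq_weight_def s_def
      by (intro power_le_seq_weight[OF l k n p(1)]) (use p(3) in \<open>simp_all add: c_def\<close>)
  qed
  have long_le: "P (cyl Ks) \<le> ?w Ks * ?\<Lambda>" if Ks: "Ks \<in> ?Ex bs" for Ks bs
  proof -
    have "(s - 1) * card (seq_verts Ks) \<le> (k - l) * card (seq_edges l Ks) + l * s"
      using exploration_excess[OF l k Ks] by (simp add: s_def)
    \<comment> \<open>The excess can be as low as - l s; division by s - 1 turns this into an
      exponent of at most 2 l.\<close>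
    also have "l * s \<le> 2 * l * (s - 1)"
    proof -
      have "s \<le> 2 * (s - 1)" using sk by linarith
      then have "l * s \<le> l * (2 * (s - 1))" by (rule mult_left_mono) simp
      then show ?thesis by (simp only: mult_ac)
    qed
    finally have "real ((s - 1) * card (seq_verts Ks)) \<le> real ((k - l) * card (seq_edges l Ks) + 2 * l * (s - 1))"
      by (intro of_nat_mono) (simp only: add_le_cancel_left)
    then have "(real s - 1) * (real (card (seq_verts Ks)) + (- (2 * real l))) \<le> real (k - l) * real (card (seq_edges l Ks))"
    proof -
      have "real (s - 1) = real s - 1" using sk by (simp add: of_nat_diff)
      then have "(real s - 1) * real (card (seq_verts Ks))
          \<le> real (k - l) * real (card (seq_edges l Ks)) + 2 * real l * (real s - 1)"
        using \<open>real (_ * _) \<le> _\<close> by (simp only: of_nat_mult of_nat_add of_nat_numeral)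
      moreover have "(real s - 1) * (real (card (seq_verts Ks)) + (- (2 * real l)))
          = (real s - 1) * real (card (seq_verts Ks)) - 2 * real l * (real s - 1)"
        by (simp add: algebra_simps)
      ultimately show ?thesis by linarith
    qed
    from power_le_seq_weight[OF l k n p(1,3) this[unfolded s_def]] show ?thesis
      unfolding cylP[OF Ks] seq_weight_def by (simp add: c_def)
  qed
  define S1 where "S1 = (\<lambda>bs. {Ks \<in> ?Ex bs. dense Ks})"
  define Bl where "Bl = {bs \<in> Bs. length bs = T}"
  have sub: "{X. arrows l r k {..<n} {e \<in> nsets {..<n} l. X e}}
      \<subseteq> (\<Union>bs\<in>Bs. \<Union>Ks\<in>S1 bs. cyl Ks) \<union> (\<Union>bs\<in>Bl. \<Union>Ks\<in>?Ex bs. cyl Ks)"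
  proof
    fix X assume "X \<in> {X. arrows l r k {..<n} {e \<in> nsets {..<n} l. X e}}"
    then have nc: "\<not> two_colourable k l {e \<in> nsets V l. X e}"
      using not_two_colourable_if_ramsey[OF r finV, of l k "{e \<in> nsets V l. X e}"] by (simp add: V_def)
    have "{e \<in> nsets V l. X e} \<subseteq> nsets V l" by blast
    from exploration_witness[OF l k this finV nc, of T] obtain bs Ks where
      w: "Ks \<in> ?Ex bs" "seq_edges l Ks \<subseteq> {e \<in> nsets V l. X e}" "length bs \<le> T" "count_list bs True \<le> D"
        "length bs = T \<or> dense Ks" unfolding D_def dense_def s_def by blast
    have "X \<in> cyl Ks" using w(2) by (auto simp: cyl_def)
    moreover have "bs \<in> Bs" using w by (simp add: Bs_def)
    ultimately show "X \<in> (\<Union>bs\<in>Bs. \<Union>Ks\<in>S1 bs. cyl Ks) \<union> (\<Union>bs\<in>Bl. \<Union>Ks\<in>?Ex bs. cyl Ks)"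
      using w(1,5) by (auto simp: S1_def Bl_def)
  qed
  have union: "P (\<Union>bs\<in>B. \<Union>Ks\<in>S bs. cyl Ks) \<le> (\<Sum>bs\<in>B. M * z ^ length bs) * x"
    if B: "B \<subseteq> Bs" and S: "\<And>bs. S bs \<subseteq> ?Ex bs" and x: "0 \<le> x"
      and le: "\<And>bs Ks. Ks \<in> S bs \<Longrightarrow> P (cyl Ks) \<le> ?w Ks * x"
    for B and S :: "bool list \<Rightarrow> nat set list set" and x
  proof -
    have fin: "finite B" "finite (S bs)" for bs
      using finite_subset[OF B finB] finite_subset[OF S finE] .
    have "P (\<Union>bs\<in>B. \<Union>Ks\<in>S bs. cyl Ks) \<le> (\<Sum>bs\<in>B. P (\<Union>Ks\<in>S bs. cyl Ks))"
      unfolding P_def by (rule measure_pmf.finite_measure_subadditive_finite) (use fin in auto)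
    also have "\<dots> \<le> (\<Sum>bs\<in>B. \<Sum>Ks\<in>S bs. P (cyl Ks))"
      unfolding P_def using fin by (intro sum_mono measure_pmf.finite_measure_subadditive_finite) auto
    also have "\<dots> \<le> (\<Sum>bs\<in>B. M * z ^ length bs * x)"
    proof (rule sum_mono)
      fix bs assume "bs \<in> B"
      then have bs: "bs \<in> Bs" using B by blast
      have "(\<Sum>Ks\<in>S bs. P (cyl Ks)) \<le> (\<Sum>Ks\<in>S bs. ?w Ks * x)" by (intro sum_mono le)
      also have "\<dots> \<le> (\<Sum>Ks\<in>?Ex bs. ?w Ks * x)"
        using finE S x by (intro sum_mono2) (auto simp: seq_weight_def c_def)
      also have "\<dots> = (\<Sum>Ks\<in>?Ex bs. ?w Ks) * x" by (rule sum_distrib_right[symmetric])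
      also have "\<dots> \<le> M * z ^ length bs * x" using sumw[OF bs] x by (intro mult_right_mono)
      finally show "(\<Sum>Ks\<in>S bs. P (cyl Ks)) \<le> M * z ^ length bs * x" .
    qed
    finally show ?thesis by (simp only: sum_distrib_right)
  qed
  have geom: "(\<Sum>bs\<in>{bs \<in> Bs. length bs = t}. M * z ^ length bs) \<le> M * (1 / 2) ^ t" for t
  proof -
    have "(\<Sum>bs\<in>{bs \<in> Bs. length bs = t}. M * z ^ length bs) = real (card {bs \<in> Bs. length bs = t}) * (M * z ^ t)"
      by simp
    also have "\<dots> \<le> real (2 ^ t) * (M * z ^ t)"
    proof (rule mult_right_mono)
      have "finite {bs :: bool list. length bs = t}"
        by (rule finite_subset[OF _ finite_bool_lists[of t]]) auto
      then have "card {bs \<in> Bs. length bs = t} \<le> card {bs :: bool list. length bs = t}"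
        by (intro card_mono) auto
      then show "real (card {bs \<in> Bs. length bs = t}) \<le> real (2 ^ t)"
        unfolding card_bool_lists by (rule of_nat_mono)
    qed (use M0 z in simp)
    \<comment> \<open>This is where c = 1 / 4 is small enough: z \<le> c outweighs the 2^t patterns
      and leaves (1 / 2)^t.\<close>
    also have "\<dots> = M * (2 * z) ^ t" by (simp add: power_mult_distrib)
    also have "\<dots> \<le> M * (1 / 2) ^ t" using M0 z by (intro mult_left_mono power_mono) auto
    finally show ?thesis .
  qed
  have "P (\<Union>bs\<in>Bs. \<Union>Ks\<in>S1 bs. cyl Ks) \<le> (\<Sum>bs\<in>Bs. M * z ^ length bs) * ?\<theta>"
    by (rule union) (auto simp: S1_def intro: dense_le)
  also have "\<dots> \<le> (M * (real T + 1)) * ?\<theta>"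
  proof (rule mult_right_mono)
    have "(\<Sum>bs\<in>Bs. M * z ^ length bs) = (\<Sum>t\<in>{..T}. \<Sum>bs\<in>{bs \<in> Bs. length bs = t}. M * z ^ length bs)"
      using finB by (intro sum.group[symmetric]) (auto simp: Bs_def)
    also have "\<dots> \<le> (\<Sum>t\<in>{..T}. M * 1)"
    proof (rule sum_mono)
      fix t
      have "M * (1 / 2) ^ t \<le> M * 1" using M0 by (intro mult_left_mono power_le_one) auto
      then show "(\<Sum>bs\<in>{bs \<in> Bs. length bs = t}. M * z ^ length bs) \<le> M * 1" using geom[of t] by linarith
    qed
    also have "\<dots> = M * (real T + 1)" by simp
    finally show "(\<Sum>bs\<in>Bs. M * z ^ length bs) \<le> M * (real T + 1)" .
  qed simp
  finally have 1: "P (\<Union>bs\<in>Bs. \<Union>Ks\<in>S1 bs. cyl Ks) \<le> M * (real T + 1) * ?\<theta>" .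
  have "P (\<Union>bs\<in>Bl. \<Union>Ks\<in>?Ex bs. cyl Ks) \<le> (\<Sum>bs\<in>Bl. M * z ^ length bs) * ?\<Lambda>"
    by (rule union) (auto simp: Bl_def intro: long_le)
  also have "\<dots> \<le> (M * (1 / 2) ^ T) * ?\<Lambda>"
    unfolding Bl_def by (intro mult_right_mono geom) simp
  finally have 2: "P (\<Union>bs\<in>Bl. \<Union>Ks\<in>?Ex bs. cyl Ks) \<le> M * ?\<Lambda> * (1 / 2) ^ T" by (simp add: mult_ac)
  have "ramsey_prob l r k n p
      = P {X. arrows l r k {..<n} {e \<in> nsets {..<n} l. X e}}"
    unfolding prob_random_hypergraph P_def V_def ..
  also have "\<dots> \<le> P ((\<Union>bs\<in>Bs. \<Union>Ks\<in>S1 bs. cyl Ks) \<union> (\<Union>bs\<in>Bl. \<Union>Ks\<in>?Ex bs. cyl Ks))"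
    unfolding P_def by (intro measure_pmf.finite_measure_mono sub) simp
  also have "\<dots> \<le> P (\<Union>bs\<in>Bs. \<Union>Ks\<in>S1 bs. cyl Ks) + P (\<Union>bs\<in>Bl. \<Union>Ks\<in>?Ex bs. cyl Ks)"
    unfolding P_def by (rule measure_Un_le) auto
  finally show ?thesis using 1 2 by linarith
qed

lemma log_power_over_power_tendsto_0:
  fixes a \<theta> :: real
  assumes "a > 0" "\<theta> > 0"
  shows "(\<lambda>n. (a * log 2 (real n) + 3) ^ E * real n powr (- \<theta>)) \<longlonglongrightarrow> 0"
  using assms by real_asymp

theorem ramsey_zero_statement:
  fixes l k r :: nat
  assumes l: "2 \<le> l" and k: "l < k" and r: "2 \<le> r"
    and p: "\<And>n. 0 \<le> p n \<and> p n \<le> 1"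
    and pc: "eventually (\<lambda>n. p n \<le> (1 / 4) / clique_scale l k n) sequentially"
  shows "(\<lambda>n. ramsey_prob l r k n (p n)) \<longlonglongrightarrow> 0"
proof -
  define s where "s = k choose l"
  define \<theta> where "\<theta> = 1 / (real s - 1)"
  define D where "D = l * s"
  define z :: real where "z = (1 / 4) ^ (s - 1)"
  define a where "a = 2 * real l + 1"
  define f where "f = (\<lambda>n. a * log 2 (real n) + 3)"
  define C where "C = (real k ^ k * real s / z) ^ D"
  \<comment> \<open>\<open>M\<close> contributes (k + 1) D logarithmic factors, and T + 1 one
    more.\<close>
  define E where "E = Suc (Suc k * D)"
  have sk: "3 \<le> s" using choose_ge_self[of l k] l k by (simp add: s_def)
  have \<theta>: "\<theta> > 0" using sk by (simp add: \<theta>_def)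
  have a: "a > 0" by (simp add: a_def)
  have z: "z > 0" by (simp add: z_def)
  have C0: "C \<ge> 0" using z by (simp add: C_def)
  let ?Pr = "\<lambda>n. ramsey_prob l r k n (p n)"
  have bound: "eventually (\<lambda>n. ?Pr n \<le> C * (f n ^ E * real n powr (- \<theta>)) + C * (f n ^ E * real n powr (- 1))) sequentially"
    using pc eventually_ge_at_top[of 1]
  proof eventually_elim
    case (elim n)
    \<comment> \<open>With a = 2 l + 1 the factor 2^(- T) outweighs n powr (2 l) and leaves 1 / n,
      while \<open>T\<close> stays logarithmic and \<open>M\<close> polylogarithmic. Rounding up and
      \<open>Suc\<close> account for the 3 in \<open>f\<close>.\<close>
    define T where "T = Suc (nat \<lceil>a * log 2 (real n)\<rceil>)"
    define M where "M = (((real k * real T + 1) ^ k * (real s * real T)) / z) ^ D"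
    have log0: "0 \<le> a * log 2 (real n)" using elim a by simp
    have Tf: "real T + 1 \<le> f n"
    proof -
      have "real (nat \<lceil>a * log 2 (real n)\<rceil>) \<le> a * log 2 (real n) + 1" using log0 by linarith
      then show ?thesis by (simp add: T_def f_def)
    qed
    have T1: "1 \<le> T" by (simp add: T_def)
    have f1: "1 \<le> f n" using Tf by linarith
    have "?Pr n \<le> M * (real T + 1) * real n powr (- \<theta>) + M * real n powr (2 * real l) * (1 / 2) ^ T"
      using prob_ramsey_le[OF l k r elim(2) T1 _ _ elim(1)] p
      by (simp add: M_def \<theta>_def s_def z_def D_def)
    moreover have MT: "M * (real T + 1) \<le> C * f n ^ E"
    proof -
      have "(real k * real T + 1) ^ k * (real s * real T) \<le> (real k * f n) ^ k * (real s * f n)"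
      proof (intro mult_mono power_mono)
        have "real k * real T + 1 \<le> real k * real T + real k" using k by simp
        also have "\<dots> = real k * (real T + 1)" by (simp add: distrib_left)
        also have "\<dots> \<le> real k * f n" using Tf by (intro mult_left_mono) auto
        finally show "real k * real T + 1 \<le> real k * f n" .
      qed (use Tf f1 in auto)
      then have "M \<le> (((real k * f n) ^ k * (real s * f n)) / z) ^ D"
        unfolding M_def using z by (intro power_mono divide_right_mono) auto
      also have "((real k * f n) ^ k * (real s * f n)) / z = (real k ^ k * real s / z) * f n ^ Suc k"
        by (simp add: power_mult_distrib)
      also have "\<dots> ^ D = C * f n ^ (Suc k * D)"
        by (simp only: C_def power_mult_distrib power_mult)
      finally have "M * (real T + 1) \<le> C * f n ^ (Suc k * D) * f n"
        using Tf f1 C0 by (intro mult_mono) auto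
      then show ?thesis by (simp add: E_def mult_ac)
    qed
    moreover have "real n powr (2 * real l) * (1 / 2) ^ T \<le> real n powr (- 1)"
    proof -
      have "a * log 2 (real n) \<le> real T" unfolding T_def by linarith
      then have "2 powr (a * log 2 (real n)) \<le> 2 powr real T" by (intro powr_mono) auto
      moreover have "2 powr (a * log 2 (real n)) = real n powr a"
      proof -
        have "2 powr (a * log 2 (real n)) = (2 powr log 2 (real n)) powr a" by (simp add: powr_powr mult.commute)
        then show ?thesis using elim(2) by simp
      qed
      ultimately have "real n powr a \<le> 2 ^ T" by (simp add: powr_realpow)
      then have "1 / 2 ^ T \<le> 1 / real n powr a" using elim(2) by (intro divide_left_mono) auto
      then have "real n powr (2 * real l) * (1 / 2 ^ T) \<le> real n powr (2 * real l) * (1 / real n powr a)"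
        by (intro mult_left_mono) auto
      also have "\<dots> = real n powr (2 * real l - a)" by (simp add: powr_diff)
      finally show ?thesis by (simp add: a_def power_one_over)
    qed
    moreover have M0: "0 \<le> M" using z by (simp add: M_def)
    ultimately have "?Pr n \<le> (C * f n ^ E) * real n powr (- \<theta>) + (M * (real T + 1)) * real n powr (- 1)"
    proof -
      assume 1: "?Pr n \<le> M * (real T + 1) * real n powr (- \<theta>) + M * real n powr (2 * real l) * (1 / 2) ^ T"
        and 2: "real n powr (2 * real l) * (1 / 2) ^ T \<le> real n powr (- 1)"
      have "M * (real T + 1) * real n powr (- \<theta>) \<le> (C * f n ^ E) * real n powr (- \<theta>)"
        using MT by (intro mult_right_mono) auto
      moreover have "M * (real n powr (2 * real l) * (1 / 2) ^ T) \<le> (M * (real T + 1)) * real n powr (- 1)"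
        using 2 M0 by (intro mult_mono) (auto simp: mult_le_cancel_left1)
      ultimately show ?thesis using 1 by (simp add: mult.assoc)
    qed
    also have "\<dots> \<le> (C * f n ^ E) * real n powr (- \<theta>) + (C * f n ^ E) * real n powr (- 1)"
      using MT by (intro add_left_mono mult_right_mono) auto
    finally show ?case by (simp only: mult.assoc)
  qed
  have "(\<lambda>n. C * (f n ^ E * real n powr (- \<theta>)) + C * (f n ^ E * real n powr (- 1))) \<longlonglongrightarrow> C * 0 + C * 0"
    unfolding f_def
    by (intro tendsto_add tendsto_mult_left log_power_over_power_tendsto_0 a \<theta>) simp
  then have lim: "(\<lambda>n. C * (f n ^ E * real n powr (- \<theta>)) + C * (f n ^ E * real n powr (- 1))) \<longlonglongrightarrow> 0" by simp
  show ?thesis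
    by (rule tendsto_sandwich[OF _ bound tendsto_const lim]) simp
qed

theorem theorem3:
  fixes k l r :: nat
  assumes "2 \<le> l" and "l < k" and "2 \<le> r"
  shows "\<exists>c C :: real. c > 0 \<and> C > 0 \<and>
    (\<forall>p :: nat \<Rightarrow> real. (\<forall>n. 0 \<le> p n \<and> p n \<le> 1) \<longrightarrow>
      ((\<forall>\<^sub>F n in sequentially.
          p n \<ge> C * real n powr (- 1 / max_l_density l (complete_hypergraph l k))) \<longrightarrow>
        (\<lambda>n. measure_pmf.prob (random_hypergraph l n (p n))
               {G. ramsey_for l r (complete_hypergraph l k) G}) \<longlonglongrightarrow> 1) \<and>
      ((\<forall>\<^sub>F n in sequentially.
          p n \<le> c * real n powr (- 1 / max_l_density l (complete_hypergraph l k))) \<longrightarrow>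
        (\<lambda>n. measure_pmf.prob (random_hypergraph l n (p n))
               {G. ramsey_for l r (complete_hypergraph l k) G}) \<longlonglongrightarrow> 0))"
proof -
  have scale: "x * real n powr (- 1 / max_l_density l (complete_hypergraph l k)) = x / clique_scale l k n" for x n
    by (simp add: max_l_density_complete[OF assms(1,2)] clique_scale_def powr_minus_divide)
  have "1 \<le> r" using assms(3) by simp
  from ramsey_one_statement[OF assms(1,2) this] obtain C where C: "C > 0"
    "\<And>p :: nat \<Rightarrow> real. (\<And>n. 0 \<le> p n \<and> p n \<le> 1) \<Longrightarrow>
      eventually (\<lambda>n. p n \<ge> C / clique_scale l k n) sequentially \<Longrightarrow>
      (\<lambda>n. ramsey_prob l r k n (p n)) \<longlonglongrightarrow> 1"
    by blast
  \<comment> \<open>The constant c = 1 / 4 serves all k, l and r, whereas C depends on them.\<close>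
  show ?thesis unfolding scale
    by (intro exI[of _ "1 / 4"] exI[of _ C] conjI allI impI C ramsey_zero_statement[OF assms]) auto
qed

end
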